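(* Let $S=\Bbbk[x_1,\ldots,x_n]$ with $\Bbbk$ an infinite field, and let $\mathfrak{a}=\mathfrak{f}+(G)$ be an almost complete intersection of degrees $(\mathbf{d};D)=(d_1,\ldots,d_h;D)$. If $D\le \sigma=\sum_{i=1}^h(d_i-1)$, then there exists an Artinian almost complete intersection $\overline{\mathfrak{a}}\subseteq \overline{S}=\Bbbk[x_1,\ldots,x_h]$ of degrees $(\mathbf{d};D)$ such that $\operatorname{HF}(S/\mathfrak{a};j)\le \operatorname{HF}(S/\overline{\mathfrak{a}}S;j)$ for all $j\in\mathbb{Z}$. In particular, $\operatorname{e}(S/\mathfrak{a})\le \operatorname{e}(\overline{S}/\overline{\mathfrak{a}})$.
   Context: $S$ is standard graded; $\operatorname{HF}(M;j)=\dim_\Bbbk M_j$ and $\operatorname{e}(M)$ is the multiplicity. A homogeneous ideal $\mathfrak{a}\subseteq S$ is an almost complete intersection of degrees $(\mathbf{d};D)=(d_1,\ldots,d_h;D)$ if $\operatorname{ht}(\mathfrak{a})=h$ and $\mathfrak{a}=\mathfrak{f}+(G)$, where $\mathfrak{f}=(f_1,\ldots,f_h)$ is generated by a homogeneous regular sequence of degrees $d_1\le\cdots\le d_h$ and $G$ is a homogeneous element of degree $D$ with $G\notin\mathfrak{f}$ ($\mathfrak{a}$ need not be minimally generated by $h+1$ elements). *)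

theory Defs
  imports Complex_Main "HOL-Library.Poly_Mapping" "HOL-Library.Extended_Nat"
    "HOL-Computational_Algebra.Polynomial"
begin

text \<open>Polynomials over a field in the variables x_0, x_1, ... (indexed by nat);
  a monomial is a finitely supported exponent vector.\<close>
type_synonym 'k mpoly = "(nat \<Rightarrow>\<^sub>0 nat) \<Rightarrow>\<^sub>0 'k"

text \<open>The polynomial ring S_n = k[x_0,...,x_(n-1)] (the paper's k[x_1,...,x_n]), as a subset.\<close>
definition polyring :: "nat \<Rightarrow> 'k::field mpoly set" where
  "polyring n = {p. \<forall>m\<in>Poly_Mapping.keys p. Poly_Mapping.keys m \<subseteq> {..<n}}"

definition mdeg :: "(nat \<Rightarrow>\<^sub>0 nat) \<Rightarrow> nat" where
  "mdeg m = (\<Sum>i\<in>Poly_Mapping.keys m. Poly_Mapping.lookup m i)"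

definition homog :: "'k::field mpoly \<Rightarrow> nat \<Rightarrow> bool" where
  "homog p j \<longleftrightarrow> (\<forall>m\<in>Poly_Mapping.keys p. mdeg m = j)"

definition smult_mp :: "'k::field \<Rightarrow> 'k mpoly \<Rightarrow> 'k mpoly" where
  "smult_mp c p = Poly_Mapping.map (\<lambda>x. c * x) p"

inductive_set ideal_gen :: "nat \<Rightarrow> 'k::field mpoly set \<Rightarrow> 'k mpoly set"
  for n :: nat and F :: "'k mpoly set" where
  zero: "0 \<in> ideal_gen n F"
| step: "g \<in> F \<Longrightarrow> c \<in> polyring n \<Longrightarrow> p \<in> ideal_gen n F \<Longrightarrow> c * g + p \<in> ideal_gen n F"

definition is_ideal :: "nat \<Rightarrow> 'k::field mpoly set \<Rightarrow> bool" where
  "is_ideal n I \<longleftrightarrow> I \<subseteq> polyring n \<and> 0 \<in> I \<and> (\<forall>a\<in>I. \<forall>b\<in>I. a + b \<in> I)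
     \<and> (\<forall>a\<in>I. \<forall>c\<in>polyring n. c * a \<in> I)"

definition is_prime :: "nat \<Rightarrow> 'k::field mpoly set \<Rightarrow> bool" where
  "is_prime n P \<longleftrightarrow> is_ideal n P \<and> P \<noteq> polyring n \<and>
     (\<forall>a\<in>polyring n. \<forall>b\<in>polyring n. a * b \<in> P \<longrightarrow> a \<in> P \<or> b \<in> P)"

definition ht_prime :: "nat \<Rightarrow> 'k::field mpoly set \<Rightarrow> enat" where
  "ht_prime n P = (SUP k \<in> {k. \<exists>C. (\<forall>i\<le>k. is_prime n (C i)) \<and> (\<forall>i<k. C i \<subset> C (Suc i)) \<and> C k = P}.
      enat k)"

definition ht :: "nat \<Rightarrow> 'k::field mpoly set \<Rightarrow> enat" where
  "ht n I = (INF P \<in> {P. is_prime n P \<and> I \<subseteq> P}. ht_prime n P)"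

definition regular_seq :: "nat \<Rightarrow> nat \<Rightarrow> (nat \<Rightarrow> 'k::field mpoly) \<Rightarrow> bool" where
  "regular_seq n h f \<longleftrightarrow> (\<forall>i<h. f i \<in> polyring n) \<and>
     (\<forall>i<h. \<forall>g\<in>polyring n. f i * g \<in> ideal_gen n (f ` {..<i}) \<longrightarrow> g \<in> ideal_gen n (f ` {..<i}))
     \<and> 1 \<notin> ideal_gen n (f ` {..<h})"

text \<open>Hilbert function of S_n / a: dimension over k of the degree-j piece (S_n)_j / a_j,
  i.e. the maximal number of degree-j forms linearly independent modulo a.\<close>
definition lin_indep_mod :: "'k::field mpoly set \<Rightarrow> 'k mpoly set \<Rightarrow> bool" where
  "lin_indep_mod a B \<longleftrightarrow> finite B \<and>
     (\<forall>c. (\<Sum>b\<in>B. smult_mp (c b) b) \<in> a \<longrightarrow> (\<forall>b\<in>B. c b = 0))"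

definition HF :: "nat \<Rightarrow> 'k::field mpoly set \<Rightarrow> int \<Rightarrow> nat" where
  "HF n a j = (if j < 0 then 0 else
     Sup {card B | B. B \<subseteq> {p \<in> polyring n. homog p (nat j)} \<and> lin_indep_mod a B})"

text \<open>Multiplicity of a standard graded module from its Hilbert function H:
  if H agrees for large j with a nonzero (Hilbert) polynomial P, then e = (deg P)! * lead coeff;
  otherwise (H eventually 0, Artinian case) e = length = sum of all H j.\<close>
definition multiplicity :: "(nat \<Rightarrow> nat) \<Rightarrow> real" where
  "multiplicity H = (if \<exists>P::real poly. P \<noteq> 0 \<and> (\<forall>\<^sub>F j in sequentially. real (H j) = poly P (real j))
     then (let P = (THE P::real poly. P \<noteq> 0 \<and> (\<forall>\<^sub>F j in sequentially. real (H j) = poly P (real j)))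
           in fact (Polynomial.degree P) * lead_coeff P)
     else suminf (\<lambda>j. real (H j)))"

definition aci :: "nat \<Rightarrow> nat \<Rightarrow> (nat \<Rightarrow> nat) \<Rightarrow> nat \<Rightarrow> (nat \<Rightarrow> 'k::field mpoly) \<Rightarrow> 'k mpoly
                    \<Rightarrow> 'k mpoly set \<Rightarrow> bool" where
  "aci n h d D f G a \<longleftrightarrow>
     regular_seq n h f \<and> (\<forall>i<h. homog (f i) (d i)) \<and> (\<forall>i j. i \<le> j \<longrightarrow> j < h \<longrightarrow> d i \<le> d j) \<and>
     G \<in> polyring n \<and> homog G D \<and> G \<notin> ideal_gen n (f ` {..<h}) \<and>
     a = ideal_gen n (f ` {..<h} \<union> {G}) \<and> ht n a = enat h"

text \<open>S_n / a is Artinian (finite-dimensional over k: Hilbert function eventually zero).\<close>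
definition artinian :: "nat \<Rightarrow> 'k::field mpoly set \<Rightarrow> bool" where
  "artinian n a \<longleftrightarrow> (\<exists>N. \<forall>j\<ge>N. HF n a (int j) = 0)"

end

theory Submission
  imports Defs "HOL-Library.FuncSet"
begin

text \<open>Write J = (f) and S_m for the polynomial ring in m variables. While the number of variables
  exceeds h, S/J has no socle, so (k being infinite) some linear form l is regular modulo J, and
  substituting it away keeps f a regular sequence and sums the Hilbert function of S/J. The form G
  may become zero modulo (J,l), but then G = l G' modulo J with (J : G) = (J : G'), so one may
  continue with G' of smaller degree. This ends with a complete intersection in S_h and a form G'
  of degree at most D outside of it; since the socle of that complete intersection lives in degree
  sigma, which is at least D, G' has a multiple of degree D that is still nonzero, and passing to
  a multiple only enlarges the colon ideal. As HF(S/a; j) = HF(S/J; j) - HF(S/(J : G); j - D), this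
  proves the bound on Hilbert functions.

  For the multiplicities it remains to see that S/a has Hilbert polynomial of degree n - h - 1. As a
  has height h, the sequence f, G is not regular, so G v lies in J for some v outside J; hence a is
  contained in (J : v), whose Hilbert function is bounded below by the same reduction.\<close>

text \<open>What survives the cuts is not G but a lower bound for the Hilbert function of S/(J : G):
  the image of (J : G) lies in the colon of the images. By the subtraction formula this bounds S/a
  from above. Undoing a cut by a regular linear form, like adding a variable, replaces a Hilbert
  function by its partial sums (\<open>psums\<close>). With m = n - h, all comparisons are therefore
  between m-fold partial sums of functions on \<open>polyring h\<close>.

  The linear form is always x_n - L with L in the earlier variables, so the quotient is literally
  the smaller \<open>polyring\<close> and no change of coordinates is needed.

  \<open>multiplicity\<close> reads off degree and leading coefficient, so an inequality of Hilbert
  functions alone does not suffice: a polynomial of smaller degree may have the larger normalised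
  leading coefficient. For m > 0, the bounds e * binomial(j + m - 1, m - 1) from above and
  binomial(j + m - 1, m - 1) from below pin the degree to m - 1. The Hilbert polynomial itself must
  be shown to exist, since otherwise \<open>multiplicity\<close> falls back to an infinite
  sum.\<close>

lemma smult_mp_eq: "smult_mp c p = Poly_Mapping.single 0 c * p"
  unfolding smult_mp_def by (rule mult_map_scale_conv_mult)

text \<open>The vector space is the whole ring in infinitely many variables, hence
  infinite-dimensional; graded pieces enter as subspaces contained in the span of finitely many
  monomials.\<close>

interpretation mp: vector_space "smult_mp :: 'k::field \<Rightarrow> 'k mpoly \<Rightarrow> 'k mpoly"
  by unfold_locales
    (simp_all add: smult_mp_eq distrib_left distrib_right single_add mult_single mult.assoc[symmetric])

abbreviation const_mp :: "'k::field \<Rightarrow> 'k mpoly" where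
  "const_mp c \<equiv> Poly_Mapping.single 0 c"

definition var :: "nat \<Rightarrow> 'k::field mpoly" where
  "var i = Poly_Mapping.single (Poly_Mapping.single i 1) 1"

section \<open>Polynomial rings and homogeneous components\<close>

lemma mdeg_add: "mdeg (a + b) = mdeg a + mdeg b"
  unfolding mdeg_def using setsum_keys_plus_distrib[of "\<lambda>k x. x" a b] by simp

lemma mdeg_0 [simp]: "mdeg 0 = 0"
  by (simp add: mdeg_def)

lemma mdeg_single [simp]: "mdeg (Poly_Mapping.single i e) = e"
  by (cases "e = 0") (simp_all add: mdeg_def)

lemma mdeg_eq_0_iff [simp]: "mdeg m = 0 \<longleftrightarrow> m = 0"
proof
  assume "mdeg m = 0"
  hence "\<forall>i\<in>Poly_Mapping.keys m. Poly_Mapping.lookup m i = 0"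
    by (simp add: mdeg_def)
  thus "m = 0" by (metis in_keys_iff keys_eq_empty all_not_in_conv)
qed simp

lemma polyring_0 [simp]: "0 \<in> polyring n"
  and polyring_const [simp]: "const_mp c \<in> polyring n"
  and polyring_1 [simp]: "1 \<in> polyring n"
  by (auto simp: polyring_def)

lemma polyring_add: "p \<in> polyring n \<Longrightarrow> q \<in> polyring n \<Longrightarrow> p + q \<in> polyring n"
  unfolding polyring_def using keys_add[of p q] by blast

lemma polyring_mult: 
  assumes "p \<in> polyring n" "q \<in> polyring n" shows "p * q \<in> polyring n"
  unfolding polyring_def
proof safe
  fix m x assume "m \<in> Poly_Mapping.keys (p * q)" and x: "x \<in> Poly_Mapping.keys m"
  then obtain a b where "m = a + b" "a \<in> Poly_Mapping.keys p" "b \<in> Poly_Mapping.keys q"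
    using keys_mult[of p q] by blast
  thus "x < n" using x assms keys_add[of a b] unfolding polyring_def by blast
qed

lemma polyring_uminus [simp]: "- p \<in> polyring n \<longleftrightarrow> p \<in> polyring n"
  by (simp add: polyring_def in_keys_iff)

lemma polyring_diff: "p \<in> polyring n \<Longrightarrow> q \<in> polyring n \<Longrightarrow> p - q \<in> polyring n"
  using polyring_add[of p n "- q"] by simp

lemma polyring_smult: "p \<in> polyring n \<Longrightarrow> smult_mp c p \<in> polyring n"
  by (simp add: smult_mp_eq polyring_mult)

lemma polyring_sum: "(\<And>i. i \<in> A \<Longrightarrow> p i \<in> polyring n) \<Longrightarrow> sum p A \<in> polyring n"
  by (induction A rule: infinite_finite_induct) (auto intro: polyring_add)

lemma polyring_prod: "(\<And>i. i \<in> A \<Longrightarrow> p i \<in> polyring n) \<Longrightarrow> prod p A \<in> polyring n"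
  by (induction A rule: infinite_finite_induct) (auto intro: polyring_mult)

lemma polyring_power: "p \<in> polyring n \<Longrightarrow> p ^ k \<in> polyring n"
  by (induction k) (auto intro: polyring_mult)

lemma polyring_var [simp]: "var i \<in> polyring n \<longleftrightarrow> i < n"
  by (simp add: polyring_def var_def)

lemma polyring_mono: "n \<le> m \<Longrightarrow> p \<in> polyring n \<Longrightarrow> p \<in> polyring m"
  unfolding polyring_def by fastforce

lemma homog_0 [simp]: "homog 0 j"
  by (simp add: homog_def)

lemma homog_const [simp]: "homog (const_mp c) 0"
  and homog_1 [simp]: "homog 1 0"
  by (auto simp: homog_def)

lemma homog_var [simp]: "homog (var i) 1" "homog (var i) (Suc 0)"
  by (simp_all add: homog_def var_def)

lemma homog_add: "homog p j \<Longrightarrow> homog q j \<Longrightarrow> homog (p + q) j"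
  unfolding homog_def using keys_add[of p q] by blast

lemma homog_uminus [simp]: "homog (- p) j \<longleftrightarrow> homog p j"
  by (simp add: homog_def in_keys_iff)

lemma homog_diff: "homog p j \<Longrightarrow> homog q j \<Longrightarrow> homog (p - q) j"
  using homog_add[of p j "- q"] by simp

lemma homog_sum: "(\<And>i. i \<in> A \<Longrightarrow> homog (p i) j) \<Longrightarrow> homog (sum p A) j"
  by (induction A rule: infinite_finite_induct) (auto intro: homog_add)

lemma homog_mult: assumes "homog p i" "homog q j" shows "homog (p * q) (i + j)"
  unfolding homog_def
proof
  fix m assume "m \<in> Poly_Mapping.keys (p * q)"
  then obtain a b where "m = a + b" "a \<in> Poly_Mapping.keys p" "b \<in> Poly_Mapping.keys q"
    using keys_mult[of p q] by blast
  thus "mdeg m = i + j" using assms by (simp add: homog_def mdeg_add)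
qed

lemma homog_smult: "homog p j \<Longrightarrow> homog (smult_mp c p) j"
  using homog_mult[of "const_mp c" 0 p j] by (simp add: smult_mp_eq)

lemma homog_power: "homog p i \<Longrightarrow> homog (p ^ k) (k * i)"
  by (induction k) (auto dest: homog_mult)

definition hcomp :: "nat \<Rightarrow> 'k::field mpoly \<Rightarrow> 'k mpoly" where
  "hcomp j p = Poly_Mapping.mapp (\<lambda>m c. c when mdeg m = j) p"

lemma lookup_hcomp: "Poly_Mapping.lookup (hcomp j p) m = (Poly_Mapping.lookup p m when mdeg m = j)"
  by (auto simp: hcomp_def lookup_mapp when_def in_keys_iff)

lemma keys_hcomp: "Poly_Mapping.keys (hcomp j p) = {m \<in> Poly_Mapping.keys p. mdeg m = j}"
  by (auto simp: in_keys_iff lookup_hcomp)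

lemma homog_hcomp [simp]: "homog (hcomp j p) j"
  by (simp add: homog_def keys_hcomp)

lemma polyring_hcomp: "p \<in> polyring n \<Longrightarrow> hcomp j p \<in> polyring n"
  by (auto simp: polyring_def keys_hcomp)

lemma hcomp_0 [simp]: "hcomp j 0 = 0"
  by (rule poly_mapping_eqI) (simp add: lookup_hcomp)

lemma hcomp_add: "hcomp j (p + q) = hcomp j p + hcomp j q"
  by (rule poly_mapping_eqI) (simp add: lookup_hcomp lookup_add when_add_distrib)

lemma hcomp_sum: "hcomp j (sum p A) = (\<Sum>i\<in>A. hcomp j (p i))"
  by (induction A rule: infinite_finite_induct) (auto simp: hcomp_add)

lemma hcomp_homog: "homog p i \<Longrightarrow> hcomp j p = (if i = j then p else 0)"
  by (rule poly_mapping_eqI) (auto simp: lookup_hcomp when_def homog_def in_keys_iff)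

lemma sum_hcomp: "p = (\<Sum>i\<in>mdeg ` Poly_Mapping.keys p. hcomp i p)"
proof (rule poly_mapping_eqI)
  fix m
  have "(\<Sum>i\<in>mdeg ` Poly_Mapping.keys p. Poly_Mapping.lookup (hcomp i p) m)
      = (\<Sum>i\<in>mdeg ` Poly_Mapping.keys p. if mdeg m = i then Poly_Mapping.lookup p m else 0)"
    by (rule sum.cong) (auto simp: lookup_hcomp when_def)
  also have "\<dots> = Poly_Mapping.lookup p m"
    by (subst sum.delta') (auto simp: in_keys_iff)
  finally show "Poly_Mapping.lookup p m
      = Poly_Mapping.lookup (\<Sum>i\<in>mdeg ` Poly_Mapping.keys p. hcomp i p) m"
    by (simp add: lookup_sum)
qed

text \<open>After expanding p into components, only the one of index j - e survives. The zero branch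
  covers j < e, where j - e would be truncated. This is the tool that cuts every membership relation
  down to a single degree.\<close>

lemma hcomp_mult:
  assumes "homog g e"
  shows "hcomp j (g * p) = (if e \<le> j then g * hcomp (j - e) p else 0)"
proof -
  let ?A = "mdeg ` Poly_Mapping.keys p"
  have "hcomp j (g * p) = hcomp j (\<Sum>i\<in>?A. g * hcomp i p)"
    by (subst (1) sum_hcomp[of p]) (simp only: sum_distrib_left)
  also have "\<dots> = (\<Sum>i\<in>?A. hcomp j (g * hcomp i p))"
    by (rule hcomp_sum)
  also have "\<dots> = (\<Sum>i\<in>?A. if e + i = j then g * hcomp i p else 0)"
    using homog_mult[OF assms homog_hcomp] by (intro sum.cong refl) (simp add: hcomp_homog)
  also have "\<dots> = (if e \<le> j then g * hcomp (j - e) p else 0)"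
  proof (cases "e \<le> j")
    case True
    have "(\<Sum>i\<in>?A. if e + i = j then g * hcomp i p else 0)
        = (\<Sum>i\<in>?A. if j - e = i then g * hcomp i p else 0)"
      using True by (intro sum.cong) auto
    also have "\<dots> = (if j - e \<in> ?A then g * hcomp (j - e) p else 0)"
      by (rule sum.delta') simp
    also have "\<dots> = g * hcomp (j - e) p"
    proof (cases "j - e \<in> ?A")
      case False
      hence "Poly_Mapping.keys (hcomp (j - e) p) = {}"
        by (auto simp: keys_hcomp image_iff)
      thus ?thesis using False by simp
    qed simp
    finally show ?thesis using True by simp
  qed (auto intro: sum.neutral)
  finally show ?thesis .
qed

definition forms :: "nat \<Rightarrow> nat \<Rightarrow> 'k::field mpoly set" where
  "forms n j = {p \<in> polyring n. homog p j}"

lemma forms_0 [simp]: "0 \<in> forms n j"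
  by (simp add: forms_def)

lemma forms_add: "p \<in> forms n j \<Longrightarrow> q \<in> forms n j \<Longrightarrow> p + q \<in> forms n j"
  and forms_diff: "p \<in> forms n j \<Longrightarrow> q \<in> forms n j \<Longrightarrow> p - q \<in> forms n j"
  by (auto simp: forms_def intro: polyring_add homog_add polyring_diff homog_diff)

lemma forms_mult: "p \<in> forms n i \<Longrightarrow> q \<in> forms n j \<Longrightarrow> p * q \<in> forms n (i + j)"
  by (auto simp: forms_def intro: polyring_mult homog_mult)

lemma forms_hcomp: "p \<in> polyring n \<Longrightarrow> hcomp j p \<in> forms n j"
  by (simp add: forms_def polyring_hcomp)

lemma forms_polyring: "p \<in> forms n j \<Longrightarrow> p \<in> polyring n"
  by (simp add: forms_def)

lemma hcomp_forms: "p \<in> forms n i \<Longrightarrow> hcomp j p = (if i = j then p else 0)"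
  by (simp add: forms_def hcomp_homog)

lemma var_forms: "i < n \<Longrightarrow> var i \<in> forms n 1"
  by (simp add: forms_def)

lemma subspace_forms: "mp.subspace (forms n j)"
  by (auto simp: mp.subspace_def forms_def intro: polyring_add homog_add polyring_smult homog_smult)

section \<open>Counting monomials to bound dimensions\<close>

definition monomials_upto :: "nat \<Rightarrow> nat \<Rightarrow> (nat \<Rightarrow>\<^sub>0 nat) set" where
  "monomials_upto n j = {m. Poly_Mapping.keys m \<subseteq> {..<n} \<and> mdeg m \<le> j}"

lemma lookup_le_mdeg: "Poly_Mapping.lookup m i \<le> mdeg m"
proof (cases "i \<in> Poly_Mapping.keys m")
  case True
  thus ?thesis unfolding mdeg_def by (intro member_le_sum) auto
next
  case False
  thus ?thesis by (simp add: in_keys_iff)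
qed

text \<open>Exponent vectors lie in the cube {0..j}^n; this crude bound suffices because only its
  order of growth in j matters. Degrees up to j, not exactly j, are counted since the bound on
  chains of primes uses inhomogeneous elements.\<close>

lemma monomials_upto_bound: "finite (monomials_upto n j) \<and> card (monomials_upto n j) \<le> (j + 1) ^ n"
proof -
  let ?r = "\<lambda>m :: nat \<Rightarrow>\<^sub>0 nat. restrict (Poly_Mapping.lookup m) {..<n}"
  have inj: "inj_on ?r (monomials_upto n j)"
  proof (rule inj_onI)
    fix a b assume a: "a \<in> monomials_upto n j" and b: "b \<in> monomials_upto n j" and eq: "?r a = ?r b"
    show "a = b"
    proof (rule poly_mapping_eqI)
      fix k show "Poly_Mapping.lookup a k = Poly_Mapping.lookup b k"
      proof (cases "k < n")
        case True thus ?thesis using fun_cong[OF eq, of k] by simp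
      next
        case False
        hence "k \<notin> Poly_Mapping.keys a" "k \<notin> Poly_Mapping.keys b"
          using a b by (auto simp: monomials_upto_def)
        thus ?thesis by (simp add: in_keys_iff)
      qed
    qed
  qed
  have sub: "?r ` monomials_upto n j \<subseteq> PiE {..<n} (\<lambda>_. {..j})"
  proof (rule image_subsetI)
    fix m assume "m \<in> monomials_upto n j"
    hence "Poly_Mapping.lookup m i \<le> j" for i
      using lookup_le_mdeg[of m i] by (simp add: monomials_upto_def)
    thus "?r m \<in> PiE {..<n} (\<lambda>_. {..j})" by auto
  qed
  have fin: "finite (PiE {..<n} (\<lambda>_. {..j}))" by (intro finite_PiE) auto
  have "card (monomials_upto n j) = card (?r ` monomials_upto n j)" by (simp add: card_image inj)
  also have "\<dots> \<le> card (PiE {..<n} (\<lambda>_. {..j}))" by (rule card_mono[OF fin sub])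
  finally show ?thesis
    using finite_imageD[OF finite_subset[OF sub fin] inj] by (simp add: card_PiE)
qed

lemma poly_eq_sum_single:
  "p = (\<Sum>m\<in>Poly_Mapping.keys p. Poly_Mapping.single m (Poly_Mapping.lookup p m))"
proof (rule poly_mapping_eqI)
  fix k
  show "Poly_Mapping.lookup p k = Poly_Mapping.lookup
     (\<Sum>m\<in>Poly_Mapping.keys p. Poly_Mapping.single m (Poly_Mapping.lookup p m)) k"
    unfolding lookup_sum lookup_single when_def by (simp add: in_keys_iff)
qed

lemma single_conv_smult: "Poly_Mapping.single m c = smult_mp c (Poly_Mapping.single m 1)"
  by (simp add: smult_mp_eq mult_single)

lemma span_monomials:
  assumes "\<And>m. m \<in> Poly_Mapping.keys p \<Longrightarrow> m \<in> M"
  shows "p \<in> mp.span ((\<lambda>m. Poly_Mapping.single m 1) ` M)"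
proof (subst poly_eq_sum_single[of p], rule mp.span_sum)
  fix m assume "m \<in> Poly_Mapping.keys p"
  thus "Poly_Mapping.single m (Poly_Mapping.lookup p m)
      \<in> mp.span ((\<lambda>m. Poly_Mapping.single m 1) ` M)"
    using assms by (subst single_conv_smult) (intro mp.span_scale mp.span_base imageI)
qed

lemma forms_span: "(forms n j :: 'k::field mpoly set) \<subseteq> mp.span ((\<lambda>m. Poly_Mapping.single m 1) ` monomials_upto n j)"
proof
  fix p :: "'k mpoly" assume "p \<in> forms n j"
  hence "m \<in> monomials_upto n j" if "m \<in> Poly_Mapping.keys p" for m
    using that by (auto simp: forms_def polyring_def homog_def monomials_upto_def)
  thus "p \<in> mp.span ((\<lambda>m. Poly_Mapping.single m 1) ` monomials_upto n j)"
    by (rule span_monomials)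
qed

lemma forms_fin:
  obtains W where "finite W" "(forms n j :: 'k::field mpoly set) \<subseteq> mp.span W"
  using that[OF _ forms_span] monomials_upto_bound by simp

lemma poly_single_induct [case_names add single]:
  assumes "\<And>p q. P p \<Longrightarrow> P q \<Longrightarrow> P (p + q)" "\<And>m c. P (Poly_Mapping.single m c)"
  shows "P (p :: 'k::field mpoly)"
proof -
  have "P (sum f A)" if "\<And>m. m\<in>A \<Longrightarrow> P (f m)" for f :: "(nat \<Rightarrow>\<^sub>0 nat) \<Rightarrow> 'k mpoly" and A
    using that assms(2)[of 0 0]
    by (induction A rule: infinite_finite_induct) (auto intro: assms(1))
  from this[OF assms(2)] have "P (\<Sum>m\<in>Poly_Mapping.keys p. Poly_Mapping.single m (Poly_Mapping.lookup p m))"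
    by this
  thus ?thesis by (simp only: poly_eq_sum_single[of p, symmetric])
qed

section \<open>Dimension counting\<close>

context vector_space
begin

text \<open>As the ambient space is infinite-dimensional, finiteness is supplied by a finite W whose
  span contains V, here and in the lemmas that follow.\<close>

lemma independent_finite_card_le_dim:
  assumes "finite W" "V \<subseteq> span W" "B \<subseteq> V" "independent B"
  shows "finite B \<and> card B \<le> dim V"
proof -
  obtain C where C: "C \<subseteq> V" "independent C" "V \<subseteq> span C" "card C = dim V"
    by (rule basis_exists)
  have "finite C" using independent_span_bound[OF assms(1) C(2)] C(1) assms(2) by auto
  thus ?thesis using independent_span_bound[of C B] assms(3,4) C by auto
qed

lemma dim_mono_finite:
  assumes "finite W" "V \<subseteq> span W" "U \<subseteq> V"
  shows "dim U \<le> dim V"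
proof -
  obtain B where "B \<subseteq> U" "independent B" "U \<subseteq> span B" "card B = dim U"
    by (rule basis_exists)
  thus ?thesis using independent_finite_card_le_dim[OF assms(1,2), of B] assms(3) by auto
qed

lemma span_disjoint_parts:
  assumes "independent C" "finite C" "B \<subseteq> C" "x \<in> span B" "x \<in> span (C - B)"
  shows "x = 0"
proof -
  have fin: "finite B" "finite (C - B)" using assms finite_subset by auto
  obtain u where u: "x = (\<Sum>v\<in>B. u v *s v)" using assms(4) fin span_finite[of B] by auto
  obtain w where w: "x = (\<Sum>v\<in>C - B. w v *s v)" using assms(5) fin span_finite by auto
  let ?f = "\<lambda>v. if v \<in> B then u v else - w v"
  have "(\<Sum>v\<in>C. ?f v *s v) = (\<Sum>v\<in>B. ?f v *s v) + (\<Sum>v\<in>C - B. ?f v *s v)"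
    using sum.subset_diff[OF assms(3,2), of "\<lambda>v. ?f v *s v"] by (simp only: add.commute)
  also have "(\<Sum>v\<in>B. ?f v *s v) = x" using u by (simp cong: sum.cong)
  also have "(\<Sum>v\<in>C - B. ?f v *s v) = - x"
    unfolding w sum_negf[symmetric] by (intro sum.cong) auto
  finally have "(\<Sum>v\<in>C. ?f v *s v) = 0" by simp
  hence "?f v = 0" if "v \<in> C" for v
    using independentD[OF assms(1,2) subset_refl _ that, of ?f] by simp
  hence "\<forall>v\<in>B. u v = 0" using assms(3) by force
  thus ?thesis using u by simp
qed

lemma basis_extension:
  assumes "finite W" "V \<subseteq> span W" "U \<subseteq> V"
  obtains A C where "A \<subseteq> C" "A \<subseteq> U" "C \<subseteq> V" "independent C" "finite C"
    "U \<subseteq> span A" "V \<subseteq> span C" "card A = dim U" "card C = dim V"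
proof -
  obtain A where A: "A \<subseteq> U" "independent A" "U \<subseteq> span A" "card A = dim U"
    by (rule basis_exists)
  hence "A \<subseteq> V" using assms(3) by blast
  then obtain C where C: "A \<subseteq> C" "C \<subseteq> V" "independent C" "V \<subseteq> span C"
    using maximal_independent_subset_extend[OF _ A(2)] by blast
  have "finite C" using independent_finite_card_le_dim[OF assms(1,2) C(2,3)] by simp
  thus ?thesis using that[OF C(1) A(1) C(2,3) _ A(3) C(4) A(4)] basis_card_eq_dim C by blast
qed

text \<open>A basis A of the kernel is extended to a basis C of V; T is injective on the span of C -
  A and maps that part onto a basis of the image.\<close>

lemma rank_nullity:
  assumes T: "Vector_Spaces.linear scale scale T" and V: "subspace V" and fin: "finite W" "V \<subseteq> span W"
  shows "dim V = dim (T ` V) + dim {v\<in>V. T v = 0}"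
proof -
  interpret T: Vector_Spaces.linear scale scale T by fact
  let ?K = "{v\<in>V. T v = 0}"
  obtain A C where AC: "A \<subseteq> C" "A \<subseteq> ?K" "C \<subseteq> V" "independent C" "finite C"
    "?K \<subseteq> span A" "V \<subseteq> span C" "card A = dim ?K" "card C = dim V"
    using basis_extension[OF fin, of ?K] by blast
  let ?E = "C - A"
  have spE: "span ?E \<subseteq> V" using AC(3) V by (intro span_minimal) auto
  have inj: "inj_on T (span ?E)"
  proof (subst T.inj_on_iff_eq_0)
    show "\<forall>x\<in>span ?E. T x = 0 \<longrightarrow> x = 0"
      using AC(6) spE span_disjoint_parts[OF AC(4,5,1)] by blast
  qed simp
  have indE: "independent ?E" using AC(4) independent_mono by blast
  interpret vp: vector_space_pair scale scale by unfold_locales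
  have ind: "independent (T ` ?E)"
    using vp.linear_independent_injective_image[OF T indE inj] .
  have "T ` V \<subseteq> span (T ` ?E)"
  proof -
    have "T ` V \<subseteq> span (T ` C)" using AC(7) T.span_image[of C] by blast
    also have "T ` C \<subseteq> span (T ` ?E)"
    proof
      fix y assume "y \<in> T ` C"
      then obtain c where c: "c \<in> C" "y = T c" by blast
      show "y \<in> span (T ` ?E)"
      proof (cases "c \<in> A")
        case True
        hence "y = 0" using AC(2) c by auto
        thus ?thesis by (simp add: span_zero)
      qed (use c span_base in auto)
    qed
    hence "span (T ` C) \<subseteq> span (T ` ?E)" by (simp add: span_minimal)
    finally show ?thesis .
  qed
  moreover have "T ` ?E \<subseteq> T ` V" using AC(3) by blast
  ultimately have "dim (T ` V) = card (T ` ?E)" using ind basis_card_eq_dim by metis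
  also have "\<dots> = card ?E"
    using inj span_superset by (intro card_image) (meson inj_on_subset)
  also have "\<dots> = dim V - dim ?K"
    using AC by (simp add: card_Diff_subset finite_subset)
  finally show ?thesis using AC card_mono by (metis add.commute le_add_diff_inverse)
qed

text \<open>A substitute for the quotient map by U: the endomorphism kills a basis of U and fixes
  the remaining vectors of an extended basis. Dimensions of quotients can then be treated by
  \<open>rank_nullity\<close> without forming quotient spaces.\<close>

lemma exists_linear_with_kernel:
  assumes "subspace U"
  shows "\<exists>T. Vector_Spaces.linear scale scale T \<and> (\<forall>x. T x = 0 \<longleftrightarrow> x \<in> U)"
proof -
  interpret vp: vector_space_pair scale scale by unfold_locales
  obtain A where A: "A \<subseteq> U" "independent A" "U \<subseteq> span A"
    by (rule maximal_independent_subset)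
  have U: "U = span A" using A assms span_minimal by blast
  define C where "C = extend_basis A"
  have C: "A \<subseteq> C" "independent C" "span C = UNIV"
    using extend_basis_superset independent_extend_basis span_extend_basis A(2)
    unfolding C_def by auto
  define T where "T = vp.construct C (\<lambda>c. if c \<in> A then 0 else c)"
  have T: "Vector_Spaces.linear scale scale T" unfolding T_def by (rule vp.linear_construct[OF C(2)])
  have T1: "T x = 0" if "x \<in> span A" for x
    using vp.linear_eq_0_on_span[OF T _ that] C
    by (auto simp: T_def vp.construct_basis subset_iff)
  have T2: "T x = x" if "x \<in> span (C - A)" for x
    using vp.linear_eq_on[OF T linear_id that] C
    by (auto simp: T_def vp.construct_basis)
  have "x \<in> span A" if "T x = 0" for x
  proof -
    have "A \<union> (C - A) = C" using C(1) by blast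
    hence "x \<in> span (A \<union> (C - A))" using C(3) by simp
    then obtain y z where yz: "x = y + z" "y \<in> span A" "z \<in> span (C - A)"
      unfolding span_Un by blast
    have "T x = T y + T z" using yz(1) vp.linear_add[OF T] by simp
    thus ?thesis using T1 T2 yz that by simp
  qed
  thus ?thesis using T T1 U by blast
qed

end

section \<open>Ideals and Hilbert functions\<close>

abbreviation hf :: "nat \<Rightarrow> 'k::field mpoly set \<Rightarrow> nat \<Rightarrow> nat" where
  "hf n a j \<equiv> HF n a (int j)"

text \<open>The supremum in \<open>HF\<close> is attained by C - A, where A is a basis of the
  degree-j part of a and C extends it to the forms of degree j: a family B independent modulo a
  stays independent together with A. A sum is stated in order to avoid truncated
  subtraction.\<close>

lemma hf_dim:
  fixes a :: "'a::field mpoly set"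
  assumes a: "mp.subspace a"
  shows "hf n a j + mp.dim (a \<inter> forms n j) = mp.dim (forms n j :: 'a mpoly set)"
proof -
  let ?V = "forms n j :: 'a mpoly set"
  obtain W where W: "finite W" "?V \<subseteq> mp.span W" by (rule forms_fin)
  obtain A C where AC: "A \<subseteq> C" "A \<subseteq> a \<inter> ?V" "C \<subseteq> ?V" "mp.independent C" "finite C"
    "a \<inter> ?V \<subseteq> mp.span A" "?V \<subseteq> mp.span C" "card A = mp.dim (a \<inter> ?V)" "card C = mp.dim ?V"
    using mp.basis_extension[OF W, of "a \<inter> ?V"] by blast
  have finA: "finite A" using AC finite_subset by blast
  let ?S = "{card B | B. B \<subseteq> ?V \<and> lin_indep_mod a B}"
  have "Sup ?S = card (C - A)"
  proof (rule cSup_eq_maximum)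
    have "lin_indep_mod a (C - A)"
      unfolding lin_indep_mod_def
    proof (intro conjI allI impI)
      fix c assume c: "(\<Sum>b\<in>C - A. smult_mp (c b) b) \<in> a"
      let ?x = "\<Sum>b\<in>C - A. smult_mp (c b) b"
      have 1: "?x \<in> mp.span (C - A)" by (intro mp.span_sum mp.span_scale mp.span_base)
      have "mp.span (C - A) \<subseteq> ?V" using AC(3) subspace_forms by (intro mp.span_minimal) auto
      hence "?x \<in> mp.span A" using 1 c AC(6) by blast
      hence "?x = 0" using 1 mp.span_disjoint_parts[OF AC(4,5,1)] by blast
      moreover have "mp.independent (C - A)" using AC(4) mp.independent_mono by blast
      ultimately show "\<forall>b\<in>C - A. c b = 0"
        using mp.independentD[of "C - A" "C - A" c] AC(5) by blast
    qed (use AC in simp)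
    thus "card (C - A) \<in> ?S" using AC(3) by blast
  next
    fix x assume "x \<in> ?S"
    then obtain B where B: "x = card B" "B \<subseteq> ?V" "lin_indep_mod a B" by blast
    have finB: "finite B" and indB: "\<And>c b. (\<Sum>b\<in>B. smult_mp (c b) b) \<in> a \<Longrightarrow> b \<in> B \<Longrightarrow> c b = 0"
      using B(3) unfolding lin_indep_mod_def by blast+
    have disj: "A \<inter> B = {}"
    proof (rule ccontr)
      assume "A \<inter> B \<noteq> {}"
      then obtain b where b: "b \<in> A" "b \<in> B" by blast
      have "(\<Sum>b'\<in>B. smult_mp (if b' = b then 1 else 0) b')
          = (\<Sum>b'\<in>B. if b' = b then b' else 0)"
        by (intro sum.cong) auto
      also have "\<dots> = b" using b finB by simp
      finally show False using b AC(2) indB[of "\<lambda>b'. if b' = b then 1 else 0" b] by auto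
    qed
    have spA: "mp.span A \<subseteq> a" using AC(2) a by (intro mp.span_minimal) auto
    have "mp.independent (A \<union> B)"
    proof (rule mp.independent_if_scalars_zero)
      fix f x assume 0: "(\<Sum>x\<in>A \<union> B. smult_mp (f x) x) = 0" and x: "x \<in> A \<union> B"
      have s: "(\<Sum>x\<in>A. smult_mp (f x) x) + (\<Sum>x\<in>B. smult_mp (f x) x) = 0"
        using 0 sum.union_disjoint[OF finA finB disj] by metis
      have "(\<Sum>x\<in>A. smult_mp (f x) x) \<in> a"
        using AC(2) by (intro mp.subspace_sum mp.subspace_scale a) auto
      moreover have "(\<Sum>x\<in>B. smult_mp (f x) x) = - (\<Sum>x\<in>A. smult_mp (f x) x)"
        using s by (simp add: add_eq_0_iff)
      ultimately have "(\<Sum>x\<in>B. smult_mp (f x) x) \<in> a"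
        using mp.subspace_neg[OF a] by simp
      hence fB: "\<forall>x\<in>B. f x = 0" using indB by blast
      hence "(\<Sum>x\<in>A. smult_mp (f x) x) = 0" using s by simp
      moreover have "mp.independent A" using AC(1,4) mp.independent_mono by blast
      ultimately have "\<forall>x\<in>A. f x = 0"
        using mp.independentD[of A A f] finA by blast
      thus "f x = 0" using x fB by blast
    qed (use finA finB in simp)
    hence "card (A \<union> B) \<le> mp.dim ?V"
      using mp.independent_finite_card_le_dim[OF W, of "A \<union> B"] AC(2) B(2) by blast
    thus "x \<le> card (C - A)"
      using B(1) AC card_Un_disjoint[OF finA finB disj] by (simp add: card_Diff_subset finA)
  qed
  moreover have "hf n a j = Sup ?S" by (simp add: HF_def forms_def)
  ultimately show ?thesis using AC card_mono[OF AC(5,1)] by (simp add: card_Diff_subset finA)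
qed

lemma hf_antimono:
  fixes a b :: "'a::field mpoly set"
  assumes "mp.subspace a" "mp.subspace b" "a \<inter> forms n j \<subseteq> b"
  shows "hf n b j \<le> hf n a j"
proof -
  obtain W where W: "finite W" "(forms n j :: 'a mpoly set) \<subseteq> mp.span W" by (rule forms_fin)
  have "mp.dim (a \<inter> forms n j) \<le> mp.dim (b \<inter> forms n j)"
    using W assms(3) by (intro mp.dim_mono_finite[of W]) auto
  thus ?thesis using hf_dim[OF assms(1), of n j] hf_dim[OF assms(2), of n j] by linarith
qed

lemma hf_pos_iff:
  fixes a :: "'a::field mpoly set"
  assumes "mp.subspace a"
  shows "hf n a j > 0 \<longleftrightarrow> \<not> forms n j \<subseteq> a"
proof
  assume "hf n a j > 0"
  thus "\<not> forms n j \<subseteq> a" using hf_dim[OF assms, of n j] by (auto simp: Int_absorb1)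
next
  assume "\<not> forms n j \<subseteq> a"
  then obtain v where v: "v \<in> forms n j" "v \<notin> a" by blast
  obtain W where W: "finite W" "(forms n j :: 'a mpoly set) \<subseteq> mp.span W" by (rule forms_fin)
  obtain A where A: "A \<subseteq> a \<inter> forms n j" "mp.independent A" "a \<inter> forms n j \<subseteq> mp.span A"
      "card A = mp.dim (a \<inter> forms n j)"
    by (rule mp.basis_exists)
  have "mp.span A \<subseteq> a" using A(1) assms by (intro mp.span_minimal) auto
  hence vA: "v \<notin> mp.span A" using v by blast
  hence "mp.independent (insert v A)" using A mp.independent_insertI by blast
  hence "finite (insert v A) \<and> card (insert v A) \<le> mp.dim (forms n j :: 'a mpoly set)"
    using v A(1) by (intro mp.independent_finite_card_le_dim[OF W]) auto
  moreover have "v \<notin> A" using vA mp.span_base by blast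
  ultimately have "mp.dim (a \<inter> forms n j) < mp.dim (forms n j :: 'a mpoly set)"
    using A(4) by auto
  thus "hf n a j > 0" using hf_dim[OF assms, of n j] by linarith
qed

lemma is_ideal_subspace: "is_ideal n I \<Longrightarrow> mp.subspace I"
  by (simp add: mp.subspace_def is_ideal_def smult_mp_eq)

lemma is_idealD:
  assumes "is_ideal n I"
  shows "p \<in> I \<Longrightarrow> p \<in> polyring n" "0 \<in> I" "p \<in> I \<Longrightarrow> q \<in> I \<Longrightarrow> p + q \<in> I"
    "p \<in> I \<Longrightarrow> q \<in> I \<Longrightarrow> p - q \<in> I" "c \<in> polyring n \<Longrightarrow> p \<in> I \<Longrightarrow> c * p \<in> I"
    "c \<in> polyring n \<Longrightarrow> p \<in> I \<Longrightarrow> p * c \<in> I"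
  using assms mp.subspace_diff[OF is_ideal_subspace[OF assms]]
  by (auto simp: is_ideal_def mult.commute)

lemma is_ideal_zero: "is_ideal n {0}"
  by (simp add: is_ideal_def)

lemma is_ideal_polyring: "is_ideal n (polyring n)"
  by (auto simp: is_ideal_def intro: polyring_add polyring_mult)

lemma ideal_gen_is_ideal:
  assumes "F \<subseteq> polyring n" shows "is_ideal n (ideal_gen n F)"
proof -
  have sub: "p \<in> polyring n" if "p \<in> ideal_gen n F" for p
    using that by induction (use assms in \<open>auto intro!: polyring_add polyring_mult\<close>)
  have add: "p + q \<in> ideal_gen n F" if "p \<in> ideal_gen n F" "q \<in> ideal_gen n F" for p q
    using that by induction (auto simp: add.assoc intro: ideal_gen.step)
  have mult: "c * p \<in> ideal_gen n F" if "c \<in> polyring n" "p \<in> ideal_gen n F" for c p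
    using that(2)
  proof induction
    case (step g b p)
    have "c * (b * g + p) = (c * b) * g + c * p" by (simp add: algebra_simps)
    thus ?case using step that(1) by (auto intro: ideal_gen.step polyring_mult)
  qed (simp add: ideal_gen.zero)
  show ?thesis using sub add mult ideal_gen.zero unfolding is_ideal_def by blast
qed

lemma ideal_gen_base: "g \<in> F \<Longrightarrow> g \<in> ideal_gen n F"
  using ideal_gen.step[of g F 1 n 0] by (simp add: ideal_gen.zero)

lemma ideal_gen_minimal:
  assumes "is_ideal n I" "F \<subseteq> I" shows "ideal_gen n F \<subseteq> I"
proof
  fix p assume "p \<in> ideal_gen n F"
  thus "p \<in> I"
    by induction (use assms in \<open>auto intro: is_idealD[OF assms(1)]\<close>)
qed

lemma ideal_gen_empty [simp]: "ideal_gen n {} = {0}"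
  using ideal_gen_minimal[OF is_ideal_zero, of "{}" n] ideal_gen.zero by blast

lemma ideal_gen_mono: "F \<subseteq> F' \<Longrightarrow> F' \<subseteq> polyring n \<Longrightarrow> ideal_gen n F \<subseteq> ideal_gen n F'"
  by (rule ideal_gen_minimal) (auto intro: ideal_gen_is_ideal ideal_gen_base)

section \<open>Homogeneous ideals, colon ideals and adjoining one element\<close>

definition hideal :: "nat \<Rightarrow> 'k::field mpoly set \<Rightarrow> bool" where
  "hideal n I \<longleftrightarrow> is_ideal n I \<and> (\<forall>p\<in>I. \<forall>j. hcomp j p \<in> I)"

lemma hideal_is_ideal: "hideal n I \<Longrightarrow> is_ideal n I"
  and hideal_hcomp: "hideal n I \<Longrightarrow> p \<in> I \<Longrightarrow> hcomp j p \<in> I"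
  by (auto simp: hideal_def)

lemmas hideal_subspace = is_ideal_subspace[OF hideal_is_ideal]
lemmas hidealD = is_idealD[OF hideal_is_ideal]

lemma hideal_memI:
  assumes "is_ideal n I" "\<And>j. hcomp j p \<in> I" shows "p \<in> I"
  by (subst sum_hcomp[of p]) (intro mp.subspace_sum is_ideal_subspace[OF assms(1)] assms(2))

lemma hideal_subset:
  assumes "hideal n I" "is_ideal n K" "\<And>j. I \<inter> forms n j \<subseteq> K"
  shows "I \<subseteq> K"
proof
  fix p assume p: "p \<in> I"
  show "p \<in> K"
  proof (rule hideal_memI[OF assms(2)])
    fix j show "hcomp j p \<in> K"
      using assms(3)[of j] hideal_hcomp[OF assms(1) p, of j] forms_hcomp hidealD(1)[OF assms(1) p] by blast
  qed
qed

definition colon :: "nat \<Rightarrow> 'k::field mpoly set \<Rightarrow> 'k mpoly \<Rightarrow> 'k mpoly set" where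
  "colon n I g = {p \<in> polyring n. g * p \<in> I}"

text \<open>The ideal I + (g), kept in explicit form so that membership splits at once as p + g * q;
  \<open>ideal_gen_insert\<close> connects it with \<open>ideal_gen\<close>.\<close>

definition adjoin :: "nat \<Rightarrow> 'k::field mpoly set \<Rightarrow> 'k mpoly \<Rightarrow> 'k mpoly set" where
  "adjoin n I g = {p + g * q | p q. p \<in> I \<and> q \<in> polyring n}"

definition nzd :: "nat \<Rightarrow> 'k::field mpoly set \<Rightarrow> 'k mpoly \<Rightarrow> bool" where
  "nzd n I g \<longleftrightarrow> (\<forall>p\<in>polyring n. g * p \<in> I \<longrightarrow> p \<in> I)"

lemma is_ideal_colon:
  assumes "is_ideal n I" "g \<in> polyring n" shows "is_ideal n (colon n I g)"
  using assms(2) is_idealD[OF assms(1)]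
  by (auto simp: is_ideal_def colon_def polyring_add polyring_mult distrib_left mult.left_commute)

lemma hideal_colon:
  assumes "hideal n I" "g \<in> forms n e" shows "hideal n (colon n I g)"
  unfolding hideal_def
proof (intro conjI ballI allI)
  show "is_ideal n (colon n I g)"
    using is_ideal_colon hideal_is_ideal assms forms_polyring by blast
  fix p j assume p: "p \<in> colon n I g"
  have "hcomp (e + j) (g * p) \<in> I" using p hideal_hcomp[OF assms(1)] by (simp add: colon_def)
  hence "g * hcomp j p \<in> I" using hcomp_mult[of g e "e + j" p] assms(2) by (simp add: forms_def)
  thus "hcomp j p \<in> colon n I g" using p by (simp add: colon_def polyring_hcomp)
qed

lemma colon_superset: "is_ideal n I \<Longrightarrow> g \<in> polyring n \<Longrightarrow> I \<subseteq> colon n I g"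
  using is_idealD[of n I] by (auto simp: colon_def)

lemma colon_nzd: "is_ideal n I \<Longrightarrow> g \<in> polyring n \<Longrightarrow> nzd n I g \<Longrightarrow> colon n I g = I"
  using colon_superset[of n I g] by (auto simp: colon_def nzd_def)

lemma is_ideal_adjoin:
  assumes "is_ideal n I" "g \<in> polyring n" shows "is_ideal n (adjoin n I g)"
  unfolding is_ideal_def
proof (intro conjI ballI)
  note I = is_idealD[OF assms(1)]
  show "adjoin n I g \<subseteq> polyring n"
    using I(1) assms(2) by (auto simp: adjoin_def intro!: polyring_add polyring_mult)
  show "0 \<in> adjoin n I g"
    using I(2) unfolding adjoin_def by (rule_tac CollectI) (rule exI[of _ 0], rule exI[of _ 0], simp)
  fix x assume "x \<in> adjoin n I g"
  then obtain p q where x: "x = p + g * q" "p \<in> I" "q \<in> polyring n" by (auto simp: adjoin_def)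
  {
    fix y assume "y \<in> adjoin n I g"
    then obtain p' q' where y: "y = p' + g * q'" "p' \<in> I" "q' \<in> polyring n"
      by (auto simp: adjoin_def)
    have "x + y = (p + p') + g * (q + q')" using x y by (simp add: algebra_simps)
    thus "x + y \<in> adjoin n I g" using x y I(3) polyring_add unfolding adjoin_def by blast
  next
    fix c :: "'a mpoly" assume c: "c \<in> polyring n"
    have "c * x = c * p + g * (c * q)" using x by (simp add: algebra_simps)
    thus "c * x \<in> adjoin n I g" using x c I(5) polyring_mult unfolding adjoin_def by blast
  }
qed

lemma hideal_adjoin:
  assumes "hideal n I" "g \<in> forms n e" shows "hideal n (adjoin n I g)"
  unfolding hideal_def
proof (intro conjI ballI allI)
  show "is_ideal n (adjoin n I g)"
    using is_ideal_adjoin hideal_is_ideal assms forms_polyring by blast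
  fix x j assume "x \<in> adjoin n I g"
  then obtain p q where x: "x = p + g * q" "p \<in> I" "q \<in> polyring n" by (auto simp: adjoin_def)
  have "hcomp j x = hcomp j p + g * (if e \<le> j then hcomp (j - e) q else 0)"
    using hcomp_mult[of g e j q] assms(2) x by (simp add: hcomp_add forms_def)
  moreover have "(if e \<le> j then hcomp (j - e) q else 0) \<in> polyring n"
    using polyring_hcomp[OF x(3), of "j - e"] by simp
  ultimately show "hcomp j x \<in> adjoin n I g"
    using hideal_hcomp[OF assms(1) x(2)] unfolding adjoin_def by blast
qed

lemma adjoin_superset: "is_ideal n I \<Longrightarrow> I \<subseteq> adjoin n I g"
proof
  fix p assume "p \<in> I"
  hence "p = p + g * 0 \<and> p \<in> I \<and> (0::'a mpoly) \<in> polyring n" by simp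
  thus "p \<in> adjoin n I g" unfolding adjoin_def by blast
qed

lemma adjoin_base: "is_ideal n I \<Longrightarrow> q \<in> polyring n \<Longrightarrow> g * q \<in> adjoin n I g"
proof -
  assume "is_ideal n I" "q \<in> polyring n"
  hence "g * q = 0 + g * q \<and> 0 \<in> I \<and> q \<in> polyring n" using is_idealD(2) by simp
  thus ?thesis unfolding adjoin_def by blast
qed

lemma adjoin_minimal:
  assumes "is_ideal n K" "I \<subseteq> K" "g \<in> K" shows "adjoin n I g \<subseteq> K"
  using assms(2,3) is_idealD[OF assms(1)] by (auto simp: adjoin_def)

lemma ideal_gen_insert:
  assumes "F \<subseteq> polyring n" "g \<in> polyring n"
  shows "ideal_gen n (insert g F) = adjoin n (ideal_gen n F) g"
proof
  have I: "is_ideal n (ideal_gen n F)" using assms ideal_gen_is_ideal by blast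
  have "g \<in> adjoin n (ideal_gen n F) g" using adjoin_base[OF I, of 1 g] by simp
  thus "ideal_gen n (insert g F) \<subseteq> adjoin n (ideal_gen n F) g"
    using adjoin_superset[OF I, of g] ideal_gen_base[of _ F n] is_ideal_adjoin[OF I assms(2)]
    by (intro ideal_gen_minimal) auto
  show "adjoin n (ideal_gen n F) g \<subseteq> ideal_gen n (insert g F)"
    using assms
    by (intro adjoin_minimal ideal_gen_is_ideal ideal_gen_mono ideal_gen_base) auto
qed

lemma hideal_ideal_gen:
  assumes "\<And>g. g \<in> F \<Longrightarrow> \<exists>e. g \<in> forms n e" shows "hideal n (ideal_gen n F)"
  unfolding hideal_def
proof (intro conjI ballI allI)
  have F: "F \<subseteq> polyring n" using assms forms_polyring by blast
  show I: "is_ideal n (ideal_gen n F)" by (rule ideal_gen_is_ideal[OF F])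
  fix p j assume "p \<in> ideal_gen n F"
  thus "hcomp j p \<in> ideal_gen n F"
  proof induction
    case (step g c p)
    obtain e where e: "g \<in> forms n e" using assms step by blast
    have "hcomp j (c * g) = (if e \<le> j then hcomp (j - e) c * g else 0)"
      using hcomp_mult[of g e j c] e by (simp add: forms_def mult.commute)
    hence "hcomp j (c * g) \<in> ideal_gen n F"
      using step(1,2) is_idealD[OF I] ideal_gen_base[of g F n] by (simp add: polyring_hcomp)
    thus ?case using step is_idealD(3)[OF I] by (simp add: hcomp_add)
  qed (simp add: ideal_gen.zero)
qed

text \<open>The colon of a homogeneous ideal by a form is homogeneous, so regularity can be tested
  on forms.\<close>

lemma nzd_homogI:
  assumes "hideal n I" "g \<in> forms n e" "\<And>j p. p \<in> forms n j \<Longrightarrow> g * p \<in> I \<Longrightarrow> p \<in> I"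
  shows "nzd n I g"
  unfolding nzd_def
proof (intro ballI impI)
  fix p assume p: "p \<in> polyring n" "g * p \<in> I"
  have "p \<in> colon n I g" using p by (simp add: colon_def)
  hence "hcomp j p \<in> colon n I g" for j using hideal_hcomp[OF hideal_colon[OF assms(1,2)]] by blast
  hence "hcomp j p \<in> I" for j using assms(3) forms_hcomp[OF p(1)] by (auto simp: colon_def)
  thus "p \<in> I" using hideal_memI hideal_is_ideal assms(1) by blast
qed

lemma linear_mult: "Vector_Spaces.linear smult_mp smult_mp (\<lambda>p. g * p)"
  by unfold_locales (simp_all add: smult_mp_eq algebra_simps)

text \<open>Dimension count for the exact sequence 0 -> S/(J : g)(-D) -> S/J -> S/(J + (g)) -> 0.
  With T as quotient map by J, the map p |-> T (g * p) on forms of degree j has kernel (J : g), and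
  its image is that of J + (g) in degree j + D.\<close>

lemma hf_adjoin:
  fixes J :: "'a::field mpoly set"
  assumes J: "hideal n J" and g: "g \<in> forms n D"
  shows "hf n (adjoin n J g) (j + D) + hf n (colon n J g) j = hf n J (j + D)"
proof -
  let ?a = "adjoin n J g" and ?c = "colon n J g"
  let ?aj = "?a \<inter> forms n (j + D)"
  have Ja: "J \<subseteq> ?a" using adjoin_superset J hideal_is_ideal by blast
  have ha: "hideal n ?a" and hcomp: "hideal n ?c" using hideal_adjoin hideal_colon assms by blast+
  obtain T where T: "Vector_Spaces.linear smult_mp smult_mp T" "\<And>x. T x = 0 \<longleftrightarrow> x \<in> J"
    using mp.exists_linear_with_kernel[OF hideal_subspace[OF J]] by blast
  interpret T: Vector_Spaces.linear smult_mp smult_mp T by fact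
  obtain W where W: "finite W" "(forms n (j + D) :: 'a mpoly set) \<subseteq> mp.span W" by (rule forms_fin)
  obtain W' where W': "finite W'" "(forms n j :: 'a mpoly set) \<subseteq> mp.span W'" by (rule forms_fin)
  have "mp.dim ?aj = mp.dim (T ` ?aj) + mp.dim {v\<in>?aj. T v = 0}"
    using W by (intro mp.rank_nullity[OF T(1) _ W(1)] mp.subspace_inter
        hideal_subspace[OF ha] subspace_forms) auto
  moreover have "{v\<in>?aj. T v = 0} = J \<inter> forms n (j + D)" using T(2) Ja by auto
  moreover have "mp.dim (forms n j :: 'a mpoly set)
      = mp.dim ((T \<circ> (\<lambda>p. g * p)) ` forms n j) + mp.dim {v\<in>forms n j. (T \<circ> (\<lambda>p. g * p)) v = 0}"
    by (rule mp.rank_nullity[OF Vector_Spaces.linear_compose[OF linear_mult T(1)] subspace_forms W'])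
  moreover have "{v\<in>forms n j. (T \<circ> (\<lambda>p. g * p)) v = 0} = ?c \<inter> forms n j"
    using T(2) by (auto simp: colon_def forms_polyring)
  \<comment> \<open>Modulo J, the part of J + (g) in degree j + D consists of the products of g with
    forms of degree j: take the component of degree j + D of p + g * q.\<close>
  moreover have "(T \<circ> (\<lambda>p. g * p)) ` forms n j = T ` ?aj"
  proof (intro equalityI subsetI)
    fix y assume "y \<in> (T \<circ> (\<lambda>p. g * p)) ` forms n j"
    then obtain p where p: "y = T (g * p)" "p \<in> forms n j" by auto
    have "g * p \<in> ?aj"
      using p(2) forms_mult[OF g p(2)] adjoin_base[OF hideal_is_ideal[OF J] forms_polyring[OF p(2)], of g]
      by (simp add: add.commute)
    thus "y \<in> T ` ?aj" using p(1) by blast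
  next
    fix y assume "y \<in> T ` ?aj"
    then obtain x where x: "y = T x" "x \<in> ?a" "x \<in> forms n (j + D)" by auto
    obtain p q where pq: "x = p + g * q" "p \<in> J" "q \<in> polyring n"
      using x(2) by (auto simp: adjoin_def)
    have "x = hcomp (j + D) x" using hcomp_forms[OF x(3)] by simp
    also have "\<dots> = hcomp (j + D) p + g * hcomp j q"
      using hcomp_mult[of g D "j + D" q] g pq by (simp add: hcomp_add forms_def)
    finally have "T x = T (hcomp (j + D) p) + T (g * hcomp j q)" by (metis T.add)
    moreover have "T (hcomp (j + D) p) = 0" using T(2) pq(2) hideal_hcomp[OF J] by blast
    ultimately have "y = (T \<circ> (\<lambda>p. g * p)) (hcomp j q)" using x(1) by simp
    thus "y \<in> (T \<circ> (\<lambda>p. g * p)) ` forms n j" using forms_hcomp[OF pq(3)] by blast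
  qed
  ultimately have "mp.dim ?aj + mp.dim (?c \<inter> forms n j)
      = mp.dim (forms n j :: 'a mpoly set) + mp.dim (J \<inter> forms n (j + D))" by simp
  thus ?thesis
    using hf_dim[OF hideal_subspace[OF J], of n "j + D"]
      hf_dim[OF hideal_subspace[OF ha], of n "j + D"] hf_dim[OF hideal_subspace[OF hcomp], of n j]
    by linarith
qed

lemma hf_adjoin_low:
  assumes J: "hideal n J" and g: "g \<in> forms n D" and "j < D"
  shows "hf n (adjoin n J g) j = hf n J j"
proof (rule antisym)
  have Ja: "J \<subseteq> adjoin n J g" using adjoin_superset J hideal_is_ideal by blast
  have ha: "hideal n (adjoin n J g)" using hideal_adjoin assms by blast
  show "hf n (adjoin n J g) j \<le> hf n J j"
    using Ja by (intro hf_antimono hideal_subspace[OF J] hideal_subspace[OF ha]) auto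
  have "adjoin n J g \<inter> forms n j \<subseteq> J"
  proof
    fix x assume "x \<in> adjoin n J g \<inter> forms n j"
    then obtain p q where pq: "x = p + g * q" "p \<in> J" "x \<in> forms n j" by (auto simp: adjoin_def)
    have "x = hcomp j x" using hcomp_forms[OF pq(3)] by simp
    also have "\<dots> = hcomp j p" using hcomp_mult[of g D j q] pq g \<open>j < D\<close> by (simp add: hcomp_add forms_def)
    finally show "x \<in> J" using hideal_hcomp[OF J pq(2)] by simp
  qed
  thus "hf n J j \<le> hf n (adjoin n J g) j"
    by (intro hf_antimono hideal_subspace[OF J] hideal_subspace[OF ha])
qed

section \<open>Eliminating a variable by a linear substitution\<close>

lemma polyring_induct [consumes 1, case_names add single]:
  assumes "p \<in> polyring n"
    and "\<And>p q. P p \<Longrightarrow> P q \<Longrightarrow> P (p + q)"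
    and "\<And>m c. Poly_Mapping.keys m \<subseteq> {..<n} \<Longrightarrow> P (Poly_Mapping.single m c)"
  shows "P (p :: 'k::field mpoly)"
proof -
  have single: "P (Poly_Mapping.single m (Poly_Mapping.lookup p m))" if "m \<in> Poly_Mapping.keys p" for m
    using assms(1) that by (intro assms(3)) (auto simp: polyring_def)
  have "P (sum f A)" if "\<And>m. m\<in>A \<Longrightarrow> P (f m)" for f :: "(nat \<Rightarrow>\<^sub>0 nat) \<Rightarrow> 'k mpoly" and A
    using that assms(3)[of 0 0]
    by (induction A rule: infinite_finite_induct) (auto intro: assms(2))
  from this[OF single]
  have "P (\<Sum>m\<in>Poly_Mapping.keys p. Poly_Mapping.single m (Poly_Mapping.lookup p m))" by this
  thus ?thesis by (simp only: poly_eq_sum_single[of p, symmetric])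
qed

definition drop_var :: "nat \<Rightarrow> (nat \<Rightarrow>\<^sub>0 nat) \<Rightarrow> nat \<Rightarrow>\<^sub>0 nat" where
  "drop_var n m = Poly_Mapping.update n 0 m"

lemma drop_var_add: "drop_var n (a + b) = drop_var n a + drop_var n b"
  by (rule poly_mapping_eqI) (simp add: drop_var_def lookup_update lookup_add)

lemma drop_var_split: "m = drop_var n m + Poly_Mapping.single n (Poly_Mapping.lookup m n)"
  by (rule poly_mapping_eqI) (auto simp: drop_var_def lookup_update lookup_add lookup_single when_def)

lemma keys_drop_var: "Poly_Mapping.keys (drop_var n m) = Poly_Mapping.keys m - {n}"
  by (auto simp: drop_var_def in_keys_iff lookup_update split: if_splits)

text \<open>The ring homomorphism x_n := L. For L in \<open>polyring n\<close> it realises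
  \<open>polyring n\<close> as the quotient of \<open>polyring (Suc n)\<close> by x_n - L. The
  coefficient is split off as a constant factor so that additivity is an instance of
  \<open>setsum_keys_plus_distrib\<close>.\<close>

definition subst_last :: "nat \<Rightarrow> 'k::field mpoly \<Rightarrow> 'k mpoly \<Rightarrow> 'k mpoly" where
  "subst_last n L p = (\<Sum>m\<in>Poly_Mapping.keys p. const_mp (Poly_Mapping.lookup p m)
     * (Poly_Mapping.single (drop_var n m) 1 * L ^ Poly_Mapping.lookup m n))"

lemma subst_last_add: "subst_last n L (p + q) = subst_last n L p + subst_last n L q"
  unfolding subst_last_def
  by (rule setsum_keys_plus_distrib[of "\<lambda>m c. const_mp c
     * (Poly_Mapping.single (drop_var n m) 1 * L ^ Poly_Mapping.lookup m n)"])
    (simp_all add: single_add distrib_right)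

lemma subst_last_0 [simp]: "subst_last n L 0 = 0"
  by (simp add: subst_last_def)

lemma subst_last_single: "subst_last n L (Poly_Mapping.single m c)
    = Poly_Mapping.single (drop_var n m) c * L ^ Poly_Mapping.lookup m n"
  by (cases "c = 0") (simp_all add: subst_last_def mult.assoc[symmetric] mult_single)

lemma subst_last_mult: "subst_last n L (p * q) = subst_last n L p * subst_last n L q"
proof (induction p rule: poly_single_induct)
  case (single m c)
  show ?case
  proof (induction q rule: poly_single_induct)
    case (single m' c')
    have "Poly_Mapping.single (drop_var n m + drop_var n m') (c * c')
        = Poly_Mapping.single (drop_var n m) c * Poly_Mapping.single (drop_var n m') c'"
      by (simp add: mult_single)
    thus ?case
      by (simp add: mult_single subst_last_single drop_var_add lookup_add power_add mult_ac)
  qed (simp add: distrib_left subst_last_add)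
qed (simp add: distrib_right subst_last_add)

lemma subst_last_const [simp]: "subst_last n L (const_mp c) = const_mp c"
proof -
  have "drop_var n 0 = 0" by (rule poly_mapping_eqI) (simp add: drop_var_def lookup_update)
  thus ?thesis by (simp add: subst_last_single)
qed

lemma subst_last_uminus: "subst_last n L (- p) = - subst_last n L p"
  using subst_last_add[of n L p "- p"] by (simp add: eq_neg_iff_add_eq_0 add.commute)

lemma subst_last_diff: "subst_last n L (p - q) = subst_last n L p - subst_last n L q"
  using subst_last_add[of n L p "- q"] by (simp add: subst_last_uminus)

lemma linear_subst_last: "Vector_Spaces.linear smult_mp smult_mp (subst_last n L)"
  by unfold_locales (simp_all add: smult_mp_eq subst_last_add subst_last_mult)

lemma subst_last_sum: "subst_last n L (sum p A) = (\<Sum>i\<in>A. subst_last n L (p i))"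
  by (induction A rule: infinite_finite_induct) (auto simp: subst_last_add)

lemma subst_last_var [simp]: "subst_last n L (var n) = L"
proof -
  have "drop_var n (Poly_Mapping.single n (Suc 0)) = 0"
    by (rule poly_mapping_eqI) (simp add: drop_var_def lookup_update lookup_single when_def)
  thus ?thesis by (simp add: var_def subst_last_single)
qed

lemma subst_last_polyring:
  assumes "L \<in> polyring n" "p \<in> polyring (Suc n)" shows "subst_last n L p \<in> polyring n"
  using assms(2)
proof (induction rule: polyring_induct)
  case (single m c)
  hence "Poly_Mapping.single (drop_var n m) c \<in> polyring n"
    by (auto simp: polyring_def keys_drop_var)
  thus ?case
    unfolding subst_last_single using assms(1) by (intro polyring_mult polyring_power)
qed (auto simp: subst_last_add polyring_add)

lemma subst_last_homog:
  assumes "homog L 1" "homog p j" shows "homog (subst_last n L p) j"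
proof (unfold subst_last_def, rule homog_sum)
  fix m assume m: "m \<in> Poly_Mapping.keys p"
  have "mdeg m = mdeg (drop_var n m) + Poly_Mapping.lookup m n"
    by (subst drop_var_split[of m n]) (simp only: mdeg_add mdeg_single)
  hence j: "j = 0 + (mdeg (drop_var n m) + Poly_Mapping.lookup m n * 1)"
    using m assms(2) by (simp add: homog_def)
  have "homog (Poly_Mapping.single (drop_var n m) (1::'a)) (mdeg (drop_var n m))"
    by (simp add: homog_def)
  thus "homog (const_mp (Poly_Mapping.lookup p m)
     * (Poly_Mapping.single (drop_var n m) 1 * L ^ Poly_Mapping.lookup m n)) j"
    unfolding j using assms(1) by (intro homog_mult homog_power homog_const)
qed

lemma subst_last_id: "p \<in> polyring n \<Longrightarrow> subst_last n L p = p"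
proof (induction rule: polyring_induct)
  case (single m c)
  hence "Poly_Mapping.lookup m n = 0" by (auto simp: in_keys_iff)
  moreover from this have "drop_var n m = m" using drop_var_split[of m n] by simp
  ultimately show ?case by (simp add: subst_last_single)
qed (simp add: subst_last_add)

text \<open>Division with remainder by x_n - L, which is monic in x_n. On a monomial with exponent k
  in x_n, the quotient comes from the factorisation of x_n^k - L^k.\<close>

lemma subst_last_cong:
  assumes "L \<in> polyring n" "p \<in> polyring (Suc n)"
  obtains q where "q \<in> polyring (Suc n)" "p = subst_last n L p + (var n - L) * q"
proof -
  have "\<exists>q\<in>polyring (Suc n). p = subst_last n L p + (var n - L) * q"
    using assms(2)
  proof (induction rule: polyring_induct)
    case (add p q)
    then obtain p' q' where pq: "p' \<in> polyring (Suc n)" "q' \<in> polyring (Suc n)"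
      "p = subst_last n L p + (var n - L) * p'" "q = subst_last n L q + (var n - L) * q'" by blast
    have "p + q = (subst_last n L p + (var n - L) * p') + (subst_last n L q + (var n - L) * q')"
      by (rule arg_cong2[where f = "(+)", OF pq(3,4)])
    also have "\<dots> = subst_last n L (p + q) + (var n - L) * (p' + q')"
      by (simp add: subst_last_add algebra_simps)
    finally show ?case using pq(1,2) polyring_add by blast
  next
    case (single m c)
    let ?k = "Poly_Mapping.lookup m n" and ?s = "Poly_Mapping.single (drop_var n m) c"
    let ?q = "\<Sum>i<?k. L ^ (?k - Suc i) * var n ^ i"
    have s: "?s \<in> polyring (Suc n)" using single by (auto simp: polyring_def keys_drop_var)
    have L: "L \<in> polyring (Suc n)" using assms(1) polyring_mono[of n "Suc n"] by simp
    have "?q \<in> polyring (Suc n)"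
      using L by (intro polyring_sum polyring_mult polyring_power) auto
    hence 1: "?s * ?q \<in> polyring (Suc n)" using s polyring_mult by blast
    have pow: "var n ^ k = Poly_Mapping.single (Poly_Mapping.single n k) (1::'a)" for k
      by (induction k) (simp_all add: var_def mult_single flip: single_add)
    have "Poly_Mapping.single m c = ?s * var n ^ ?k"
      unfolding pow mult_single drop_var_split[of m n, symmetric] by simp
    also have "\<dots> = ?s * (L ^ ?k + (var n ^ ?k - L ^ ?k))" by simp
    also have "var n ^ ?k - L ^ ?k = (var n - L) * ?q" by (rule power_diff_sumr2)
    finally have "Poly_Mapping.single m c
        = subst_last n L (Poly_Mapping.single m c) + (var n - L) * (?s * ?q)"
      by (simp add: subst_last_single algebra_simps)
    thus ?case using 1 by blast
  qed
  thus ?thesis using that by blast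
qed

lemma subst_last_forms:
  "L \<in> forms n 1 \<Longrightarrow> p \<in> forms (Suc n) j \<Longrightarrow> subst_last n L p \<in> forms n j"
  by (simp add: forms_def subst_last_polyring subst_last_homog)

lemma hcomp_subst_last:
  assumes "L \<in> forms n 1" shows "hcomp j (subst_last n L p) = subst_last n L (hcomp j p)"
proof -
  let ?A = "mdeg ` Poly_Mapping.keys p"
  have "hcomp j (subst_last n L p) = (\<Sum>i\<in>?A. hcomp j (subst_last n L (hcomp i p)))"
    by (subst (1) sum_hcomp[of p]) (simp only: subst_last_sum hcomp_sum)
  also have "\<dots> = (\<Sum>i\<in>?A. subst_last n L (hcomp j (hcomp i p)))"
  proof (rule sum.cong[OF refl])
    fix i
    have "homog (subst_last n L (hcomp i p)) i" using assms by (simp add: forms_def subst_last_homog)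
    thus "hcomp j (subst_last n L (hcomp i p)) = subst_last n L (hcomp j (hcomp i p))"
      by (simp add: hcomp_homog[OF homog_hcomp] hcomp_homog[of _ i])
  qed
  also have "\<dots> = subst_last n L (hcomp j p)"
    by (subst (3) sum_hcomp[of p]) (simp only: subst_last_sum hcomp_sum)
  finally show ?thesis .
qed

lemma is_ideal_subst_last:
  assumes "is_ideal (Suc n) I" "L \<in> polyring n" shows "is_ideal n (subst_last n L ` I)"
  unfolding is_ideal_def
proof (intro conjI ballI)
  note I = is_idealD[OF assms(1)]
  show "subst_last n L ` I \<subseteq> polyring n" using I(1) assms(2) subst_last_polyring by blast
  show "0 \<in> subst_last n L ` I" using I(2) by (metis subst_last_0 imageI)
  show "a + b \<in> subst_last n L ` I" if "a \<in> subst_last n L ` I" "b \<in> subst_last n L ` I" for a b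
    using that I(3) by (auto simp flip: subst_last_add)
  show "c * a \<in> subst_last n L ` I" if a: "a \<in> subst_last n L ` I" and c: "c \<in> polyring n" for a c
  proof -
    obtain p where p: "p \<in> I" "a = subst_last n L p" using a by blast
    have "c * a = subst_last n L (c * p)" using p c by (simp add: subst_last_mult subst_last_id)
    moreover have "c * p \<in> I" using I(5)[OF polyring_mono[of n "Suc n" c] p(1)] c by simp
    ultimately show ?thesis by blast
  qed
qed

lemma hideal_subst_last:
  assumes "hideal (Suc n) I" "L \<in> forms n 1" shows "hideal n (subst_last n L ` I)"
  using assms is_ideal_subst_last[of n I L]
  by (auto simp: hideal_def hcomp_subst_last forms_polyring)

text \<open>The kernel of the substitution is generated by x_n - L, so working modulo the image of I
  in the smaller ring amounts to working modulo I + (x_n - L) in the larger one.\<close>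

lemma subst_last_mem_iff:
  assumes "is_ideal (Suc n) I" "L \<in> polyring n" "p \<in> polyring (Suc n)"
  shows "subst_last n L p \<in> subst_last n L ` I \<longleftrightarrow> p \<in> adjoin (Suc n) I (var n - L)"
proof
  assume "subst_last n L p \<in> subst_last n L ` I"
  then obtain i where i: "i \<in> I" "subst_last n L p = subst_last n L i" by blast
  have "i \<in> polyring (Suc n)" using is_idealD(1)[OF assms(1) i(1)] .
  hence "p - i \<in> polyring (Suc n)" using assms(3) polyring_diff by blast
  then obtain q where q: "q \<in> polyring (Suc n)"
      "p - i = subst_last n L (p - i) + (var n - L) * q"
    using subst_last_cong[OF assms(2)] by blast
  hence "p = i + (var n - L) * q" using i by (simp add: subst_last_diff algebra_simps)
  thus "p \<in> adjoin (Suc n) I (var n - L)" using i q unfolding adjoin_def by blast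
next
  assume "p \<in> adjoin (Suc n) I (var n - L)"
  then obtain i q where "p = i + (var n - L) * q" "i \<in> I" by (auto simp: adjoin_def)
  hence "subst_last n L p = subst_last n L i"
    using assms(2) by (simp add: subst_last_add subst_last_mult subst_last_diff subst_last_id)
  thus "subst_last n L p \<in> subst_last n L ` I" using \<open>i \<in> I\<close> by blast
qed

lemma subst_last_ideal_gen:
  assumes "F \<subseteq> polyring (Suc n)" "L \<in> polyring n"
  shows "subst_last n L ` ideal_gen (Suc n) F = ideal_gen n (subst_last n L ` F)"
proof
  have FL: "subst_last n L ` F \<subseteq> polyring n" using assms subst_last_polyring by blast
  show "subst_last n L ` ideal_gen (Suc n) F \<subseteq> ideal_gen n (subst_last n L ` F)"
  proof
    fix y assume "y \<in> subst_last n L ` ideal_gen (Suc n) F"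
    then obtain p where "p \<in> ideal_gen (Suc n) F" "y = subst_last n L p" by blast
    moreover from this(1) have "subst_last n L p \<in> ideal_gen n (subst_last n L ` F)"
      by induction (auto simp: subst_last_add subst_last_mult ideal_gen.zero
          intro!: ideal_gen.step subst_last_polyring assms(2))
    ultimately show "y \<in> ideal_gen n (subst_last n L ` F)" by simp
  qed
  show "ideal_gen n (subst_last n L ` F) \<subseteq> subst_last n L ` ideal_gen (Suc n) F"
    using ideal_gen_base[of _ F "Suc n"]
    by (intro ideal_gen_minimal is_ideal_subst_last ideal_gen_is_ideal assms) auto
qed

lemma var_minus_nonzero: "L \<in> polyring n \<Longrightarrow> var n - L \<noteq> (0 :: 'k::field mpoly)"
  using polyring_var[of n n, where ?'a = 'k] by auto

lemma var_minus_forms: "L \<in> forms n 1 \<Longrightarrow> var n - L \<in> forms (Suc n) 1"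
  using polyring_mono[of n "Suc n" L] by (auto simp: forms_def intro: polyring_diff homog_diff)

lemma subst_last_kernel_homog:
  assumes "L \<in> forms n 1" "p \<in> forms (Suc n) (Suc j)" "subst_last n L p = 0"
  obtains q where "q \<in> forms (Suc n) j" "p = (var n - L) * q"
proof -
  obtain q where q: "q \<in> polyring (Suc n)" "p = (var n - L) * q"
    using subst_last_cong[OF forms_polyring[OF assms(1)] forms_polyring[OF assms(2)]] assms(3) by auto
  have "homog (var n - L) 1" using var_minus_forms[OF assms(1)] by (simp add: forms_def)
  hence "hcomp (Suc j) p = (var n - L) * hcomp j q" unfolding q(2) by (subst hcomp_mult) auto
  hence "p = (var n - L) * hcomp j q" using hcomp_forms[OF assms(2)] by simp
  thus ?thesis using that forms_hcomp[OF q(1)] by blast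
qed

lemma subst_last_kernel_homog_0:
  assumes "L \<in> forms n 1" "p \<in> forms (Suc n) 0" "subst_last n L p = 0"
  shows "p = 0"
proof -
  obtain q where q: "p = (var n - L) * q"
    using subst_last_cong[OF forms_polyring[OF assms(1)] forms_polyring[OF assms(2)]] assms(3) by auto
  have "homog (var n - L) 1" using var_minus_forms[OF assms(1)] by (simp add: forms_def)
  hence "hcomp 0 p = 0" unfolding q by (subst hcomp_mult) auto
  thus ?thesis using hcomp_forms[OF assms(2)] by simp
qed

lemma subst_last_image_forms:
  assumes "hideal (Suc n) I" "L \<in> forms n 1"
  shows "subst_last n L ` (I \<inter> forms (Suc n) j) = subst_last n L ` I \<inter> forms n j"
proof (intro equalityI subsetI)
  fix y assume "y \<in> subst_last n L ` (I \<inter> forms (Suc n) j)"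
  thus "y \<in> subst_last n L ` I \<inter> forms n j" using subst_last_forms[OF assms(2)] by blast
next
  fix y assume y: "y \<in> subst_last n L ` I \<inter> forms n j"
  then obtain p where p: "p \<in> I" "y = subst_last n L p" by blast
  have "y = subst_last n L (hcomp j p)"
    using hcomp_subst_last[OF assms(2), of j p] hcomp_forms[of y n j j] y p by simp
  thus "y \<in> subst_last n L ` (I \<inter> forms (Suc n) j)"
    using hideal_hcomp[OF assms(1) p(1)] hidealD(1)[OF assms(1) p(1)] forms_hcomp by blast
qed

text \<open>Rank-nullity for the substitution on the degree-j part of I: its kernel consists of the
  multiples l * q in I with l = x_n - L, and q runs through (I : l) in degree j - 1. In degree 0
  there is no such q.\<close>

lemma dim_subst_last:
  fixes I :: "'k::field mpoly set"
  assumes I: "hideal (Suc n) I" and L: "L \<in> forms n 1"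
  shows "mp.dim (I \<inter> forms (Suc n) j) = mp.dim (subst_last n L ` I \<inter> forms n j)
    + (case j of 0 \<Rightarrow> 0 | Suc i \<Rightarrow> mp.dim (colon (Suc n) I (var n - L) \<inter> forms (Suc n) i))"
proof -
  have W: "\<exists>W. finite W \<and> (I \<inter> forms (Suc n) j) \<subseteq> mp.span W" for I :: "'k mpoly set" and j
  proof -
    obtain W where "finite W" "(forms (Suc n) j :: 'k mpoly set) \<subseteq> mp.span W" by (rule forms_fin)
    thus ?thesis by blast
  qed
  have sub: "mp.subspace (I \<inter> forms (Suc n) j)" if "hideal (Suc n) I" for I :: "'k mpoly set" and j
    by (intro mp.subspace_inter subspace_forms hideal_subspace[OF that])
  obtain W1 where W1: "finite W1" "I \<inter> forms (Suc n) j \<subseteq> mp.span W1" using W by blast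
  let ?K = "{v \<in> I \<inter> forms (Suc n) j. subst_last n L v = 0}"
  have 1: "mp.dim (I \<inter> forms (Suc n) j) = mp.dim (subst_last n L ` I \<inter> forms n j) + mp.dim ?K"
    using mp.rank_nullity[OF linear_subst_last sub[OF I] W1, of n L]
    unfolding subst_last_image_forms[OF assms] .
  have "mp.dim ?K =
    (case j of 0 \<Rightarrow> 0 | Suc i \<Rightarrow> mp.dim (colon (Suc n) I (var n - L) \<inter> forms (Suc n) i))"
  proof (cases j)
    case 0
    have "?K \<subseteq> {0}" using subst_last_kernel_homog_0[OF L] 0 by blast
    hence "mp.dim ?K \<le> card ({} :: 'k mpoly set)" by (intro mp.dim_le_card) auto
    thus ?thesis using 0 by simp
  next
    case (Suc i)
    let ?l = "var n - L" and ?C = "colon (Suc n) I (var n - L) \<inter> forms (Suc n) i"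
    have l: "?l \<in> forms (Suc n) 1" by (rule var_minus_forms[OF L])
    obtain W2 where W2: "finite W2" "?C \<subseteq> mp.span W2" using W by blast
    have "?K = (\<lambda>q. ?l * q) ` ?C"
    proof (intro equalityI subsetI)
      fix v assume v: "v \<in> ?K"
      then obtain q where "q \<in> forms (Suc n) i" "v = ?l * q"
        using subst_last_kernel_homog[OF L, of v i] Suc by blast
      thus "v \<in> (\<lambda>q. ?l * q) ` ?C" using v by (auto simp: colon_def forms_polyring)
    next
      fix v assume "v \<in> (\<lambda>q. ?l * q) ` ?C"
      then obtain q where q: "v = ?l * q" "q \<in> colon (Suc n) I ?l" "q \<in> forms (Suc n) i" by blast
      moreover have "subst_last n L v = 0"
        using L q by (simp add: subst_last_mult subst_last_diff subst_last_id forms_polyring)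
      ultimately show "v \<in> ?K" using forms_mult[OF l q(3)] Suc by (simp add: colon_def)
    qed
    moreover have "mp.dim ?C = mp.dim ((\<lambda>q. ?l * q) ` ?C) + mp.dim {v \<in> ?C. ?l * v = 0}"
      by (rule mp.rank_nullity[OF linear_mult sub[OF hideal_colon[OF I l]] W2])
    moreover have "{v \<in> ?C. ?l * v = 0} = {0}"
      using var_minus_nonzero[OF forms_polyring[OF L]]
        hidealD(2)[OF hideal_colon[OF I l]] by auto
    moreover have "mp.dim {0 :: 'k mpoly} = 0"
      using mp.dim_le_card[of "{0}" "{}"] by simp
    ultimately show ?thesis using Suc by simp
  qed
  thus ?thesis using 1 by simp
qed

lemma hideal_polyring: "hideal n (polyring n)"
  by (simp add: hideal_def is_ideal_polyring polyring_hcomp)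

text \<open>The exact sequence of multiplication by l = x_n - L, with S/(I + (l)) already rewritten
  in the smaller ring. The colon is kept general because the existence of Hilbert polynomials uses
  it for zero divisors too.\<close>

lemma hf_cut:
  fixes I :: "'k::field mpoly set"
  assumes I: "hideal (Suc n) I" and L: "L \<in> forms n 1"
  shows "hf (Suc n) I j = hf n (subst_last n L ` I) j
    + (case j of 0 \<Rightarrow> 0 | Suc i \<Rightarrow> hf (Suc n) (colon (Suc n) I (var n - L)) i)"
proof -
  let ?l = "var n - L"
  have l: "?l \<in> forms (Suc n) 1" by (rule var_minus_forms[OF L])
  have P: "hideal (Suc n) (polyring (Suc n) :: 'k mpoly set)" by (rule hideal_polyring)
  \<comment> \<open>The same count for the unit ideal gives the recursion for the full spaces of
    forms; subtracting the count for I from it yields the claim.\<close>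
  have "subst_last n L ` polyring (Suc n) = polyring n"
    using subst_last_polyring[OF forms_polyring[OF L]] subst_last_id[of _ n L]
      polyring_mono[of n "Suc n"] by (force simp: image_iff)
  moreover have "colon (Suc n) (polyring (Suc n)) ?l = polyring (Suc n)"
    using forms_polyring[OF l] by (auto simp: colon_def intro: polyring_mult)
  moreover have "polyring n \<inter> forms n j = (forms n j :: 'k mpoly set)" for n j
    by (auto simp: forms_def)
  ultimately have 1: "mp.dim (forms (Suc n) j :: 'k mpoly set) = mp.dim (forms n j :: 'k mpoly set)
    + (case j of 0 \<Rightarrow> 0 | Suc i \<Rightarrow> mp.dim (forms (Suc n) i :: 'k mpoly set))"
    using dim_subst_last[OF P L, of j] by (cases j) simp_all
  note d = hf_dim[OF hideal_subspace[OF I], of "Suc n" j]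
    hf_dim[OF hideal_subspace[OF hideal_subst_last[OF I L]], of n j]
  show ?thesis
  proof (cases j)
    case 0
    thus ?thesis using d dim_subst_last[OF I L, of j] 1 by simp
  next
    case (Suc i)
    thus ?thesis using d dim_subst_last[OF I L, of j] 1
      hf_dim[OF hideal_subspace[OF hideal_colon[OF I l]], of "Suc n" i] by simp
  qed
qed

section \<open>The ascending chain condition for homogeneous ideals\<close>

lemma polyring_0_iff: "p \<in> polyring 0 \<longleftrightarrow> (\<exists>c. p = const_mp c)"
proof
  assume "p \<in> polyring 0"
  hence "Poly_Mapping.keys p \<subseteq> {0}" by (auto simp: polyring_def)
  hence "p = const_mp (Poly_Mapping.lookup p 0)"
    by (intro poly_mapping_eqI) (auto simp: lookup_single when_def in_keys_iff)
  thus "\<exists>c. p = const_mp c" by blast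
qed auto

lemma is_ideal_0_cases:
  assumes "is_ideal 0 I" shows "I = {0} \<or> I = polyring 0"
proof (cases "I \<subseteq> {0}")
  case True thus ?thesis using is_idealD(2)[OF assms] by auto
next
  case False
  then obtain c where c: "const_mp c \<in> I" "c \<noteq> 0"
    using is_idealD(1)[OF assms] polyring_0_iff by (metis single_zero singletonI subsetI)
  have "const_mp b \<in> I" for b
    using is_idealD(5)[OF assms _ c(1), of "const_mp (b / c)"] c(2) by (simp add: mult_single)
  hence "polyring 0 \<subseteq> I" by (auto simp: polyring_0_iff)
  thus ?thesis using assms by (auto simp: is_ideal_def)
qed

lemma colon_mono: "I \<subseteq> K \<Longrightarrow> colon n I g \<subseteq> colon n K g"
  by (auto simp: colon_def)

lemma var_pow_forms: "var n ^ k \<in> forms (Suc n) k"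
  by (auto simp: forms_def intro: polyring_power homog_power[of _ 1, simplified])

lemma zero_forms_1: "0 \<in> forms n 1"
  by (rule forms_0)

text \<open>The images of the colons (I : x_n^k) under x_n = 0 determine I and live in one variable fewer.
  A chain of ideals thus yields a doubly indexed monotone family, whose diagonal stabilises by
  induction on the number of variables.\<close>

lemma hideal_eq_by_slices:
  assumes A: "hideal (Suc n) A" and B: "hideal (Suc n) B" and AB: "A \<subseteq> B"
    and slices: "\<And>k. subst_last n 0 ` colon (Suc n) A (var n ^ k)
                   = subst_last n 0 ` colon (Suc n) B (var n ^ k)"
  shows "A = B"
proof (rule antisym[OF AB])
  note v = var_pow_forms
  have hA: "hideal (Suc n) (colon (Suc n) A (var n ^ k))"
    and hB: "hideal (Suc n) (colon (Suc n) B (var n ^ k))" for k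
    using hideal_colon v A B by blast+
  \<comment> \<open>Induction on the degree, for all k at once: equal slices allow p to be corrected
    by an element of the A-side so that x_n divides the difference; the cofactor has smaller degree
    and lies in the colon by the next power of x_n.\<close>
  have "colon (Suc n) B (var n ^ k) \<inter> forms (Suc n) j \<subseteq> colon (Suc n) A (var n ^ k)" for k j
  proof (induction j arbitrary: k)
    case 0
    show ?case
    proof
      fix p assume p: "p \<in> colon (Suc n) B (var n ^ k) \<inter> forms (Suc n) 0"
      hence "subst_last n 0 p \<in> subst_last n 0 ` (colon (Suc n) A (var n ^ k) \<inter> forms (Suc n) 0)"
        using slices[of k] subst_last_image_forms[OF hA zero_forms_1]
          subst_last_image_forms[OF hB zero_forms_1] by blast
      then obtain q where q: "q \<in> colon (Suc n) A (var n ^ k)" "q \<in> forms (Suc n) 0"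
        "subst_last n 0 p = subst_last n 0 q" by blast
      have "p - q \<in> forms (Suc n) 0" using p q(2) forms_diff by blast
      hence "p - q = 0"
        by (rule subst_last_kernel_homog_0[OF zero_forms_1])
          (simp_all add: subst_last_diff q(3))
      thus "p \<in> colon (Suc n) A (var n ^ k)" using q by simp
    qed
  next
    case (Suc j)
    show ?case
    proof
      fix p assume p: "p \<in> colon (Suc n) B (var n ^ k) \<inter> forms (Suc n) (Suc j)"
      hence "subst_last n 0 p \<in> subst_last n 0 ` (colon (Suc n) A (var n ^ k) \<inter> forms (Suc n) (Suc j))"
        using slices[of k] subst_last_image_forms[OF hA zero_forms_1]
          subst_last_image_forms[OF hB zero_forms_1] by blast
      then obtain q where q: "q \<in> colon (Suc n) A (var n ^ k)" "q \<in> forms (Suc n) (Suc j)"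
        "subst_last n 0 p = subst_last n 0 q" by blast
      have "p - q \<in> forms (Suc n) (Suc j)" using p q(2) forms_diff by blast
      moreover have "subst_last n 0 (p - q) = 0" using q(3) by (simp add: subst_last_diff)
      ultimately obtain r where r: "r \<in> forms (Suc n) j" "p - q = (var n - 0) * r"
        by (rule subst_last_kernel_homog[OF zero_forms_1])
      have "q \<in> colon (Suc n) B (var n ^ k)" using q(1) colon_mono[OF AB] by blast
      hence "p - q \<in> colon (Suc n) B (var n ^ k)" using p hidealD(4)[OF hB] by blast
      hence "r \<in> colon (Suc n) B (var n ^ Suc k)"
        using r forms_polyring[OF r(1)] by (simp add: colon_def mult_ac)
      hence "r \<in> colon (Suc n) A (var n ^ Suc k)" using Suc.IH r(1) by blast
      hence "p - q \<in> colon (Suc n) A (var n ^ k)"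
        using r forms_polyring[OF r(1)] by (simp add: colon_def mult_ac polyring_mult)
      thus "p \<in> colon (Suc n) A (var n ^ k)" using hidealD(3)[OF hA _ q(1)] by fastforce
    qed
  qed
  from this[of 0] have "B \<inter> forms (Suc n) j \<subseteq> A" for j
    using hidealD(1)[OF B] by (auto simp: colon_def)
  thus "B \<subseteq> A" by (intro hideal_subset[OF B] hideal_is_ideal[OF A])
qed

theorem hideal_acc:
  fixes I :: "nat \<Rightarrow> 'k::field mpoly set"
  assumes "\<And>i. hideal n (I i)" "\<And>i. I i \<subseteq> I (Suc i)"
  shows "\<exists>N. \<forall>i\<ge>N. I i = I N"
  using assms
proof (induction n arbitrary: I)
  case 0
  have mono: "I i \<subseteq> I j" if "i \<le> j" for i j using lift_Suc_mono_le[of I] 0(2) that by blast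
  show ?case
  proof (cases "\<exists>N. I N = polyring 0")
    case True
    then obtain N where "I N = polyring 0" by blast
    moreover have "I i \<subseteq> polyring 0" for i using hidealD(1)[OF 0(1)] by blast
    ultimately show ?thesis using mono by (intro exI[of _ N]) blast
  next
    case False
    hence "I i = {0}" for i using is_ideal_0_cases[OF hideal_is_ideal[OF 0(1)]] by blast
    thus ?thesis by auto
  qed
next
  case (Suc n)
  note v = var_pow_forms
  have mono: "I i \<subseteq> I j" if "i \<le> j" for i j using lift_Suc_mono_le[of I] Suc(3) that by blast
  define \<Phi> where "\<Phi> k i = subst_last n 0 ` colon (Suc n) (I i) (var n ^ k)" for k i
  have h\<Phi>: "hideal n (\<Phi> k i)" for k i
    unfolding \<Phi>_def using hideal_subst_last hideal_colon v Suc(2) zero_forms_1 by blast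
  have m\<Phi>: "\<Phi> k i \<subseteq> \<Phi> k' i'" if "k \<le> k'" "i \<le> i'" for k k' i i'
  proof -
    have "colon (Suc n) (I i') (var n ^ k) \<subseteq> colon (Suc n) (I i') (var n ^ k')"
    proof
      fix p assume p: "p \<in> colon (Suc n) (I i') (var n ^ k)"
      have "(var n :: 'k mpoly) ^ k' = var n ^ (k' - k) * var n ^ k"
        using that(1) by (simp flip: power_add)
      hence "var n ^ k' * p = var n ^ (k' - k) * (var n ^ k * p)" by (simp only: mult.assoc)
      also have "\<dots> \<in> I i'"
        using p hidealD(5)[OF Suc(2) forms_polyring[OF v]] by (simp add: colon_def)
      finally show "p \<in> colon (Suc n) (I i') (var n ^ k')"
        using p by (simp add: colon_def)
    qed
    thus ?thesis unfolding \<Phi>_def using colon_mono[OF mono[OF that(2)]] by blast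
  qed
  obtain N0 where N0: "\<And>i. i \<ge> N0 \<Longrightarrow> \<Phi> i i = \<Phi> N0 N0"
    using Suc.IH[of "\<lambda>i. \<Phi> i i"] h\<Phi> m\<Phi> by auto
  have "\<exists>N. \<forall>i\<ge>N. \<Phi> k i = \<Phi> k N" for k
    using Suc.IH[of "\<lambda>i. \<Phi> k i"] h\<Phi> m\<Phi> by auto
  then obtain M where M: "\<And>k i. i \<ge> M k \<Longrightarrow> \<Phi> k i = \<Phi> k (M k)" by metis
  \<comment> \<open>Only the finitely many rows k < \<open>N0\<close> need their own bounds
    \<open>M k\<close>. For k and i at least \<open>N0\<close>, \<Phi> k i is squeezed between two
    values on the diagonal, which are equal.\<close>
  define N where "N = Max (insert N0 (M ` {..<N0}))"
  have N: "N \<ge> N0" "\<And>k. k < N0 \<Longrightarrow> N \<ge> M k" unfolding N_def by auto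
  have "\<Phi> k i = \<Phi> k N" if "i \<ge> N" for i k
  proof (cases "k < N0")
    case True thus ?thesis using M[of k i] M[of k N] N(2) that by (metis order.trans)
  next
    case False
    have "\<Phi> N0 N0 \<subseteq> \<Phi> k N" using m\<Phi> False N(1) by simp
    moreover have "\<Phi> k N \<subseteq> \<Phi> k i" using m\<Phi> that by simp
    moreover have "\<Phi> k i \<subseteq> \<Phi> N0 N0"
      using m\<Phi>[of k "max k i" i "max k i"] N0[of "max k i"] False by simp
    ultimately show ?thesis by blast
  qed
  hence "I i = I N" if "i \<ge> N" for i
    using hideal_eq_by_slices[OF Suc(2) Suc(2) mono[OF that]] that unfolding \<Phi>_def by metis
  thus ?case by blast
qed

section \<open>Linear non-zero-divisors\<close>

text \<open>Every monomial of g has positive degree and hence contains a variable. Applied to v = 1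
  it shows that a linear form in variables of K lies in K; applied to a socle element v it shows
  that all forms of positive degree kill v.\<close>

lemma maximal_ideal_mult:
  assumes K: "is_ideal n K" and g: "g \<in> forms n (Suc e)" and v: "\<And>i. i < n \<Longrightarrow> var i * v \<in> K"
  shows "g * v \<in> K"
proof -
  have "Poly_Mapping.single m (Poly_Mapping.lookup g m) * v \<in> K"
    if m: "m \<in> Poly_Mapping.keys g" for m
  proof -
    have "mdeg m \<noteq> 0" and mn: "Poly_Mapping.keys m \<subseteq> {..<n}"
      using m g by (auto simp: forms_def homog_def polyring_def)
    hence "Poly_Mapping.keys m \<noteq> {}" by auto
    then obtain i where i: "i \<in> Poly_Mapping.keys m" by blast
    let ?m = "m - Poly_Mapping.single i 1"
    have le: "Poly_Mapping.lookup m i \<ge> 1" using i by (simp add: in_keys_iff Suc_le_eq)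
    have "m = Poly_Mapping.single i 1 + ?m"
      by (rule poly_mapping_eqI) (use le in \<open>auto simp: lookup_add lookup_minus lookup_single when_def\<close>)
    hence eq: "Poly_Mapping.single m c = var i * Poly_Mapping.single ?m c" for c :: 'a
      unfolding var_def by (simp add: mult_single)
    have "Poly_Mapping.keys ?m \<subseteq> Poly_Mapping.keys m"
      by (auto simp: in_keys_iff lookup_minus lookup_single when_def)
    hence "Poly_Mapping.single ?m c \<in> polyring n" for c :: 'a
      using mn by (auto simp: polyring_def)
    moreover have "Poly_Mapping.single m c * v = Poly_Mapping.single ?m c * (var i * v)" for c
      unfolding eq by (simp only: mult_ac)
    moreover have "var i * v \<in> K" using v i mn by blast
    ultimately show ?thesis using is_idealD(5)[OF K] by metis
  qed
  hence "(\<Sum>m\<in>Poly_Mapping.keys g. Poly_Mapping.single m (Poly_Mapping.lookup g m) * v) \<in> K"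
    by (intro mp.subspace_sum is_ideal_subspace[OF K])
  thus ?thesis
    by (simp only: sum_distrib_right[symmetric] poly_eq_sum_single[of g, symmetric])
qed

text \<open>Without a maximal member, dependent choice would build a strictly increasing chain,
  against \<open>hideal_acc\<close>.\<close>

lemma hideal_exists_maximal:
  fixes A :: "'k::field mpoly set set"
  assumes "\<And>K. K \<in> A \<Longrightarrow> hideal n K" "K0 \<in> A"
  obtains K where "K \<in> A" "K0 \<subseteq> K" "\<And>K'. K' \<in> A \<Longrightarrow> K \<subseteq> K' \<Longrightarrow> K' = K"
proof -
  have "\<exists>K\<in>A. K0 \<subseteq> K \<and> (\<forall>K'\<in>A. K \<subseteq> K' \<longrightarrow> K' = K)"
  proof (rule ccontr)
    assume neg: "\<not> (\<exists>K\<in>A. K0 \<subseteq> K \<and> (\<forall>K'\<in>A. K \<subseteq> K' \<longrightarrow> K' = K))"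
    have *: "\<exists>K'\<in>A. K \<subset> K'" if "K \<in> A" "K0 \<subseteq> K" for K
      using neg that by (metis psubsetI)
    have "\<exists>f. \<forall>i. (f i \<in> A \<and> K0 \<subseteq> f i) \<and> f i \<subset> f (Suc i)"
    proof (rule dependent_nat_choice)
      show "\<exists>K. K \<in> A \<and> K0 \<subseteq> K" using assms(2) by blast
      fix K and i :: nat assume "K \<in> A \<and> K0 \<subseteq> K"
      moreover from this obtain K' where "K' \<in> A" "K \<subset> K'" using *[of K] by blast
      ultimately show "\<exists>K'. (K' \<in> A \<and> K0 \<subseteq> K') \<and> K \<subset> K'"
        by (intro exI[of _ K']) auto
    qed
    then obtain f where f: "\<And>i. f i \<in> A" "\<And>i. f i \<subset> f (Suc i)" by blast
    have "hideal n (f i)" for i by (rule assms(1)[OF f(1)])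
    moreover have "f i \<subseteq> f (Suc i)" for i using f(2)[of i] by (rule psubset_imp_subset)
    ultimately have "\<exists>N. \<forall>i\<ge>N. f i = f N" by (rule hideal_acc)
    then obtain N where "\<forall>i\<ge>N. f i = f N" ..
    hence "f (Suc N) = f N" using le_SucI[OF order_refl] by blast
    thus False using f(2)[of N] by blast
  qed
  then obtain K where "K \<in> A" "K0 \<subseteq> K" "\<forall>K'\<in>A. K \<subseteq> K' \<longrightarrow> K' = K" by auto
  thus ?thesis using that[of K] by auto
qed

section \<open>Homogeneous associated primes and avoidance by linear forms\<close>

definition annihilators :: "nat \<Rightarrow> 'k::field mpoly set \<Rightarrow> 'k mpoly set set" where
  "annihilators n I = {colon n I v | v. v \<notin> I \<and> (\<exists>j. v \<in> forms n j)}"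

text \<open>These are associated primes of S/I; each form that is a zero divisor modulo I lies in
  one of them.\<close>

definition max_annihilators :: "nat \<Rightarrow> 'k::field mpoly set \<Rightarrow> 'k mpoly set set" where
  "max_annihilators n I
     = {K \<in> annihilators n I. \<forall>K'\<in>annihilators n I. K \<subseteq> K' \<longrightarrow> K' = K}"

lemma annihilators_hideal: "hideal n I \<Longrightarrow> K \<in> annihilators n I \<Longrightarrow> hideal n K"
  unfolding annihilators_def using hideal_colon by blast

text \<open>If b * v is nonzero modulo I, its annihilator contains that of v and so equals it by
  maximality; a kills b * v. Taking b homogeneous keeps b * v among the elements that define
  \<open>annihilators\<close>.\<close>

lemma max_annihilator_prime:
  assumes I: "hideal n I" and K: "K \<in> max_annihilators n I"
    and b: "b \<in> forms n e" "b \<notin> K" and a: "a \<in> polyring n" "b * a \<in> K"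
  shows "a \<in> K"
proof -
  obtain v j where v: "K = colon n I v" "v \<notin> I" "v \<in> forms n j"
    and max: "\<And>K'. K' \<in> annihilators n I \<Longrightarrow> K \<subseteq> K' \<Longrightarrow> K' = K"
    using K by (auto simp: max_annihilators_def annihilators_def)
  have bv: "b * v \<in> forms n (e + j)" using forms_mult b(1) v(3) by blast
  have "b * v \<notin> I" using b v forms_polyring[OF b(1)] by (auto simp: colon_def mult.commute)
  hence "colon n I (b * v) \<in> annihilators n I" using bv unfolding annihilators_def by blast
  moreover have "K \<subseteq> colon n I (b * v)"
    using hidealD(5)[OF I forms_polyring[OF b(1)]] v(1) by (auto simp: colon_def mult.assoc)
  ultimately have "colon n I (b * v) = K" using max by blast
  moreover have "a \<in> colon n I (b * v)"
    using a v(1) by (simp add: colon_def mult_ac)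
  ultimately show ?thesis by simp
qed

text \<open>Otherwise there are infinitely many distinct P_i = (I : v_i), and by the chain condition some v_k
  lies in (I, v_0, ..., v_(k-1)). A product of elements of P_i outside P_k, one for each i < k, then
  annihilates v_k, contradicting primality of P_k.\<close>

lemma finite_max_annihilators:
  assumes I: "hideal n I" shows "finite (max_annihilators n I)"
proof (rule ccontr)
  assume "infinite (max_annihilators n I)"
  then obtain P :: "nat \<Rightarrow> 'a mpoly set" where inj: "inj P" and P: "range P \<subseteq> max_annihilators n I"
    using infinite_countable_subset by blast
  hence "\<forall>i. \<exists>v. P i = colon n I v \<and> v \<notin> I \<and> (\<exists>j. v \<in> forms n j)"
    by (auto simp: max_annihilators_def annihilators_def subset_iff image_iff)
  then obtain v where v: "\<And>i. P i = colon n I (v i)" "\<And>i. v i \<notin> I" "\<And>i. \<exists>j. v i \<in> forms n j"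
    by metis
  have hP: "hideal n (P i)" for i
    using P annihilators_hideal[OF I] unfolding max_annihilators_def by blast
  define J where "J = rec_nat I (\<lambda>k K. adjoin n K (v k))"
  have J: "J 0 = I" "J (Suc k) = adjoin n (J k) (v k)" for k by (simp_all add: J_def)
  have hJ: "hideal n (J k)" for k
  proof (induction k)
    case (Suc k)
    obtain j where "v k \<in> forms n j" using v(3) by blast
    thus ?case unfolding J(2) by (rule hideal_adjoin[OF Suc])
  qed (use I in \<open>simp add: J\<close>)
  have "J k \<subseteq> J (Suc k)" for k
    unfolding J(2) by (rule adjoin_superset[OF hideal_is_ideal[OF hJ]])
  hence "\<exists>N. \<forall>k\<ge>N. J k = J N" by (rule hideal_acc[OF hJ])
  then obtain k where "\<forall>i\<ge>k. J i = J k" ..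
  hence "J (Suc k) = J k" using le_SucI[OF order_refl] by blast
  moreover have "v k * 1 \<in> adjoin n (J k) (v k)"
    by (rule adjoin_base[OF hideal_is_ideal[OF hJ] polyring_1])
  ultimately have vk: "v k \<in> J k" by (simp add: J(2))
  have ann: "p * x \<in> I" if "p \<in> polyring n" "\<And>i. i < m \<Longrightarrow> p \<in> P i" "x \<in> J m" for p x m
    using that(2,3)
  proof (induction m arbitrary: x)
    case 0
    thus ?case using hidealD(5)[OF I that(1)] by (simp add: J)
  next
    case (Suc m)
    then obtain y q where y: "x = y + v m * q" "y \<in> J m" "q \<in> polyring n"
      by (auto simp: J(2) adjoin_def)
    have "v m * p \<in> I" using Suc.prems(1)[of m] v(1) by (simp add: colon_def)
    hence "(v m * p) * q \<in> I" using hidealD(6)[OF I y(3)] by blast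
    moreover have "p * y \<in> I" using Suc y(2) by simp
    ultimately have "p * y + (v m * p) * q \<in> I" using hidealD(3)[OF I] by blast
    thus ?case by (simp add: y(1) algebra_simps)
  qed
  \<comment> \<open>Distinct maximal annihilators are incomparable, and by homogeneity the failure
    of P_i \<subseteq> P_k is witnessed by a form.\<close>
  have "\<exists>b. b \<in> P i \<and> b \<notin> P k \<and> (\<exists>e. b \<in> forms n e)" if "i < k" for i
  proof (rule ccontr)
    assume *: "\<not> ?thesis"
    have "P i \<subseteq> P k" by (rule hideal_subset[OF hP hideal_is_ideal[OF hP]]) (use * in blast)
    moreover have "P i \<in> max_annihilators n I" "P k \<in> max_annihilators n I" using P by blast+
    ultimately have "P k = P i" by (simp add: max_annihilators_def)
    thus False using inj \<open>i < k\<close> by (simp add: inj_eq)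
  qed
  then obtain b where b: "\<And>i. i < k \<Longrightarrow> b i \<in> P i" "\<And>i. i < k \<Longrightarrow> b i \<notin> P k"
    "\<And>i. i < k \<Longrightarrow> \<exists>e. b i \<in> forms n e" by metis
  have bp: "b i \<in> polyring n" if "i < k" for i using hidealD(1)[OF hP] b(1) that by blast
  have "prod b {..<m} \<notin> P k" if "m \<le> k" for m
    using that
  proof (induction m)
    case 0
    thus ?case using v(1)[of k] v(2)[of k] by (simp add: colon_def)
  next
    case (Suc m)
    have "b m * prod b {..<m} \<notin> P k"
    proof
      assume in_P: "b m * prod b {..<m} \<in> P k"
      have "P k \<in> max_annihilators n I" using P by blast
      moreover obtain e where "b m \<in> forms n e" using b(3)[of m] Suc.prems by auto
      moreover have "b m \<notin> P k" using b(2)[of m] Suc.prems by simp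
      moreover have "prod b {..<m} \<in> polyring n"
        using bp Suc.prems by (intro polyring_prod) simp
      ultimately have "prod b {..<m} \<in> P k" using max_annihilator_prime[OF I] in_P by metis
      thus False using Suc by simp
    qed
    thus ?case by (simp add: mult.commute)
  qed
  hence 1: "prod b {..<k} \<notin> P k" by simp
  have pk: "prod b {..<k} \<in> polyring n" using bp by (intro polyring_prod) auto
  have "prod b {..<k} \<in> P i" if "i < k" for i
  proof -
    have "prod b {..<k} = prod b ({..<k} - {i}) * b i"
      using that by (simp add: prod.remove[of _ i] mult.commute)
    moreover have "prod b ({..<k} - {i}) \<in> polyring n" using bp by (intro polyring_prod) auto
    ultimately show ?thesis using hidealD(5)[OF hP _ b(1)[OF that]] by simp
  qed
  hence "prod b {..<k} * v k \<in> I" using ann[OF pk _ vk] by blast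
  thus False using 1 pk v(1) by (simp add: colon_def mult.commute)
qed

text \<open>Avoidance over an infinite field, one ideal at a time: if the current form lies in P, it
  is moved along the line L + t * x_i with x_i outside P, and every ideal forbids at most one value
  of t.\<close>

lemma linear_form_avoidance:
  fixes M :: "'k::field mpoly set set"
  assumes inf: "infinite (UNIV :: 'k set)" and "finite M"
    and M: "\<And>P. P \<in> M \<Longrightarrow> is_ideal (Suc n) P" "\<And>P. P \<in> M \<Longrightarrow> \<exists>i<Suc n. var i \<notin> P"
  shows "\<exists>L\<in>forms n 1. \<forall>P\<in>M. var n - L \<notin> P"
  using assms(2,3,4)
proof (induction M rule: finite_induct)
  case empty
  thus ?case using forms_0 by blast
next
  case (insert P F)
  then obtain L where L: "L \<in> forms n 1" "\<And>P'. P' \<in> F \<Longrightarrow> var n - L \<notin> P'" by auto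
  note idP = insert.prems(1)
  show ?case
  proof (cases "var n - L \<in> P")
    case False thus ?thesis using L by blast
  next
    case True
    \<comment> \<open>If all earlier variables were in P, then L would be too, and with x_n - L also
      x_n; then P would contain every variable.\<close>
    have "\<exists>i<n. var i \<notin> P"
    proof (rule ccontr)
      assume *: "\<not> ?thesis"
      have "is_ideal n (P \<inter> polyring n)"
        using is_idealD[OF idP[of P]] polyring_mono[of n "Suc n", where ?'a = 'k]
        by (auto simp: is_ideal_def polyring_add polyring_mult)
      from maximal_ideal_mult[OF this, of L 0 1] have "L \<in> P" using L(1) * by auto
      hence "var n \<in> P" using is_idealD(3)[OF idP[of P] True \<open>L \<in> P\<close>] by simp
      thus False using * insert.prems(2)[of P] less_Suc_eq by blast
    qed
    then obtain i where i: "i < n" "var i \<notin> P" by blast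
    let ?l = "\<lambda>t. var n - (L + const_mp t * var i)"
    \<comment> \<open>Two forbidden values would put x_i, and with it x_n - L, into P'. For P' = P
      this contradicts the choice of i, for the other ideals the choice of L.\<close>
    have "finite {t. ?l t \<in> P'}" if P': "P' \<in> insert P F" for P'
    proof (rule ccontr)
      assume infT: "infinite {t. ?l t \<in> P'}"
      then obtain t where t: "?l t \<in> P'" by (metis (mono_tags) finite.emptyI Collect_empty_eq)
      have "infinite ({t. ?l t \<in> P'} - {t})" using infT by simp
      then obtain s where s: "?l s \<in> P'" "s \<noteq> t"
        by (metis (mono_tags, lifting) DiffE equals0I finite.emptyI mem_Collect_eq singletonI)
      have "const_mp (1 / (t - s)) * (?l s - ?l t) \<in> P'"
        using is_idealD(4)[OF idP[OF P'] s(1) t] is_idealD(5)[OF idP[OF P'] polyring_const] by blast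
      also have "?l s - ?l t = const_mp (t - s) * var i"
        by (simp add: single_diff algebra_simps)
      also have "const_mp (1 / (t - s)) * (const_mp (t - s) * var i) = var i"
        using s(2) by (simp add: mult.assoc[symmetric] mult_single)
      finally have v: "var i \<in> P'" .
      have "?l t + const_mp t * var i \<in> P'"
        using is_idealD(3)[OF idP[OF P'] t] is_idealD(5)[OF idP[OF P'] polyring_const v] by blast
      hence "var n - L \<in> P'" by simp
      thus False using P' v i(2) L(2) by blast
    qed
    hence "finite (\<Union>P'\<in>insert P F. {t. ?l t \<in> P'})" using insert.hyps(1) by blast
    then obtain t where t: "t \<notin> (\<Union>P'\<in>insert P F. {t. ?l t \<in> P'})"
      using inf ex_new_if_finite by blast
    have "const_mp t * var i \<in> forms n 1"
      using i(1) homog_mult[of "const_mp t" 0 "var i" 1] by (simp add: forms_def polyring_mult)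
    hence "L + const_mp t * var i \<in> forms n 1" using forms_add L(1) by blast
    thus ?thesis using t by blast
  qed
qed

text \<open>The hypothesis says that S/I has no nonzero homogeneous socle element, so no maximal
  annihilator contains all variables. A linear form outside the finitely many of them is regular,
  since a zero divisor would lie in one.\<close>

theorem exists_linear_nzd:
  fixes I :: "'k::field mpoly set"
  assumes inf: "infinite (UNIV :: 'k set)" and I: "hideal (Suc n) I"
    and socle: "\<And>j v. v \<in> forms (Suc n) j \<Longrightarrow> (\<And>i. i < Suc n \<Longrightarrow> var i * v \<in> I) \<Longrightarrow> v \<in> I"
  obtains L where "L \<in> forms n 1" "nzd (Suc n) I (var n - L)"
proof -
  let ?M = "max_annihilators (Suc n) I"
  have "\<exists>i<Suc n. var i \<notin> P" if P: "P \<in> ?M" for P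
  proof -
    obtain v j where v: "P = colon (Suc n) I v" "v \<notin> I" "v \<in> forms (Suc n) j"
      using P by (auto simp: max_annihilators_def annihilators_def)
    then obtain i where "i < Suc n" "var i * v \<notin> I" using socle by blast
    thus ?thesis using v(1) by (auto simp: colon_def mult.commute)
  qed
  moreover have "is_ideal (Suc n) P" if "P \<in> ?M" for P
    using that annihilators_hideal[OF I] hideal_is_ideal unfolding max_annihilators_def by blast
  ultimately have "\<exists>L\<in>forms n 1. \<forall>P\<in>?M. var n - L \<notin> P"
    by (intro linear_form_avoidance[OF inf finite_max_annihilators[OF I]])
  then obtain L where L: "L \<in> forms n 1" "\<And>P. P \<in> ?M \<Longrightarrow> var n - L \<notin> P" by auto
  have "nzd (Suc n) I (var n - L)"
  proof (rule nzd_homogI[OF I var_minus_forms[OF L(1)]], rule ccontr)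
    fix j p assume p: "p \<in> forms (Suc n) j" "(var n - L) * p \<in> I" "p \<notin> I"
    hence "colon (Suc n) I p \<in> annihilators (Suc n) I" unfolding annihilators_def by blast
    then obtain K where "K \<in> annihilators (Suc n) I" "colon (Suc n) I p \<subseteq> K"
      "\<And>K'. K' \<in> annihilators (Suc n) I \<Longrightarrow> K \<subseteq> K' \<Longrightarrow> K' = K"
      using hideal_exists_maximal[OF annihilators_hideal[OF I]] by metis
    moreover have "var n - L \<in> colon (Suc n) I p"
      using p(2) forms_polyring[OF var_minus_forms[OF L(1)]] by (simp add: colon_def mult.commute)
    ultimately show False using L(2)[of K] unfolding max_annihilators_def by blast
  qed
  thus ?thesis using that L(1) by blast
qed

section \<open>Homogeneous regular sequences\<close>

abbreviation seq_ideal :: "nat \<Rightarrow> (nat \<Rightarrow> 'k::field mpoly) \<Rightarrow> nat \<Rightarrow> 'k mpoly set" where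
  "seq_ideal n f h \<equiv> ideal_gen n (f ` {..<h})"

definition homog_regular :: "nat \<Rightarrow> nat \<Rightarrow> (nat \<Rightarrow> nat) \<Rightarrow> (nat \<Rightarrow> 'k::field mpoly) \<Rightarrow> bool" where
  "homog_regular n h d f \<longleftrightarrow> regular_seq n h f \<and> (\<forall>i<h. homog (f i) (d i))"

lemma homog_regular_forms: "homog_regular n h d f \<Longrightarrow> i < h \<Longrightarrow> f i \<in> forms n (d i)"
  by (simp add: homog_regular_def regular_seq_def forms_def)

lemma homog_regular_hideal: "homog_regular n h d f \<Longrightarrow> k \<le> h \<Longrightarrow> hideal n (seq_ideal n f k)"
proof (rule hideal_ideal_gen)
  fix g assume "homog_regular n h d f" "k \<le> h" "g \<in> f ` {..<k}"
  moreover from this obtain i where "i < k" "g = f i" by blast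
  ultimately have "g \<in> forms n (d i)" using homog_regular_forms[of n h d f i] by simp
  thus "\<exists>e. g \<in> forms n e" ..
qed

text \<open>Since 1 is its own component of degree 0, this keeps 1 out of ideals generated by forms
  of positive degree.\<close>

lemma hcomp_0_ideal_gen:
  assumes "\<And>g. g \<in> F \<Longrightarrow> \<exists>e>0. homog g e" "p \<in> ideal_gen n F"
  shows "hcomp 0 p = 0"
  using assms(2)
proof induction
  case (step g c p)
  then obtain e where "e > 0" "homog g e" using assms(1) by blast
  thus ?case using step.IH hcomp_mult[of g e 0 c] by (simp add: hcomp_add mult.commute)
qed simp

lemma forms_deg_0:
  assumes "p \<in> forms n 0" obtains c where "p = const_mp c"
proof -
  have "Poly_Mapping.keys p \<subseteq> {0}" using assms by (auto simp: forms_def homog_def)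
  hence "p = const_mp (Poly_Mapping.lookup p 0)"
    by (intro poly_mapping_eqI) (auto simp: lookup_single when_def in_keys_iff)
  thus ?thesis using that by blast
qed

lemma seq_ideal_Suc:
  assumes "\<And>i. i < Suc h \<Longrightarrow> f i \<in> polyring n"
  shows "seq_ideal n f (Suc h) = adjoin n (seq_ideal n f h) (f h)"
  using assms by (subst ideal_gen_insert[symmetric]) (auto simp: lessThan_Suc)

lemma homog_regular_0 [simp]: "homog_regular n 0 d f"
  by (simp add: homog_regular_def regular_seq_def)

lemma homog_regular_SucD:
  assumes "homog_regular n (Suc h) d f"
  shows "homog_regular n h d f" "f h \<in> forms n (d h)" "d h > 0" "nzd n (seq_ideal n f h) (f h)"
    "seq_ideal n f (Suc h) = adjoin n (seq_ideal n f h) (f h)"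
proof -
  have f: "f i \<in> polyring n" if "i < Suc h" for i
    using assms that by (simp add: homog_regular_def regular_seq_def)
  have sub: "seq_ideal n f h \<subseteq> seq_ideal n f (Suc h)"
    using f by (intro ideal_gen_mono) auto
  have one: "1 \<notin> seq_ideal n f (Suc h)" using assms by (simp add: homog_regular_def regular_seq_def)
  thus "homog_regular n h d f" using assms sub by (auto simp: homog_regular_def regular_seq_def)
  show fh: "f h \<in> forms n (d h)" using homog_regular_forms[OF assms] by simp
  show nz: "nzd n (seq_ideal n f h) (f h)"
    using assms by (auto simp: homog_regular_def regular_seq_def nzd_def)
  show "seq_ideal n f (Suc h) = adjoin n (seq_ideal n f h) (f h)"
    using f by (rule seq_ideal_Suc)
  \<comment> \<open>In degree 0 the last element is a constant: zero cannot be regular on a nonzero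
    quotient, and a nonzero constant would put 1 into the ideal.\<close>
  show "d h > 0"
  proof (rule ccontr)
    assume "\<not> d h > 0"
    then obtain c where c: "f h = const_mp c" using fh forms_deg_0[of "f h" n] by auto
    have I: "is_ideal n (seq_ideal n f h)" "is_ideal n (seq_ideal n f (Suc h))"
      using f by (auto intro!: ideal_gen_is_ideal)
    show False
    proof (cases "c = 0")
      case True
      hence "f h * 1 \<in> seq_ideal n f h" using c is_idealD(2)[OF I(1)] by simp
      thus False using nz one sub unfolding nzd_def by (meson polyring_1 subsetD)
    next
      case False
      have "f h \<in> seq_ideal n f (Suc h)" by (intro ideal_gen_base) simp
      hence "const_mp (1 / c) * f h \<in> seq_ideal n f (Suc h)"
        using is_idealD(5)[OF I(2) polyring_const] by blast
      thus False using one False by (simp add: c mult_single)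
    qed
  qed
qed

lemma homog_regular_SucI:
  assumes "homog_regular n h d f" "f h \<in> forms n (d h)" "d h > 0" "nzd n (seq_ideal n f h) (f h)"
    "\<And>i. i < h \<Longrightarrow> d i > 0"
  shows "homog_regular n (Suc h) d f"
proof -
  have "hcomp 0 p = 0" if "p \<in> seq_ideal n f (Suc h)" for p
  proof (rule hcomp_0_ideal_gen[OF _ that])
    fix g assume "g \<in> f ` {..<Suc h}"
    then obtain i where "g = f i" "i < Suc h" by blast
    thus "\<exists>e>0. homog g e"
      using assms(2,3) assms(5)[of i] homog_regular_forms[OF assms(1), of i]
      by (cases "i = h") (auto simp: forms_def)
  qed
  moreover have "hcomp 0 1 = (1 :: 'a mpoly)" by (simp add: hcomp_homog[OF homog_1])
  ultimately have "1 \<notin> seq_ideal n f (Suc h)" by (metis zero_neq_one)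
  thus ?thesis
    using assms unfolding homog_regular_def regular_seq_def nzd_def forms_def by (auto simp: less_Suc_eq)
qed

lemma homog_regular_deg_pos: "homog_regular n h d f \<Longrightarrow> i < h \<Longrightarrow> d i > 0"
proof (induction h)
  case (Suc h)
  thus ?case using homog_regular_SucD(1,3)[OF Suc.prems(1)] by (cases "i = h") auto
qed simp

text \<open>A graded Nakayama argument, one step of permuting a homogeneous regular sequence. If l *
  v is in I, then v = i + p * w with i in I; cancelling p gives l * w in I, and w has smaller degree
  because e > 0.\<close>

lemma nzd_before_adjoin:
  assumes I: "hideal n I" and p: "p \<in> forms n e" "e > 0" "nzd n I p"
    and l: "l \<in> forms n e'" "nzd n (adjoin n I p) l"
  shows "nzd n I l"
proof (rule nzd_homogI[OF I l(1)])
  fix j v assume "v \<in> forms n j" "l * v \<in> I"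
  thus "v \<in> I"
  proof (induction j arbitrary: v rule: less_induct)
    case (less j)
    note v = less.prems
    have "v \<in> adjoin n I p"
      using l(2) v adjoin_superset[OF hideal_is_ideal[OF I], of p] forms_polyring
      unfolding nzd_def by blast
    then obtain i w where w: "v = i + p * w" "i \<in> I" "w \<in> polyring n" by (auto simp: adjoin_def)
    have hi: "hcomp j i \<in> I" using hideal_hcomp[OF I w(2)] .
    have v': "v = hcomp j i + (if e \<le> j then p * hcomp (j - e) w else 0)"
      using hcomp_forms[OF v(1), of j] hcomp_mult[of p e j w] p(1) by (simp add: w(1) hcomp_add forms_def)
    show "v \<in> I"
    proof (cases "e \<le> j")
      case True
      let ?w = "hcomp (j - e) w"
      have wV: "?w \<in> forms n (j - e)" by (rule forms_hcomp[OF w(3)])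
      have veq: "v = hcomp j i + p * ?w" using v' True by simp
      have "p * (l * ?w) = l * v - l * hcomp j i" by (subst veq) (simp add: algebra_simps)
      also have "\<dots> \<in> I" 
        by (rule hidealD(4)[OF I v(2) hidealD(5)[OF I forms_polyring[OF l(1)] hi]])
      finally have "l * ?w \<in> I"
        using p(3) polyring_mult[OF forms_polyring[OF l(1)] forms_polyring[OF wV]] unfolding nzd_def by blast
      hence "?w \<in> I" using less.IH[OF _ wV] True p(2) by simp
      hence "p * ?w \<in> I" using hidealD(5)[OF I forms_polyring[OF p(1)]] by blast
      hence "hcomp j i + p * ?w \<in> I" using hi hidealD(3)[OF I] by blast
      thus ?thesis using veq by simp
    qed (use v' hi in simp)
  qed
qed

text \<open>The linear form comes last in the regular sequence but is divided out first.
  \<open>nzd_before_adjoin\<close> makes it regular modulo every initial segment, so the induction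
  can proceed.\<close>

lemma homog_regular_subst_last:
  assumes L: "L \<in> forms n 1"
  shows "homog_regular (Suc n) h d f \<Longrightarrow> nzd (Suc n) (seq_ideal (Suc n) f h) (var n - L)
    \<Longrightarrow> homog_regular n h d (\<lambda>i. subst_last n L (f i))"
proof (induction h)
  case (Suc h)
  let ?I = "seq_ideal (Suc n) f h" and ?l = "var n - L" and ?p = "f h" and ?s = "subst_last n L"
  note R = homog_regular_SucD[OF Suc.prems(1)]
  have I: "hideal (Suc n) ?I" using homog_regular_hideal[OF R(1)] by simp
  note Iid = hideal_is_ideal[OF I]
  have l: "?l \<in> forms (Suc n) 1" by (rule var_minus_forms[OF L])
  have nl: "nzd (Suc n) (adjoin (Suc n) ?I ?p) ?l" using Suc.prems(2) R(5) by simp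
  have nzI: "nzd (Suc n) ?I ?l" by (rule nzd_before_adjoin[OF I R(2,3,4) l nl])
  have "f ` {..<h} \<subseteq> polyring (Suc n)" using homog_regular_forms[OF R(1)] forms_polyring by blast
  hence eq: "seq_ideal n (\<lambda>i. ?s (f i)) h = ?s ` ?I"
    by (subst subst_last_ideal_gen) (use L forms_polyring in \<open>auto simp: image_image\<close>)
  show ?case
  proof (rule homog_regular_SucI)
    show "homog_regular n h d (\<lambda>i. ?s (f i))" by (rule Suc.IH[OF R(1) nzI])
    show "?s (f h) \<in> forms n (d h)" by (rule subst_last_forms[OF L R(2)])
    show "nzd n (seq_ideal n (\<lambda>i. ?s (f i)) h) (?s (f h))"
      unfolding eq nzd_def
    proof (intro ballI impI)
      fix y assume y: "y \<in> polyring n" "?s ?p * y \<in> ?s ` ?I"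
      have yS: "y \<in> polyring (Suc n)" using y(1) polyring_mono[of n "Suc n"] by simp
      have "?s (?p * y) \<in> ?s ` ?I" using y by (simp add: subst_last_mult subst_last_id)
      \<comment> \<open>From p * y = i + l * w, regularity of l modulo I + (p) gives w = i' + p * u;
        cancelling p then leaves y - l * u in I.\<close>
      hence "?p * y \<in> adjoin (Suc n) ?I ?l"
        using subst_last_mem_iff[OF Iid forms_polyring[OF L]] polyring_mult[OF forms_polyring[OF R(2)] yS]
        by blast
      then obtain i w where w: "?p * y = i + ?l * w" "i \<in> ?I" "w \<in> polyring (Suc n)"
        by (auto simp: adjoin_def)
      have A: "is_ideal (Suc n) (adjoin (Suc n) ?I ?p)"
        by (rule is_ideal_adjoin[OF Iid forms_polyring[OF R(2)]])
      have "?l * w = ?p * y - i" using w(1) by simp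
      also have "\<dots> \<in> adjoin (Suc n) ?I ?p"
        using is_idealD(4)[OF A adjoin_base[OF Iid yS]] adjoin_superset[OF Iid] w(2) by blast
      finally have "w \<in> adjoin (Suc n) ?I ?p" using nl w(3) unfolding nzd_def by blast
      then obtain i' u where u: "w = i' + ?p * u" "i' \<in> ?I" "u \<in> polyring (Suc n)"
        by (auto simp: adjoin_def)
      have lu: "?l * u \<in> polyring (Suc n)" using polyring_mult[OF forms_polyring[OF l] u(3)] .
      have "?p * (y - ?l * u) = ?p * y - ?l * (?p * u)" by (simp add: algebra_simps)
      also have "\<dots> = i + ?l * i'" unfolding w(1) u(1) by (simp add: algebra_simps)
      also have "\<dots> \<in> ?I"
        using w(2) u(2) is_idealD(3,5)[OF Iid] forms_polyring[OF l] by blast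
      finally have "y - ?l * u \<in> ?I"
        using R(4) polyring_diff[OF yS lu] unfolding nzd_def by blast
      hence "(y - ?l * u) + ?l * u \<in> adjoin (Suc n) ?I ?l"
        using u(3) unfolding adjoin_def by blast
      hence "?s y \<in> ?s ` ?I"
        using subst_last_mem_iff[OF Iid forms_polyring[OF L] yS] by simp
      thus "y \<in> ?s ` ?I" using subst_last_id[OF y(1)] by simp
    qed
  qed (use R homog_regular_deg_pos[OF R(1)] in auto)
qed simp

section \<open>The socle of a complete intersection\<close>

text \<open>If p and q are both regular modulo I, multiplication by q and by p identifies the socles of
  S/(I,p) and S/(I,q) with the socle of S/(I,pq). This trades a generator of a complete
  intersection for a linear form.\<close>

lemma socle_exchange:
  assumes I: "hideal n I" and p: "p \<in> forms n d" "nzd n I p" and q: "q \<in> forms n 1" "nzd n I q"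
    and v: "v \<in> forms n e" "v \<notin> adjoin n I p" "\<And>i. i < n \<Longrightarrow> var i * v \<in> adjoin n I p"
  obtains w where "d \<le> Suc e" "w \<in> forms n (Suc e - d)" "w \<notin> adjoin n I q"
    "\<And>i. i < n \<Longrightarrow> var i * w \<in> adjoin n I q"
proof -
  note Iid = hideal_is_ideal[OF I] and pP = forms_polyring[OF p(1)] and qP = forms_polyring[OF q(1)]
  have q': "q \<in> forms n (Suc 0)" using q(1) by simp
  have Ap: "is_ideal n (adjoin n I p)" using is_ideal_adjoin[OF Iid pP] .
  \<comment> \<open>A socle element is killed by all forms of positive degree, in particular by q.
    The partner w is the cofactor in q * v = p * w modulo I.\<close>
  have "q * v \<in> adjoin n I p" by (rule maximal_ideal_mult[OF Ap q' v(3)])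
  then obtain i w0 where w0: "q * v = i + p * w0" "i \<in> I" "w0 \<in> polyring n"
    by (auto simp: adjoin_def)
  have qv: "q * v \<in> forms n (Suc e)" using forms_mult[OF q' v(1)] by simp
  have "q * v = hcomp (Suc e) i + hcomp (Suc e) (p * w0)"
    using hcomp_forms[OF qv, of "Suc e"] w0(1) by (simp add: hcomp_add)
  moreover have "hcomp (Suc e) i \<in> I" using hideal_hcomp[OF I w0(2)] .
  ultimately obtain i' where i': "i' \<in> I" "q * v = i' + hcomp (Suc e) (p * w0)" by blast
  have hcp: "hcomp (Suc e) (p * w0) = (if d \<le> Suc e then p * hcomp (Suc e - d) w0 else 0)"
    using p(1) by (intro hcomp_mult) (simp add: forms_def)
  have vP: "v \<in> polyring n" using forms_polyring[OF v(1)] .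
  have vI: "v \<notin> I" using v(2) adjoin_superset[OF Iid, of p] by blast
  \<comment> \<open>Otherwise p * w0 has no component of degree e + 1, so q * v would lie in I, and
    so would v.\<close>
  have d: "d \<le> Suc e"
  proof (rule ccontr)
    assume "\<not> d \<le> Suc e"
    hence "q * v \<in> I" using i' hcp by simp
    thus False using q(2) vP vI unfolding nzd_def by blast
  qed
  define w where "w = hcomp (Suc e - d) w0"
  have wV: "w \<in> forms n (Suc e - d)" unfolding w_def by (rule forms_hcomp[OF w0(3)])
  have wP: "w \<in> polyring n" using forms_polyring[OF wV] .
  have eq: "q * v = i' + p * w" using i'(2) hcp d by (simp add: w_def)
  have "w \<notin> adjoin n I q"
  proof
    assume "w \<in> adjoin n I q"
    then obtain j t where t: "w = j + q * t" "j \<in> I" "t \<in> polyring n" by (auto simp: adjoin_def)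
    have "q * (v - p * t) = q * v - p * (q * t)" by (simp add: algebra_simps)
    also have "\<dots> = i' + p * j" unfolding eq t(1) by (simp add: algebra_simps)
    also have "\<dots> \<in> I" using is_idealD(3)[OF Iid i'(1) is_idealD(5)[OF Iid pP t(2)]] .
    finally have "v - p * t \<in> I"
      using q(2) polyring_diff[OF vP polyring_mult[OF pP t(3)]] unfolding nzd_def by blast
    hence "(v - p * t) + p * t \<in> adjoin n I p" using t(3) unfolding adjoin_def by blast
    thus False using v(2) by simp
  qed
  moreover have "var k * w \<in> adjoin n I q" if k: "k < n" for k
  proof -
    have kP: "var k \<in> polyring n" using k by simp
    obtain j s where s: "var k * v = j + p * s" "j \<in> I" "s \<in> polyring n"
      using v(3)[OF k] by (auto simp: adjoin_def)
    \<comment> \<open>Modulo I, p * (x_k * w) = q * (x_k * v) = q * p * s, and p can be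
      cancelled.\<close>
    have "p * (var k * w - q * s) = var k * (i' + p * w) - var k * i' - q * (p * s)"
      by (simp add: algebra_simps)
    also have "\<dots> = q * (var k * v) - q * (p * s) - var k * i'"
      unfolding eq[symmetric] by (simp add: algebra_simps)
    also have "\<dots> = q * j - var k * i'" unfolding s(1) by (simp add: algebra_simps)
    also have "\<dots> \<in> I"
      using is_idealD(4)[OF Iid is_idealD(5)[OF Iid qP s(2)] is_idealD(5)[OF Iid kP i'(1)]] .
    finally have "var k * w - q * s \<in> I"
      using p(2) polyring_diff[OF polyring_mult[OF kP wP] polyring_mult[OF qP s(3)]]
      unfolding nzd_def by blast
    hence "(var k * w - q * s) + q * s \<in> adjoin n I q" using s(3) unfolding adjoin_def by blast
    thus ?thesis by simp
  qed
  ultimately show ?thesis using that[OF d wV] by blast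
qed

lemma subst_last_seq_ideal:
  assumes "homog_regular (Suc n) h d f" "L \<in> forms n 1"
  shows "seq_ideal n (\<lambda>i. subst_last n L (f i)) h = subst_last n L ` seq_ideal (Suc n) f h"
proof -
  have "f ` {..<h} \<subseteq> polyring (Suc n)" using homog_regular_forms[OF assms(1)] forms_polyring by blast
  thus ?thesis
    by (subst subst_last_ideal_gen) (use assms(2) forms_polyring in \<open>auto simp: image_image\<close>)
qed

text \<open>Exchanging the last generator for a linear form shifts the socle degree by d_h - 1, and
  substituting the form away leaves h generators in one variable fewer. The case n > h, in which
  there is no socle, provides the regular linear form for the next step, so all n are treated
  together. The vanishing beyond the socle degree comes from Hilbert functions.\<close>

theorem socle_complete_intersection:
  fixes f :: "nat \<Rightarrow> 'k::field mpoly"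
  assumes inf: "infinite (UNIV :: 'k set)"
  shows "homog_regular n h d f \<Longrightarrow> h \<le> n \<Longrightarrow>
    (\<forall>e v. v \<in> forms n e \<longrightarrow> v \<notin> seq_ideal n f h \<longrightarrow> (\<forall>i<n. var i * v \<in> seq_ideal n f h)
        \<longrightarrow> n = h \<and> e = (\<Sum>i<h. d i - 1))
    \<and> (n = h \<longrightarrow> (\<forall>j>(\<Sum>i<h. d i - 1). hf n (seq_ideal n f h) j = 0))"
proof (induction h arbitrary: n f)
  case 0
  have "n = 0 \<and> e = 0" if v: "v \<in> forms n e" "v \<noteq> 0" "\<forall>i<n. var i * v = 0" for e and v :: "'k mpoly"
  proof -
    have "var 0 \<noteq> (0 :: 'k mpoly)"
      unfolding var_def by (metis lookup_single_eq lookup_zero zero_neq_one)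
    hence n: "n = 0" using v(2,3) by (cases n) auto
    then obtain c where "v = const_mp c" using v(1) polyring_0_iff[of v] by (auto simp: forms_def)
    hence "hcomp e v = 0 \<or> e = 0" using hcomp_homog[OF homog_const[of c], of e] by auto
    thus ?thesis using n hcomp_forms[OF v(1), of e] v(2) by auto
  qed
  moreover have "hf 0 {0 :: 'k mpoly} j = 0" if "j > 0" for j
  proof -
    have "forms 0 j \<subseteq> {0 :: 'k mpoly}"
    proof
      fix v :: "'k mpoly" assume v: "v \<in> forms 0 j"
      then obtain c where "v = const_mp c" using polyring_0_iff[of v] by (auto simp: forms_def)
      hence "hcomp j v = 0" using hcomp_homog[OF homog_const[of c], of j] that by auto
      thus "v \<in> {0}" using hcomp_forms[OF v, of j] by simp
    qed
    thus ?thesis using hf_pos_iff[OF is_ideal_subspace[OF is_ideal_zero[of 0]], of 0 j] by blast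
  qed
  ultimately show ?case by auto
next
  case (Suc h)
  obtain n' where n: "n = Suc n'" "h \<le> n'" using Suc.prems(2) by (cases n) auto
  define I where "I = seq_ideal n f h"
  define p where "p = f h"
  note R = homog_regular_SucD[OF Suc.prems(1), folded I_def p_def]
  have I: "hideal n I" using homog_regular_hideal[OF R(1)] by (simp add: I_def)
  note Iid = hideal_is_ideal[OF I]
  \<comment> \<open>The first h generators live in more than h variables, so by induction the
    quotient has no socle.\<close>
  have "v \<in> I" if "v \<in> forms (Suc n') j" "\<And>i. i < Suc n' \<Longrightarrow> var i * v \<in> I" for j v
    using Suc.IH[OF R(1)] n that unfolding I_def by force
  then obtain L where L: "L \<in> forms n' 1" "nzd (Suc n') I (var n' - L)"
    using exists_linear_nzd[OF inf, of n' I] I n(1) by blast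
  let ?s = "subst_last n' L" and ?q = "var n' - L"
  have q: "?q \<in> forms n 1" using var_minus_forms[OF L(1)] n(1) by simp
  have nq: "nzd n I ?q" using L(2) n(1) by simp
  let ?g = "\<lambda>i. ?s (f i)"
  have rg: "homog_regular n' h d ?g"
    using homog_regular_subst_last[OF L(1), of h d f] R(1) L(2) unfolding I_def n(1) by blast
  have sg: "seq_ideal n' ?g h = ?s ` I"
    using subst_last_seq_ideal[of n' h d f L] R(1) L(1) unfolding I_def n(1) by blast
  note IH = Suc.IH[OF rg n(2), unfolded sg]
  let ?\<sigma> = "\<Sum>i<h. d i - 1"
  have mem: "?s x \<in> ?s ` I \<longleftrightarrow> x \<in> adjoin n I ?q" if "x \<in> polyring n" for x
    using subst_last_mem_iff[of n' I L x] Iid forms_polyring[OF L(1)] that n(1) by simp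
  have A: "n = Suc h \<and> e = (\<Sum>i<Suc h. d i - 1)"
    if v: "v \<in> forms n e" "v \<notin> adjoin n I p" "\<And>i. i < n \<Longrightarrow> var i * v \<in> adjoin n I p" for e v
  proof -
    obtain w where w: "d h \<le> Suc e" "w \<in> forms n (Suc e - d h)" "w \<notin> adjoin n I ?q"
      "\<And>i. i < n \<Longrightarrow> var i * w \<in> adjoin n I ?q"
      using socle_exchange[OF I R(2,4) q nq v] by metis
    have wP: "w \<in> polyring n" using forms_polyring[OF w(2)] .
    have "var i * ?s w \<in> ?s ` I" if "i < n'" for i
    proof -
      have "?s (var i * w) \<in> ?s ` I"
        using w(4)[of i] mem[of "var i * w"] wP that n(1) by (simp add: polyring_mult)
      thus ?thesis using that by (simp add: subst_last_mult subst_last_id)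
    qed
    moreover have "?s w \<in> forms n' (Suc e - d h)" using subst_last_forms[OF L(1)] w(2) n(1) by simp
    moreover have "?s w \<notin> ?s ` I" using mem[OF wP] w(3) by simp
    ultimately have "n' = h \<and> Suc e - d h = ?\<sigma>" using IH by blast
    thus ?thesis using n(1) w(1) R(3) by auto
  qed
  \<comment> \<open>After the cut by the linear form everything vanishes beyond ?\<sigma>, so the
    Hilbert function of S/I is constant from ?\<sigma> on. That of S/(I + (p)) is its difference at
    j and j - d_h, hence zero.\<close>
  have B: "hf n (adjoin n I p) j = 0" if nh: "n = Suc h" and j: "j > (\<Sum>i<Suc h. d i - 1)" for j
  proof -
    have step: "hf n I (Suc i) = hf n I i" if "i \<ge> ?\<sigma>" for i
    proof -
      have "n' = h" using nh n(1) by simp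
      hence "\<forall>j>?\<sigma>. hf n' (?s ` I) j = 0" using conjunct2[OF IH] by (rule rev_mp)
      from mp[OF spec[OF this, of "Suc i"] le_imp_less_Suc[OF that]]
      have "hf n' (?s ` I) (Suc i) = 0" .
      moreover have "colon n I ?q = I" by (rule colon_nzd[OF Iid forms_polyring[OF q] nq])
      ultimately show ?thesis using hf_cut[of n' I L "Suc i"] I L(1) n(1) by simp
    qed
    have const: "hf n I i = hf n I ?\<sigma>" if "i \<ge> ?\<sigma>" for i
      using that by (induction i rule: dec_induct) (simp_all add: step del: of_nat_Suc of_nat_sum)
    \<comment> \<open>From j > ?\<sigma> + (d_h - 1): the smaller argument just reaches the constant
      range, which makes the bound exact.\<close>
    have jd: "j - d h \<ge> ?\<sigma>" "j \<ge> d h" using j R(3) by auto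
    have "colon n I p = I" by (rule colon_nzd[OF Iid forms_polyring[OF R(2)] R(4)])
    hence "hf n (adjoin n I p) j + hf n I (j - d h) = hf n I j"
      using hf_adjoin[OF I R(2), of "j - d h"] jd(2) by simp
    thus ?thesis using const[of j] const[of "j - d h"] jd by simp
  qed
  show ?case unfolding R(5)
  proof (intro conjI allI impI)
    fix e v assume "v \<in> forms n e" "v \<notin> adjoin n I p" "\<forall>i<n. var i * v \<in> adjoin n I p"
    hence "n = Suc h \<and> e = (\<Sum>i<Suc h. d i - 1)" by (intro A) auto
    thus "n = Suc h" "e = (\<Sum>i<Suc h. d i - 1)" by auto
  qed (rule B)
qed

section \<open>Cutting down to the Artinian case\<close>

text \<open>On generating series this is multiplication by 1/(1 - t), the effect on Hilbert series
  of a new variable or of undoing a cut by a regular linear form.\<close>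

definition psums :: "(nat \<Rightarrow> nat) \<Rightarrow> nat \<Rightarrow> nat" where
  "psums H j = (\<Sum>i\<le>j. H i)"

lemma psums_mono: "(\<And>i. H i \<le> H' i) \<Longrightarrow> psums H j \<le> psums H' j"
  unfolding psums_def by (rule sum_mono) simp

lemma psums_pow_mono: "(\<And>i. H i \<le> H' i) \<Longrightarrow> (psums ^^ m) H j \<le> (psums ^^ m) H' j"
  by (induction m arbitrary: j) (simp_all add: psums_mono)

lemma psums_add: "psums (\<lambda>i. H i + H' i) j = psums H j + psums H' j"
  unfolding psums_def by (rule sum.distrib)

lemma psums_pow_add: "(psums ^^ m) (\<lambda>i. H i + H' i) j = (psums ^^ m) H j + (psums ^^ m) H' j"
proof (induction m arbitrary: j)
  case (Suc m)
  hence "(psums ^^ m) (\<lambda>i. H i + H' i) = (\<lambda>i. (psums ^^ m) H i + (psums ^^ m) H' i)" by blast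
  thus ?case by (simp add: psums_add)
qed simp

lemma psums_recursion:
  assumes "\<And>j. F j = H j + (case j of 0 \<Rightarrow> 0 | Suc i \<Rightarrow> F i)" shows "F j = psums H j"
  by (induction j) (subst assms, simp add: psums_def)+

lemma hf_cut_nzd:
  assumes I: "hideal (Suc n) I" and L: "L \<in> forms n 1" and nz: "nzd (Suc n) I (var n - L)"
  shows "hf (Suc n) I j = psums (hf n (subst_last n L ` I)) j"
proof (rule psums_recursion)
  have "colon (Suc n) I (var n - L) = I"
    by (rule colon_nzd[OF hideal_is_ideal[OF I] forms_polyring[OF var_minus_forms[OF L]] nz])
  thus "hf (Suc n) I j = hf n (subst_last n L ` I) j + (case j of 0 \<Rightarrow> 0 | Suc i \<Rightarrow> hf (Suc n) I i)"
    for j using hf_cut[OF I L, of j] by (cases j) simp_all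
qed

text \<open>Dividing by a form l that is regular modulo I does not change the colon ideal.\<close>

lemma strip_nzd_factor:
  assumes I: "hideal n I" and l: "l \<in> forms n 1" "nzd n I l"
  shows "G \<in> forms n D \<Longrightarrow> G \<notin> I \<Longrightarrow>
    \<exists>D' G'. D' \<le> D \<and> G' \<in> forms n D' \<and> G' \<notin> adjoin n I l \<and> colon n I G' = colon n I G"
proof (induction D arbitrary: G)
  case 0
  \<comment> \<open>The recursion stops here at the latest: multiples of l have no component of
    degree 0, so G in I + (l) would mean G in I.\<close>
  have "G \<notin> adjoin n I l"
  proof
    assume "G \<in> adjoin n I l"
    then obtain i w where w: "G = i + l * w" "i \<in> I" by (auto simp: adjoin_def)
    have "hcomp 0 (l * w) = 0" using hcomp_mult[of l 1 0 w] l(1) by (simp add: forms_def)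
    hence "G = hcomp 0 i" using hcomp_forms[OF 0(1), of 0] by (simp add: w(1) hcomp_add)
    thus False using hideal_hcomp[OF I w(2), of 0] 0(2) by simp
  qed
  thus ?case using 0 by blast
next
  case (Suc D)
  note Iid = hideal_is_ideal[OF I]
  show ?case
  proof (cases "G \<in> adjoin n I l")
    case False thus ?thesis using Suc.prems by blast
  next
    case True
    then obtain i w where w: "G = i + l * w" "i \<in> I" "w \<in> polyring n" by (auto simp: adjoin_def)
    define i' w' where "i' = hcomp (Suc D) i" and "w' = hcomp D w"
    have "hcomp (Suc D) (l * w) = l * w'" using hcomp_mult[of l 1 "Suc D" w] l(1)
      by (simp add: forms_def w'_def)
    hence G: "G = i' + l * w'" using hcomp_forms[OF Suc.prems(1), of "Suc D"]
      by (simp add: w(1) hcomp_add i'_def)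
    have i': "i' \<in> I" unfolding i'_def by (rule hideal_hcomp[OF I w(2)])
    have w': "w' \<in> forms n D" unfolding w'_def by (rule forms_hcomp[OF w(3)])
    have "w' \<notin> I"
    proof
      assume "w' \<in> I"
      hence "l * w' \<in> I" by (rule is_idealD(5)[OF Iid forms_polyring[OF l(1)]])
      thus False using Suc.prems(2) G is_idealD(3)[OF Iid i'] by simp
    qed
    then obtain D' G' where G': "D' \<le> D" "G' \<in> forms n D'" "G' \<notin> adjoin n I l"
      "colon n I G' = colon n I w'" using Suc.IH[OF w'] by blast
    have "colon n I w' = colon n I G"
    proof -
      have "w' * p \<in> I \<longleftrightarrow> G * p \<in> I" if p: "p \<in> polyring n" for p
      proof -
        have i'p: "i' * p \<in> I" by (rule is_idealD(6)[OF Iid p i'])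
        have Gp: "G * p = i' * p + l * (w' * p)" unfolding G by (simp add: algebra_simps)
        have wp: "w' * p \<in> polyring n" by (rule polyring_mult[OF forms_polyring[OF w'] p])
        show ?thesis
        proof
          assume "w' * p \<in> I"
          hence "l * (w' * p) \<in> I" by (rule is_idealD(5)[OF Iid forms_polyring[OF l(1)]])
          thus "G * p \<in> I" unfolding Gp by (rule is_idealD(3)[OF Iid i'p])
        next
          assume "G * p \<in> I"
          hence "G * p - i' * p \<in> I" using i'p by (rule is_idealD(4)[OF Iid])
          hence "l * (w' * p) \<in> I" unfolding Gp by simp
          thus "w' * p \<in> I" using l(2) wp unfolding nzd_def by blast
        qed
      qed
      thus ?thesis by (auto simp: colon_def)
    qed
    thus ?thesis using G' le_SucI by metis
  qed
qed

text \<open>One sequence g serves all forms G: the final proof uses it for the given G and again for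
  a form v outside J that G multiplies into J. Only an inequality holds for the colons, since the
  image of a colon ideal may be smaller than the colon of the images.\<close>

theorem cut_to_artinian:
  fixes f :: "nat \<Rightarrow> 'k::field mpoly"
  assumes inf: "infinite (UNIV :: 'k set)"
  shows "homog_regular (h + m) h d f \<Longrightarrow> \<exists>g :: nat \<Rightarrow> 'k mpoly. homog_regular h h d g
    \<and> (\<forall>j. hf (h + m) (seq_ideal (h + m) f h) j = (psums ^^ m) (hf h (seq_ideal h g h)) j)
    \<and> (\<forall>D G. G \<in> forms (h + m) D \<longrightarrow> G \<notin> seq_ideal (h + m) f h \<longrightarrow>
         (\<exists>D' G'. D' \<le> D \<and> G' \<in> forms h D' \<and> G' \<notin> seq_ideal h g h \<and>
           (\<forall>j. (psums ^^ m) (hf h (colon h (seq_ideal h g h) G')) j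
             \<le> hf (h + m) (colon (h + m) (seq_ideal (h + m) f h) G) j)))"
proof (induction m arbitrary: f)
  case 0
  show ?case
  proof (intro exI[of _ f] conjI allI impI)
    fix D and G :: "'k mpoly"
    assume "G \<in> forms (h + 0) D" "G \<notin> seq_ideal (h + 0) f h"
    thus "\<exists>D' G'. D' \<le> D \<and> G' \<in> forms h D' \<and> G' \<notin> seq_ideal h f h \<and>
           (\<forall>j. (psums ^^ 0) (hf h (colon h (seq_ideal h f h) G')) j
             \<le> hf (h + 0) (colon (h + 0) (seq_ideal (h + 0) f h) G) j)"
      by (intro exI[of _ D] exI[of _ G]) simp
  qed (use 0 in simp_all)
next
  case (Suc m)
  let ?n = "h + m"
  define I where "I = seq_ideal (Suc ?n) f h"
  have R: "homog_regular (Suc ?n) h d f" using Suc.prems by simp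
  have I: "hideal (Suc ?n) I" using homog_regular_hideal[OF R] by (simp add: I_def)
  note Iid = hideal_is_ideal[OF I]
  have "v \<in> I" if "v \<in> forms (Suc ?n) j" "\<And>i. i < Suc ?n \<Longrightarrow> var i * v \<in> I" for j v
    using socle_complete_intersection[OF inf R] that unfolding I_def by force
  then obtain L where L: "L \<in> forms ?n 1" "nzd (Suc ?n) I (var ?n - L)"
    using exists_linear_nzd[OF inf I] by blast
  let ?s = "subst_last ?n L" and ?q = "var ?n - L"
  have q: "?q \<in> forms (Suc ?n) 1" by (rule var_minus_forms[OF L(1)])
  let ?g = "\<lambda>i. ?s (f i)"
  have rg: "homog_regular ?n h d ?g"
    using homog_regular_subst_last[OF L(1) R] L(2) unfolding I_def by blast
  have sg: "seq_ideal ?n ?g h = ?s ` I"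
    using subst_last_seq_ideal[OF R L(1)] unfolding I_def by blast
  obtain g :: "nat \<Rightarrow> 'k mpoly" where g: "homog_regular h h d g"
    "\<And>j. hf ?n (?s ` I) j = (psums ^^ m) (hf h (seq_ideal h g h)) j"
    and gG: "\<And>D G. G \<in> forms ?n D \<Longrightarrow> G \<notin> ?s ` I \<Longrightarrow>
         \<exists>D' G'. D' \<le> D \<and> G' \<in> forms h D' \<and> G' \<notin> seq_ideal h g h \<and>
           (\<forall>j. (psums ^^ m) (hf h (colon h (seq_ideal h g h) G')) j
             \<le> hf ?n (colon ?n (?s ` I) G) j)"
    using Suc.IH[OF rg, unfolded sg] by metis
  have "hf (Suc ?n) I j = (psums ^^ Suc m) (hf h (seq_ideal h g h)) j" for j
  proof -
    have "hf ?n (?s ` I) = (psums ^^ m) (hf h (seq_ideal h g h))" using g(2) by blast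
    thus ?thesis using hf_cut_nzd[OF I L, of j] by simp
  qed
  moreover have "\<exists>D' G'. D' \<le> D \<and> G' \<in> forms h D' \<and> G' \<notin> seq_ideal h g h \<and>
           (\<forall>j. (psums ^^ Suc m) (hf h (colon h (seq_ideal h g h) G')) j
             \<le> hf (Suc ?n) (colon (Suc ?n) I G) j)"
    if G: "G \<in> forms (Suc ?n) D" "G \<notin> I" for G D
  proof -
    obtain D1 G1 where G1: "D1 \<le> D" "G1 \<in> forms (Suc ?n) D1" "G1 \<notin> adjoin (Suc ?n) I ?q"
      "colon (Suc ?n) I G1 = colon (Suc ?n) I G"
      using strip_nzd_factor[OF I q L(2) G] by blast
    have G1P: "G1 \<in> polyring (Suc ?n)" using forms_polyring[OF G1(2)] .
    have "?s G1 \<notin> ?s ` I"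
      using subst_last_mem_iff[OF Iid forms_polyring[OF L(1)] G1P] G1(3) by simp
    then obtain D' G' where G': "D' \<le> D1" "G' \<in> forms h D'" "G' \<notin> seq_ideal h g h"
      "\<And>j. (psums ^^ m) (hf h (colon h (seq_ideal h g h) G')) j \<le> hf ?n (colon ?n (?s ` I) (?s G1)) j"
      using gG[OF subst_last_forms[OF L(1) G1(2)]] by blast
    let ?C = "colon (Suc ?n) I G1"
    have hC: "hideal (Suc ?n) ?C" by (rule hideal_colon[OF I G1(2)])
    \<comment> \<open>Multiplication by G1 embeds S/(I : G1) into S/I, so the linear form stays
      regular there and the Hilbert function of the colon is also an exact partial sum.\<close>
    have nzC: "nzd (Suc ?n) ?C ?q"
      using L(2) forms_polyring[OF q] G1P
      by (auto simp: nzd_def colon_def mult.left_commute[of G1] intro: polyring_mult)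
    have sub: "?s ` ?C \<subseteq> colon ?n (?s ` I) (?s G1)"
    proof
      fix y assume "y \<in> ?s ` ?C"
      then obtain x where x: "y = ?s x" "x \<in> polyring (Suc ?n)" "G1 * x \<in> I"
        by (auto simp: colon_def)
      thus "y \<in> colon ?n (?s ` I) (?s G1)"
        using subst_last_polyring[OF forms_polyring[OF L(1)] x(2)]
        by (auto simp: colon_def simp flip: subst_last_mult)
    qed
    have sI: "hideal ?n (?s ` I)" by (rule hideal_subst_last[OF I L(1)])
    have "hf ?n (colon ?n (?s ` I) (?s G1)) j \<le> hf ?n (?s ` ?C) j" for j
      using sub by (intro hf_antimono hideal_subspace[OF hideal_subst_last[OF hC L(1)]]
          hideal_subspace[OF hideal_colon[OF sI subst_last_forms[OF L(1) G1(2)]]]) blast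
    hence "(psums ^^ m) (hf h (colon h (seq_ideal h g h) G')) j \<le> hf ?n (?s ` ?C) j" for j
      using G'(4) order.trans by blast
    hence "(psums ^^ Suc m) (hf h (colon h (seq_ideal h g h) G')) j \<le> hf (Suc ?n) ?C j" for j
      unfolding hf_cut_nzd[OF hC L(1) nzC] by (simp add: psums_mono)
    moreover have "D' \<le> D" using G'(1) G1(1) by simp
    ultimately show ?thesis using G'(2,3) G1(4) by (intro exI[of _ D'] exI[of _ G']) simp
  qed
  ultimately show ?case using g(1) unfolding I_def by (intro exI[of _ g]) simp
qed

section \<open>Extension to more variables\<close>

lemma hideal_ideal_gen_mono:
  assumes "\<And>g. g \<in> F \<Longrightarrow> \<exists>e. g \<in> forms n e" "n \<le> m"
  shows "hideal m (ideal_gen m F)"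
proof (rule hideal_ideal_gen)
  fix g assume "g \<in> F"
  then obtain e where "g \<in> forms n e" using assms(1) by blast
  hence "g \<in> forms m e" by (auto simp: forms_def intro: polyring_mono[OF assms(2)])
  thus "\<exists>e. g \<in> forms m e" ..
qed

text \<open>A new variable is regular modulo the extended ideal, and setting it to zero recovers the
  original ideal, so \<open>hf_cut_nzd\<close> applies with L = 0.\<close>

lemma hf_extend:
  assumes F: "\<And>g. g \<in> F \<Longrightarrow> \<exists>e. g \<in> forms n e"
  shows "hf (Suc n) (ideal_gen (Suc n) F) j = psums (hf n (ideal_gen n F)) j"
proof -
  let ?I = "ideal_gen (Suc n) F" and ?s = "subst_last n 0"
  have I: "hideal (Suc n) ?I" using hideal_ideal_gen_mono[of F n "Suc n"] F by simp
  have Fn: "F \<subseteq> polyring n" using F forms_polyring by blast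
  have "F \<subseteq> polyring (Suc n)" using Fn polyring_mono[of n "Suc n"] by auto
  moreover have "?s g = g" if "g \<in> F" for g using Fn that by (intro subst_last_id) auto
  hence "?s ` F = F" by simp
  ultimately have sI: "?s ` ?I = ideal_gen n F"
    using subst_last_ideal_gen[of F n 0] by simp
  \<comment> \<open>Division by x_n gives a cofactor in the ring; because the generators are free of
    x_n, it can be chosen in the ideal.\<close>
  have split: "\<exists>i'\<in>?I. i = ?s i + var n * i'" if "i \<in> ?I" for i
    using that
  proof induction
    case zero
    have "(0 :: 'a mpoly) \<in> ?I" by (rule ideal_gen.zero)
    thus ?case by (intro bexI[of _ 0]) simp_all
  next
    case (step g c p)
    obtain p' where p': "p' \<in> ?I" "p = ?s p + var n * p'" using step.IH by blast
    obtain q where q: "q \<in> polyring (Suc n)" "c = ?s c + (var n - 0) * q"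
      using subst_last_cong[of 0 n c] step.hyps(2) by auto
    have g: "?s g = g" using step.hyps(1) Fn subst_last_id by blast
    have "c * g + p = (?s c + var n * q) * g + (?s p + var n * p')"
      using arg_cong2[where f = "\<lambda>c p. c * g + p", OF q(2) p'(2)] by simp
    also have "\<dots> = ?s (c * g + p) + var n * (q * g + p')"
      by (simp add: subst_last_add subst_last_mult g algebra_simps)
    finally have "c * g + p = ?s (c * g + p) + var n * (q * g + p')" .
    moreover have "q * g + p' \<in> ?I" using step.hyps(1) q(1) p'(1) by (rule ideal_gen.step)
    ultimately show ?case by blast
  qed
  have "nzd (Suc n) ?I (var n - 0)"
    unfolding nzd_def
  proof (intro ballI impI)
    fix p assume "p \<in> polyring (Suc n)" "(var n - 0) * p \<in> ?I"
    hence *: "var n * p \<in> ?I" by simp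
    then obtain i' where i': "i' \<in> ?I" "var n * p = ?s (var n * p) + var n * i'"
      using split by blast
    hence "var n * (p - i') = 0" by (simp add: subst_last_mult algebra_simps)
    hence "p = i'" using var_minus_nonzero[of 0 n] by auto
    thus "p \<in> ?I" using i'(1) by simp
  qed
  thus ?thesis using hf_cut_nzd[OF I zero_forms_1, of j] sI by simp
qed

lemma hf_extend_pow:
  assumes F: "\<And>g. g \<in> F \<Longrightarrow> \<exists>e. g \<in> forms h e"
  shows "hf (h + m) (ideal_gen (h + m) F) j = (psums ^^ m) (hf h (ideal_gen h F)) j"
proof (induction m arbitrary: j)
  case (Suc m)
  have "\<exists>e. g \<in> forms (h + m) e" if "g \<in> F" for g
    using F[OF that] by (auto simp: forms_def intro: polyring_mono[of h "h + m"])
  from hf_extend[OF this]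
  have "hf (h + Suc m) (ideal_gen (h + Suc m) F) j = psums (hf (h + m) (ideal_gen (h + m) F)) j"
    by simp
  moreover have "hf (h + m) (ideal_gen (h + m) F) = (psums ^^ m) (hf h (ideal_gen h F))"
    using Suc.IH by blast
  ultimately show ?case by simp
qed simp

lemma ideal_gen_ideal_gen:
  assumes "h \<le> n" "F \<subseteq> polyring h" shows "ideal_gen n (ideal_gen h F) = ideal_gen n F"
proof
  have Fn: "F \<subseteq> polyring n" using assms polyring_mono by blast
  have "p \<in> ideal_gen n F" if "p \<in> ideal_gen h F" for p
    using that by induction (auto intro: ideal_gen.intros polyring_mono[OF assms(1)])
  hence "ideal_gen h F \<subseteq> ideal_gen n F" by blast
  thus "ideal_gen n (ideal_gen h F) \<subseteq> ideal_gen n F"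
    by (rule ideal_gen_minimal[OF ideal_gen_is_ideal[OF Fn]])
  have "ideal_gen h F \<subseteq> polyring h"
    using ideal_gen_is_ideal[OF assms(2)] by (simp add: is_ideal_def)
  hence "ideal_gen h F \<subseteq> polyring n" using polyring_mono[OF assms(1)] by blast
  thus "ideal_gen n F \<subseteq> ideal_gen n (ideal_gen h F)"
    using ideal_gen_base by (intro ideal_gen_mono) blast+
qed

section \<open>Hilbert polynomials\<close>

text \<open>For x^k, the difference of x^(k+1) is (k + 1) * x^k plus lower powers, whose
  antidifferences are available by induction.\<close>

lemma poly_antidifference:
  fixes Q :: "real poly"
  shows "\<exists>R. \<forall>x. poly R (x + 1) - poly R x = poly Q x"
proof -
  have pow: "\<exists>R :: real poly. \<forall>x. poly R (x + 1) - poly R x = x ^ k" for k :: nat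
  proof (induction k rule: less_induct)
    case (less k)
    then obtain R :: "nat \<Rightarrow> real poly"
      where R: "\<And>i x. i < k \<Longrightarrow> poly (R i) (x + 1) - poly (R i) x = x ^ i" by metis
    let ?c = "\<lambda>i. real (Suc k choose i)"
    let ?S = "\<Sum>i<k. smult (?c i) (R i)"
    let ?R = "smult (1 / real (Suc k)) (monom 1 (Suc k) - ?S)"
    have "poly ?R (x + 1) - poly ?R x = x ^ k" for x
    proof -
      have S: "poly ?S (x + 1) - poly ?S x = (\<Sum>i<k. ?c i * x ^ i)"
        using R by (simp add: poly_sum sum_subtractf[symmetric] right_diff_distrib[symmetric])
      have "(x + 1) ^ Suc k = (\<Sum>i\<le>Suc k. ?c i * x ^ i)"
        using binomial_ring[of x 1 "Suc k"] by simp
      also have "\<dots> = (\<Sum>i<k. ?c i * x ^ i) + real (Suc k) * x ^ k + x ^ Suc k"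
        by (simp add: lessThan_Suc_atMost[symmetric] del: binomial_Suc_Suc)
      finally have "(x + 1) ^ Suc k - x ^ Suc k - (poly ?S (x + 1) - poly ?S x) = real (Suc k) * x ^ k"
        unfolding S by linarith
      moreover have "poly ?R (x + 1) - poly ?R x
          = (1 / real (Suc k)) * ((x + 1) ^ Suc k - x ^ Suc k - (poly ?S (x + 1) - poly ?S x))"
        by (simp only: poly_smult poly_diff poly_monom right_diff_distrib mult_1_left)
      ultimately show ?thesis by simp
    qed
    thus ?case by blast
  qed
  then obtain R :: "nat \<Rightarrow> real poly"
    where R: "\<And>k x. poly (R k) (x + 1) - poly (R k) x = x ^ k" by metis
  let ?R = "\<Sum>i\<le>degree Q. smult (coeff Q i) (R i)"
  have "poly ?R (x + 1) - poly ?R x = poly Q x" for x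
    unfolding poly_altdef[of Q] using R
    by (simp add: poly_sum sum_subtractf[symmetric] right_diff_distrib[symmetric])
  thus ?thesis by blast
qed

definition eventually_poly :: "(nat \<Rightarrow> nat) \<Rightarrow> bool" where
  "eventually_poly H \<longleftrightarrow> (\<exists>P::real poly. \<exists>N. \<forall>j\<ge>N. real (H j) = poly P (real j))"

lemma eventually_poly_shift_add:
  assumes "eventually_poly A" "eventually_poly B" "\<And>i. F (Suc i) = A (Suc i) + B i"
  shows "eventually_poly F"
proof -
  obtain P N where P: "\<And>j. j \<ge> N \<Longrightarrow> real (A j) = poly P (real j)"
    using assms(1) unfolding eventually_poly_def by blast
  obtain Q M where Q: "\<And>j. j \<ge> M \<Longrightarrow> real (B j) = poly Q (real j)"
    using assms(2) unfolding eventually_poly_def by blast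
  have "real (F j) = poly (P + pcompose Q [:-1, 1:]) (real j)" if j: "j \<ge> Suc (max N M)" for j
  proof -
    obtain i where i: "j = Suc i" using j by (cases j) auto
    have "real (B i) = poly Q (real i)" using Q j i by simp
    moreover have "real (A j) = poly P (real j)" using P j by simp
    moreover have "real j - 1 = real i" using i by simp
    ultimately show ?thesis unfolding i assms(3) by (simp add: poly_pcompose i)
  qed
  thus ?thesis unfolding eventually_poly_def by blast
qed

lemma eventually_poly_difference:
  assumes "eventually_poly A" "\<And>i. F (Suc i) = A (Suc i) + F i"
  shows "eventually_poly F"
proof -
  obtain P N where P: "\<And>j. j \<ge> N \<Longrightarrow> real (A j) = poly P (real j)"
    using assms(1) unfolding eventually_poly_def by blast
  obtain R where R: "\<And>x. poly R (x + 1) - poly R x = poly (pcompose P [:1, 1:]) x"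
    using poly_antidifference by blast
  let ?R = "R + [:real (F N) - poly R (real N):]"
  have "real (F j) = poly ?R (real j)" if "j \<ge> N" for j
    using that
  proof (induction j rule: dec_induct)
    case (step i)
    have "real (F (Suc i)) = poly P (real i + 1) + poly ?R (real i)"
      using assms(2)[of i] P[of "Suc i"] step by (simp add: add.commute)
    also have "poly P (real i + 1) = poly R (real i + 1) - poly R (real i)"
      unfolding R by (simp add: poly_pcompose add.commute)
    finally show ?case by (simp add: add.commute)
  qed simp
  thus ?thesis unfolding eventually_poly_def by blast
qed

text \<open>Cutting by x_n, possibly a zero divisor, relates (I : x_n^k) to (I : x_n^(k+1)). The
  ascending chain of these colons is stationary from some N on; there the relation is a difference
  equation with polynomial right-hand side, and finitely many steps lead back from N to k =
  0.\<close>

theorem hilbert_polynomial: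
  fixes I :: "'k::field mpoly set"
  shows "hideal n I \<Longrightarrow> eventually_poly (hf n I)"
proof (induction n arbitrary: I)
  case 0
  have "hf 0 I j = 0" if "j > 0" for j
  proof -
    have "forms 0 j \<subseteq> I"
    proof
      fix v :: "'k mpoly" assume v: "v \<in> forms 0 j"
      then obtain c where "v = const_mp c" using polyring_0_iff[of v] by (auto simp: forms_def)
      hence "hcomp j v = 0" using hcomp_homog[OF homog_const[of c], of j] that by auto
      thus "v \<in> I" using hcomp_forms[OF v, of j] hidealD(2)[OF 0] by simp
    qed
    thus ?thesis using hf_pos_iff[OF hideal_subspace[OF 0], of 0 j] by blast
  qed
  hence "\<forall>j\<ge>1. real (hf 0 I j) = poly 0 (real j)" by simp
  thus ?case unfolding eventually_poly_def by blast
next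
  case (Suc n)
  let ?C = "\<lambda>k. colon (Suc n) I (var n ^ k)"
  have hC: "hideal (Suc n) (?C k)" for k by (rule hideal_colon[OF Suc.prems var_pow_forms])
  have next_C: "colon (Suc n) (?C k) (var n - 0) = ?C (Suc k)" for k
    by (auto simp: colon_def mult_ac polyring_mult)
  have rec: "hf (Suc n) (?C k) (Suc i) = hf n (subst_last n 0 ` ?C k) (Suc i) + hf (Suc n) (?C (Suc k)) i"
    for k i using hf_cut[OF hC zero_forms_1, of k "Suc i"] unfolding next_C by simp
  have ep: "eventually_poly (hf n (subst_last n 0 ` ?C k))" for k
    by (rule Suc.IH[OF hideal_subst_last[OF hC zero_forms_1]])
  have "?C k \<subseteq> ?C (Suc k)" for k
    unfolding next_C[symmetric]
    by (rule colon_superset[OF hideal_is_ideal[OF hC]]) simp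
  with hC have "\<exists>N. \<forall>k\<ge>N. ?C k = ?C N" by (rule hideal_acc)
  then obtain N where "\<forall>k\<ge>N. ?C k = ?C N" ..
  hence N: "?C (Suc N) = ?C N" using le_SucI[OF order_refl] by blast
  have base: "eventually_poly (hf (Suc n) (?C N))"
    by (rule eventually_poly_difference[OF ep[of N]]) (use rec[of N] N in metis)
  have "eventually_poly (hf (Suc n) (?C k))" if "k \<le> N" for k
    using that
  proof (induction k rule: inc_induct)
    case (step k)
    show ?case by (rule eventually_poly_shift_add[OF ep[of k] step.IH rec])
  qed (rule base)
  from this[of 0] have "eventually_poly (hf (Suc n) (?C 0))" by simp
  moreover have "?C 0 = I" using hidealD(1)[OF Suc.prems] by (auto simp: colon_def)
  ultimately show ?case by simp
qed

section \<open>Heights\<close>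

definition prime_chain :: "nat \<Rightarrow> nat \<Rightarrow> (nat \<Rightarrow> 'k::field mpoly set) \<Rightarrow> bool" where
  "prime_chain n k C \<longleftrightarrow> (\<forall>i\<le>k. is_prime n (C i)) \<and> (\<forall>i<k. C i \<subset> C (Suc i))"

lemma is_primeD:
  assumes "is_prime n P"
  shows "is_ideal n P" "1 \<notin> P"
    "a \<in> polyring n \<Longrightarrow> b \<in> polyring n \<Longrightarrow> a * b \<in> P \<Longrightarrow> a \<in> P \<or> b \<in> P"
proof -
  show I: "is_ideal n P" using assms by (simp add: is_prime_def)
  show "1 \<notin> P"
  proof
    assume "1 \<in> P"
    hence "p \<in> P" if "p \<in> polyring n" for p using is_idealD(5)[OF I that, of 1] by simp
    hence "P = polyring n" using is_idealD(1)[OF I] by blast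
    thus False using assms by (simp add: is_prime_def)
  qed
  show "a \<in> polyring n \<Longrightarrow> b \<in> polyring n \<Longrightarrow> a * b \<in> P \<Longrightarrow> a \<in> P \<or> b \<in> P"
    using assms by (simp add: is_prime_def)
qed

text \<open>An ideal maximal among those that contain I and miss the multiplicative set T is prime:
  two elements outside it each generate, together with it, an element of T, and the product of these
  is in T as well.\<close>

lemma exists_prime_avoiding:
  fixes I :: "'k::field mpoly set"
  assumes I: "is_ideal n I" and T: "T \<subseteq> polyring n" "1 \<in> T" "\<And>s t. s \<in> T \<Longrightarrow> t \<in> T \<Longrightarrow> s * t \<in> T"
    and disj: "I \<inter> T = {}"
  obtains P where "is_prime n P" "I \<subseteq> P" "P \<inter> T = {}"
proof -
  let ?A = "{K. is_ideal n K \<and> I \<subseteq> K \<and> K \<inter> T = {}}"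
  have "\<exists>M\<in>?A. \<forall>X\<in>?A. M \<subseteq> X \<longrightarrow> X = M"
  proof (rule subset_Zorn_nonempty)
    show "?A \<noteq> {}" using I disj by blast
    fix \<C> assume ne: "\<C> \<noteq> {}" and ch: "subset.chain ?A \<C>"
    have sub: "\<And>K. K \<in> \<C> \<Longrightarrow> is_ideal n K \<and> I \<subseteq> K \<and> K \<inter> T = {}"
      using ch by (auto simp: subset.chain_def)
    have lin: "\<And>K K'. K \<in> \<C> \<Longrightarrow> K' \<in> \<C> \<Longrightarrow> K \<subseteq> K' \<or> K' \<subseteq> K"
      using ch unfolding subset_chain_def by blast
    have "is_ideal n (\<Union>\<C>)"
      unfolding is_ideal_def
    proof (intro conjI ballI)
      show "\<Union>\<C> \<subseteq> polyring n" using sub is_idealD(1) by blast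
      obtain K where "K \<in> \<C>" using ne by blast
      thus "0 \<in> \<Union>\<C>" using sub is_idealD(2) by blast
      fix a assume "a \<in> \<Union>\<C>"
      then obtain K where K: "K \<in> \<C>" "a \<in> K" by blast
      {
        fix b assume "b \<in> \<Union>\<C>"
        then obtain K' where K': "K' \<in> \<C>" "b \<in> K'" by blast
        from lin[OF K(1) K'(1)] show "a + b \<in> \<Union>\<C>"
        proof
          assume "K \<subseteq> K'"
          hence "a + b \<in> K'" using sub[OF K'(1)] K K' is_idealD(3) by blast
          thus ?thesis using K' by blast
        next
          assume "K' \<subseteq> K"
          hence "a + b \<in> K" using sub[OF K(1)] K K' is_idealD(3) by blast
          thus ?thesis using K by blast
        qed
      next
        fix c :: "'k mpoly" assume "c \<in> polyring n"
        hence "c * a \<in> K" using sub[OF K(1)] K is_idealD(5) by blast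
        thus "c * a \<in> \<Union>\<C>" using K by blast
      }
    qed
    thus "\<Union>\<C> \<in> ?A" using sub ne by blast
  qed
  then obtain P where P: "is_ideal n P" "I \<subseteq> P" "P \<inter> T = {}"
    and max: "\<And>X. is_ideal n X \<Longrightarrow> I \<subseteq> X \<Longrightarrow> X \<inter> T = {} \<Longrightarrow> P \<subseteq> X \<Longrightarrow> X = P" by auto
  have meet: "\<exists>p q. p \<in> P \<and> q \<in> polyring n \<and> p + a * q \<in> T" if a: "a \<in> polyring n" "a \<notin> P" for a
  proof (rule ccontr)
    assume *: "\<not> ?thesis"
    have "adjoin n P a \<inter> T = {}" using * by (auto simp: adjoin_def)
    moreover have "P \<subseteq> adjoin n P a" by (rule adjoin_superset[OF P(1)])
    ultimately have "adjoin n P a = P"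
      using max[OF is_ideal_adjoin[OF P(1) a(1)]] P(2) by blast
    moreover have "a * 1 \<in> adjoin n P a" by (rule adjoin_base[OF P(1) polyring_1])
    ultimately show False using a(2) by simp
  qed
  have "is_prime n P"
    unfolding is_prime_def
  proof (intro conjI ballI impI)
    show "P \<noteq> polyring n" using P(3) T(1,2) by blast
    fix a b assume ab: "a \<in> polyring n" "b \<in> polyring n" "a * b \<in> P"
    show "a \<in> P \<or> b \<in> P"
    proof (rule ccontr)
      assume "\<not> (a \<in> P \<or> b \<in> P)"
      then obtain p q p' q' where pq: "p \<in> P" "q \<in> polyring n" "p + a * q \<in> T"
        "p' \<in> P" "q' \<in> polyring n" "p' + b * q' \<in> T"
        using meet[OF ab(1)] meet[OF ab(2)] by auto
      have 1: "(p' + b * q') * p \<in> P"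
        using is_idealD(5)[OF P(1) _ pq(1)] pq(6) T(1) by blast
      have 2: "(a * q) * p' \<in> P"
        by (rule is_idealD(5)[OF P(1) polyring_mult[OF ab(1) pq(2)] pq(4)])
      have 3: "(q * q') * (a * b) \<in> P"
        by (rule is_idealD(5)[OF P(1) polyring_mult[OF pq(2,5)] ab(3)])
      have "(p + a * q) * (p' + b * q') = (p' + b * q') * p + ((a * q) * p' + (q * q') * (a * b))"
        by (simp add: algebra_simps)
      also have "\<dots> \<in> P" by (rule is_idealD(3)[OF P(1) 1 is_idealD(3)[OF P(1) 2 3]])
      finally show False using T(3)[OF pq(3,6)] P(3) by blast
    qed
  qed (rule P(1))
  thus ?thesis using that P by blast
qed

text \<open>The step down from Q picks a prime over the shorter sequence that avoids all g^k s with s outside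
  Q, where g is the last element of the sequence; it lies in Q but does not contain g.\<close>

lemma homog_regular_prime_chain:
  fixes f :: "nat \<Rightarrow> 'k::field mpoly"
  shows "homog_regular n m d f \<Longrightarrow> is_prime n Q \<Longrightarrow> seq_ideal n f m \<subseteq> Q
    \<Longrightarrow> \<exists>C. prime_chain n m C \<and> C m = Q"
proof (induction m arbitrary: Q)
  case 0
  thus ?case by (intro exI[of _ "\<lambda>_. Q"]) (simp add: prime_chain_def)
next
  case (Suc m)
  note R = homog_regular_SucD[OF Suc.prems(1)]
  let ?I = "seq_ideal n f m" and ?g = "f m"
  have Iid: "is_ideal n ?I" using hideal_is_ideal[OF homog_regular_hideal[OF R(1)]] by simp
  have gP: "?g \<in> polyring n" using forms_polyring[OF R(2)] .
  have "?I \<subseteq> seq_ideal n f (Suc m)" unfolding R(5) by (rule adjoin_superset[OF Iid])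
  hence IQ: "?I \<subseteq> Q" using Suc.prems(3) by blast
  have "?g \<in> seq_ideal n f (Suc m)" by (rule ideal_gen_base) simp
  hence gQ: "?g \<in> Q" using Suc.prems(3) by blast
  note Q = is_primeD[OF Suc.prems(2)]
  define T where "T = {?g ^ k * s | k s. s \<in> polyring n \<and> s \<notin> Q}"
  have TP: "T \<subseteq> polyring n" unfolding T_def using gP by (auto intro: polyring_mult polyring_power)
  have T1: "s \<in> T" if "s \<in> polyring n" "s \<notin> Q" for s
    unfolding T_def using that by (intro CollectI exI[of _ 0] exI[of _ s]) simp
  have gT: "?g \<in> T"
    unfolding T_def using Q(2) by (intro CollectI exI[of _ 1] exI[of _ 1]) simp
  have Tm: "s * t \<in> T" if "s \<in> T" "t \<in> T" for s t
  proof -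
    obtain k s' where s: "s = ?g ^ k * s'" "s' \<in> polyring n" "s' \<notin> Q"
      using \<open>s \<in> T\<close> unfolding T_def by blast
    obtain l t' where t: "t = ?g ^ l * t'" "t' \<in> polyring n" "t' \<notin> Q"
      using \<open>t \<in> T\<close> unfolding T_def by blast
    have "s * t = ?g ^ (k + l) * (s' * t')" unfolding s t by (simp add: power_add mult_ac)
    moreover have "s' * t' \<in> polyring n" using polyring_mult s t by blast
    moreover have "s' * t' \<notin> Q" using Q(3) s t by blast
    ultimately show ?thesis unfolding T_def by blast
  qed
  \<comment> \<open>Regularity of g cancels the power, so an element g^k * s of the ideal would have
    s in Q. Thus the ideal misses T.\<close>
  have pw: "s \<in> ?I" if "?g ^ k * s \<in> ?I" "s \<in> polyring n" for k s
    using that(1)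
  proof (induction k)
    case (Suc k)
    have "?g * (?g ^ k * s) \<in> ?I" using Suc.prems by (simp add: mult.assoc)
    hence "?g ^ k * s \<in> ?I"
      using R(4) polyring_mult[OF polyring_power[OF gP] that(2)] unfolding nzd_def by blast
    thus ?case by (rule Suc.IH)
  qed simp
  have "?I \<inter> T = {}" using pw IQ unfolding T_def by blast
  then obtain Q' where Q': "is_prime n Q'" "?I \<subseteq> Q'" "Q' \<inter> T = {}"
    using exists_prime_avoiding[OF Iid TP T1[OF polyring_1 Q(2)] Tm] by blast
  \<comment> \<open>Missing the elements with k = 0 puts Q' inside Q; missing g, which lies in Q,
    makes the inclusion strict.\<close>
  have "Q' \<subseteq> Q" using Q'(3) T1 is_idealD(1)[OF is_primeD(1)[OF Q'(1)]] by blast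
  hence ps: "Q' \<subset> Q" using gT gQ Q'(3) by blast
  obtain C where C: "prime_chain n m C" "C m = Q'" using Suc.IH[OF R(1) Q'(1,2)] by blast
  have "prime_chain n (Suc m) (C(Suc m := Q))"
    using C ps Suc.prems(2) unfolding prime_chain_def by (auto simp: le_Suc_eq less_Suc_eq)
  moreover have "(C(Suc m := Q)) (Suc m) = Q" by simp
  ultimately show ?case by blast
qed

section \<open>Chains of primes are no longer than the number of variables\<close>

fun mon_prod :: "'k::field mpoly list \<Rightarrow> nat list \<Rightarrow> 'k mpoly" where
  "mon_prod (z # zs) (a # as) = z ^ a * mon_prod zs as"
| "mon_prod _ _ = 1"

lemma mon_prod_polyring: "set zs \<subseteq> polyring n \<Longrightarrow> mon_prod zs as \<in> polyring n"
  by (induction zs as rule: mon_prod.induct) (auto intro: polyring_mult polyring_power)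

text \<open>Elements picked from the successive steps of a chain of primes are algebraically
  independent modulo the first prime.\<close>

lemma mon_prod_independent:
  fixes C :: "nat \<Rightarrow> 'k::field mpoly set"
  shows "prime_chain n k C \<Longrightarrow> length zs = k \<Longrightarrow> (\<And>i. i < k \<Longrightarrow> zs ! i \<in> C (Suc i) - C i)
    \<Longrightarrow> finite X \<Longrightarrow> (\<And>as. as \<in> X \<Longrightarrow> length as = k)
    \<Longrightarrow> (\<Sum>as\<in>X. const_mp (c as) * mon_prod zs as) \<in> C 0 \<Longrightarrow> as \<in> X \<Longrightarrow> c as = 0"
proof (induction k arbitrary: C zs X c as)
  case 0
  have P: "is_prime n (C 0)" using 0(1) by (simp add: prime_chain_def)
  have "X = {[]}" "as = []" "zs = []" using 0 by auto
  hence "const_mp (c []) \<in> C 0" using 0(6) by simp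
  hence "const_mp (1 / c []) * const_mp (c []) \<in> C 0"
    using is_idealD(5)[OF is_primeD(1)[OF P] polyring_const] by blast
  thus ?case using is_primeD(2)[OF P] \<open>as = []\<close> by (cases "c [] = 0") (simp_all add: mult_single)
next
  case (Suc k)
  obtain z zs' where zs: "zs = z # zs'" using Suc.prems(2) by (cases zs) auto
  have P0: "is_prime n (C 0)" and P1: "is_prime n (C 1)" and C01: "C 0 \<subseteq> C 1"
    using Suc.prems(1) unfolding prime_chain_def by auto
  note I0 = is_idealD[OF is_primeD(1)[OF P0]] and I1 = is_idealD[OF is_primeD(1)[OF P1]]
  have z: "z \<in> C 1" "z \<notin> C 0" using Suc.prems(3)[of 0] zs by auto
  have zP: "z \<in> polyring n" using I1(1) z by blast
  have zs'P: "set zs' \<subseteq> polyring n"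
  proof
    fix y assume "y \<in> set zs'"
    then obtain i where i: "i < k" "y = zs' ! i" using Suc.prems(2) zs by (auto simp: in_set_conv_nth)
    hence "y \<in> C (Suc (Suc i))" using Suc.prems(3)[of "Suc i"] zs by simp
    moreover have "is_prime n (C (Suc (Suc i)))" using Suc.prems(1) i by (simp add: prime_chain_def)
    ultimately show "y \<in> polyring n" using is_idealD(1)[OF is_primeD(1)] by blast
  qed
  show ?case
  proof (rule ccontr)
    assume "c as \<noteq> 0"
    define X' where "X' = {as \<in> X. c as \<noteq> 0}"
    have X': "finite X'" "as \<in> X'" using Suc.prems(4,7) \<open>c as \<noteq> 0\<close> by (auto simp: X'_def)
    \<comment> \<open>The least exponent of z among the terms with nonzero coefficient. As z is
      outside the prime C 0, z^a0 can be cancelled; modulo C 1, which contains z, only the terms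
      with exponent exactly a0 remain, and they form a relation among the other elements.\<close>
    define a0 where "a0 = Min (hd ` X')"
    have a0: "a0 \<in> hd ` X'" "\<And>bs. bs \<in> X' \<Longrightarrow> a0 \<le> hd bs"
      using X' unfolding a0_def by (auto intro!: Min_in)
    let ?t = "\<lambda>bs. const_mp (c bs) * (z ^ (hd bs - a0) * mon_prod zs' (tl bs))"
    have form: "bs = hd bs # tl bs" "length (tl bs) = k" if "bs \<in> X'" for bs
      using Suc.prems(5)[of bs] that by (cases bs; auto simp: X'_def)+
    have tP: "?t bs \<in> polyring n" for bs
      using zP mon_prod_polyring[OF zs'P] by (intro polyring_mult polyring_power polyring_const)
    have "(\<Sum>bs\<in>X. const_mp (c bs) * mon_prod zs bs) = (\<Sum>bs\<in>X'. const_mp (c bs) * mon_prod zs bs)"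
      using Suc.prems(4) by (intro sum.mono_neutral_right) (auto simp: X'_def)
    also have "\<dots> = (\<Sum>bs\<in>X'. z ^ a0 * ?t bs)"
    proof (rule sum.cong[OF refl])
      fix bs assume bs: "bs \<in> X'"
      have "mon_prod zs bs = z ^ hd bs * mon_prod zs' (tl bs)"
        by (subst form(1)[OF bs]) (simp add: zs)
      also have "z ^ hd bs = z ^ a0 * z ^ (hd bs - a0)"
        using a0(2)[OF bs] by (simp flip: power_add)
      finally show "const_mp (c bs) * mon_prod zs bs = z ^ a0 * ?t bs" by (simp only: mult_ac)
    qed
    also have "\<dots> = z ^ a0 * (\<Sum>bs\<in>X'. ?t bs)" by (rule sum_distrib_left[symmetric])
    finally have in0: "z ^ a0 * (\<Sum>bs\<in>X'. ?t bs) \<in> C 0" using Suc.prems(6) by simp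
    have "z ^ l \<notin> C 0" for l
    proof (induction l)
      case (Suc l)
      thus ?case using is_primeD(3)[OF P0 zP polyring_power[OF zP], of l] z(2) by auto
    qed (use is_primeD(2)[OF P0] in simp)
    hence "(\<Sum>bs\<in>X'. ?t bs) \<in> C 0"
      using is_primeD(3)[OF P0 polyring_power[OF zP] polyring_sum in0] tP by blast
    hence in1: "(\<Sum>bs\<in>X'. ?t bs) \<in> C 1" using C01 by blast
    let ?X0 = "{bs \<in> X'. hd bs = a0}"
    have "(\<Sum>bs\<in>X' - ?X0. ?t bs) \<in> C 1"
    proof (intro mp.subspace_sum is_ideal_subspace[OF is_primeD(1)[OF P1]])
      fix bs assume bs: "bs \<in> X' - ?X0"
      hence "hd bs - a0 = Suc (hd bs - a0 - 1)" using a0(2)[of bs] by force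
      hence "?t bs = (const_mp (c bs) * (z ^ (hd bs - a0 - 1) * mon_prod zs' (tl bs))) * z"
        by (metis (no_types, lifting) mult.assoc mult.commute power_Suc)
      moreover have "const_mp (c bs) * (z ^ (hd bs - a0 - 1) * mon_prod zs' (tl bs)) \<in> polyring n"
        using zP mon_prod_polyring[OF zs'P] by (intro polyring_mult polyring_power polyring_const)
      ultimately show "?t bs \<in> C 1" using I1(5) z(1) by metis
    qed
    moreover have "(\<Sum>bs\<in>X'. ?t bs) = (\<Sum>bs\<in>X' - ?X0. ?t bs) + (\<Sum>bs\<in>?X0. ?t bs)"
      using X'(1) by (intro sum.subset_diff) auto
    ultimately have "(\<Sum>bs\<in>?X0. ?t bs) \<in> C 1" using I1(4)[OF in1] by fastforce
    also have "(\<Sum>bs\<in>?X0. ?t bs) = (\<Sum>bs\<in>?X0. const_mp (c (a0 # tl bs)) * mon_prod zs' (tl bs))"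
    proof (rule sum.cong[OF refl])
      fix bs assume bs: "bs \<in> ?X0"
      hence "a0 # tl bs = bs" using form(1)[of bs] by simp
      thus "?t bs = const_mp (c (a0 # tl bs)) * mon_prod zs' (tl bs)" using bs by simp
    qed
    also have "\<dots> = (\<Sum>bs\<in>tl ` ?X0. const_mp (c (a0 # bs)) * mon_prod zs' bs)"
    proof (subst sum.reindex)
      show "inj_on tl ?X0"
      proof (rule inj_onI)
        fix x y assume "x \<in> ?X0" "y \<in> ?X0" "tl x = tl y"
        thus "x = y" using form(1)[of x] form(1)[of y] by simp
      qed
    qed (simp add: o_def)
    finally have in1': "(\<Sum>bs\<in>tl ` ?X0. const_mp (c (a0 # bs)) * mon_prod zs' bs) \<in> C (Suc 0)" by simp
    obtain bs where bs: "bs \<in> X'" "hd bs = a0" using a0(1) by auto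
    have "c (a0 # tl bs) = 0"
    proof (rule Suc.IH[of "\<lambda>i. C (Suc i)" zs' "tl ` ?X0" "\<lambda>bs. c (a0 # bs)"])
      show "prime_chain n k (\<lambda>i. C (Suc i))" using Suc.prems(1) by (simp add: prime_chain_def)
      show "length zs' = k" using Suc.prems(2) zs by simp
      show "zs' ! i \<in> C (Suc (Suc i)) - C (Suc i)" if "i < k" for i
        using Suc.prems(3)[of "Suc i"] that zs by simp
      show "finite (tl ` ?X0)" using X'(1) by simp
      show "length as = k" if "as \<in> tl ` ?X0" for as using that form(2) by auto
      show "tl bs \<in> tl ` ?X0" using bs by blast
    qed (rule in1')
    moreover have "a0 # tl bs = bs" using form(1)[OF bs(1)] bs(2) by simp
    ultimately show False using bs(1) by (simp add: X'_def)
  qed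
qed

definition deg_le :: "'k::field mpoly \<Rightarrow> nat \<Rightarrow> bool" where
  "deg_le p e \<longleftrightarrow> (\<forall>m\<in>Poly_Mapping.keys p. mdeg m \<le> e)"

lemma deg_le_mult: assumes "deg_le p i" "deg_le q j" shows "deg_le (p * q) (i + j)"
  unfolding deg_le_def
proof
  fix m assume "m \<in> Poly_Mapping.keys (p * q)"
  then obtain a b where "m = a + b" "a \<in> Poly_Mapping.keys p" "b \<in> Poly_Mapping.keys q"
    using keys_mult[of p q] by blast
  thus "mdeg m \<le> i + j" using assms by (auto simp: deg_le_def mdeg_add intro: add_mono)
qed

lemma deg_le_power: "deg_le p i \<Longrightarrow> deg_le (p ^ k) (k * i)"
  by (induction k) (auto simp: deg_le_mult, simp add: deg_le_def)

lemma deg_le_mon_prod: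
  "(\<And>z. z \<in> set zs \<Longrightarrow> deg_le z c) \<Longrightarrow> deg_le (mon_prod zs as) (sum_list as * c)"
proof (induction zs as rule: mon_prod.induct)
  case (1 z zs a as)
  have "deg_le (z ^ a * mon_prod zs as) (a * c + sum_list as * c)"
    using 1 by (intro deg_le_mult deg_le_power) auto
  thus ?case by (simp add: algebra_simps)
qed (auto simp: deg_le_def)

text \<open>Transcendence degree by counting: k independent elements of degree at most c have N^k
  power products with exponents below N, all of degree at most k * N * c. That space has dimension
  at most (k * N * c + 1)^n, too small for large N if k > n.\<close>

lemma prime_chain_length_le:
  fixes C :: "nat \<Rightarrow> 'k::field mpoly set"
  assumes C: "prime_chain n k C" shows "k \<le> n"
proof (rule ccontr)
  assume "\<not> k \<le> n"
  hence kn: "Suc n \<le> k" by simp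
  have "\<exists>z. z \<in> C (Suc i) - C i" if "i < k" for i using C that unfolding prime_chain_def by blast
  then obtain y where y: "\<And>i. i < k \<Longrightarrow> y i \<in> C (Suc i) - C i" by metis
  define zs where "zs = map y [0..<k]"
  have zs: "length zs = k" "\<And>i. i < k \<Longrightarrow> zs ! i \<in> C (Suc i) - C i" using y by (auto simp: zs_def)
  have zsP: "set zs \<subseteq> polyring n"
  proof
    fix x assume "x \<in> set zs"
    then obtain i where i: "i < k" "x = y i" by (auto simp: zs_def)
    have "is_prime n (C (Suc i))" using C i by (simp add: prime_chain_def)
    thus "x \<in> polyring n" using y[OF i(1)] i(2) is_idealD(1)[OF is_primeD(1)] by blast
  qed
  define c where "c = Max (insert 0 (\<Union>z\<in>set zs. mdeg ` Poly_Mapping.keys z))"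
  have c: "deg_le z c" if "z \<in> set zs" for z
    unfolding deg_le_def c_def using that by (intro ballI Max_ge) auto
  \<comment> \<open>Chosen so that (k * c + 1)^n < N, hence (k * N * c + 1)^n \<le> (k * c + 1)^n *
    N^n < N^(n+1).\<close>
  define N where "N = (k * c + 1) ^ n + 1"
  have N1: "N \<ge> 1" by (simp add: N_def)
  define X where "X = {as. set as \<subseteq> {..<N} \<and> length as = k}"
  have finX: "finite X" unfolding X_def by (rule finite_lists_length_eq) simp
  have cardX: "card X = N ^ k" unfolding X_def by (subst card_lists_length_eq) auto
  let ?m = "mon_prod zs"
  have zero_C: "0 \<in> C 0" using C is_idealD(2)[OF is_primeD(1)] by (auto simp: prime_chain_def)
  have ind: "u as = 0" if "(\<Sum>as\<in>X. const_mp (u as) * ?m as) = 0" "as \<in> X" for u as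
    using mon_prod_independent[OF C zs finX, of u as] that zero_C by (simp add: X_def)
  have inj: "inj_on ?m X"
  proof (rule inj_onI, rule ccontr)
    fix as bs assume ab: "as \<in> X" "bs \<in> X" "?m as = ?m bs" "as \<noteq> bs"
    let ?u = "\<lambda>x. (if x = as then 1 else 0) - (if x = bs then 1 else (0::'k))"
    have "(\<Sum>x\<in>X. const_mp (?u x) * ?m x)
        = (\<Sum>x\<in>X. if x = as then ?m x else 0) - (\<Sum>x\<in>X. if x = bs then ?m x else 0)"
      unfolding sum_subtractf[symmetric]
      by (intro sum.cong refl) (auto simp: single_diff algebra_simps)
    also have "\<dots> = 0" using ab finX by simp
    finally have "?u as = 0" using ab(1) by (rule ind)
    thus False using ab(4) by simp
  qed
  have "mp.independent (?m ` X)"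
  proof (rule mp.independent_if_scalars_zero)
    fix u p assume u: "(\<Sum>p\<in>?m ` X. smult_mp (u p) p) = 0" and p: "p \<in> ?m ` X"
    have "(\<Sum>as\<in>X. const_mp (u (?m as)) * ?m as) = 0"
      using u by (simp add: sum.reindex[OF inj] smult_mp_eq)
    thus "u p = 0" using ind[of "\<lambda>as. u (?m as)"] p by auto
  qed (use finX in simp)
  moreover have "?m ` X \<subseteq> mp.span ((\<lambda>m. Poly_Mapping.single m 1) ` monomials_upto n (k * N * c))"
  proof
    fix p assume "p \<in> ?m ` X"
    then obtain as where as: "as \<in> X" "p = ?m as" by blast
    have "sum_list as \<le> length as * N"
      using as(1) by (intro order.trans[OF sum_list_mono[of as id "\<lambda>_. N", simplified]])
        (auto simp: X_def sum_list_triv intro: less_imp_le)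
    hence le: "sum_list as * c \<le> k * N * c" using as(1) by (simp add: X_def)
    have "m \<in> monomials_upto n (k * N * c)" if m: "m \<in> Poly_Mapping.keys p" for m
    proof -
      have "mdeg m \<le> sum_list as * c"
        using deg_le_mon_prod[of zs c as] c m as(2) by (auto simp: deg_le_def)
      hence "mdeg m \<le> k * N * c" using le by (rule order.trans)
      moreover have "Poly_Mapping.keys m \<subseteq> {..<n}"
        using mon_prod_polyring[OF zsP, of as] m as(2) by (auto simp: polyring_def)
      ultimately show ?thesis by (simp add: monomials_upto_def)
    qed
    thus "p \<in> mp.span ((\<lambda>m. Poly_Mapping.single m 1) ` monomials_upto n (k * N * c))"
      by (rule span_monomials)
  qed
  ultimately have "card (?m ` X) \<le> card ((\<lambda>m. Poly_Mapping.single m (1::'k)) ` monomials_upto n (k * N * c))"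
    using mp.independent_span_bound[of "(\<lambda>m. Poly_Mapping.single m 1) ` monomials_upto n (k * N * c)" "?m ` X"]
      monomials_upto_bound[of n "k * N * c"] by blast
  also have "\<dots> \<le> card (monomials_upto n (k * N * c))" by (rule card_image_le) (use monomials_upto_bound in blast)
  also have "\<dots> \<le> (k * N * c + 1) ^ n" using monomials_upto_bound by blast
  also have "\<dots> \<le> ((k * c + 1) * N) ^ n"
    using N1 by (intro power_mono) (simp_all add: algebra_simps)
  also have "\<dots> = (k * c + 1) ^ n * N ^ n" by (rule power_mult_distrib)
  also have "\<dots> < N * N ^ n" using N1 by (intro mult_strict_right_mono) (simp_all add: N_def)
  also have "\<dots> = N ^ Suc n" by simp
  also have "\<dots> \<le> N ^ k" using kn N1 by (intro power_increasing) auto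
  finally show False using cardX card_image[OF inj] by simp
qed

section \<open>Multiplicities\<close>

lemma psums_0: "psums H 0 = H 0" and psums_Suc: "psums H (Suc j) = psums H j + H (Suc j)"
  by (simp_all add: psums_def)

text \<open>Multiplication of the generating series by t^D, which therefore commutes with
  \<open>psums\<close>. It records the twist in the exact sequence for a form of degree D.\<close>

definition shift :: "nat \<Rightarrow> (nat \<Rightarrow> nat) \<Rightarrow> nat \<Rightarrow> nat" where
  "shift D H j = (if j < D then 0 else H (j - D))"

lemma psums_shift: "psums (shift D H) = shift D (psums H)"
proof
  fix j show "psums (shift D H) j = shift D (psums H) j"
  proof (induction j)
    case (Suc j)
    consider "Suc j < D" | "Suc j = D" | "Suc j > D" by linarith
    thus ?case
    proof cases
      case 2
      thus ?thesis using Suc by (auto simp: psums_Suc psums_0 shift_def)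
    next
      case 3
      hence "Suc j - D = Suc (j - D)" by simp
      thus ?thesis using Suc 3 by (simp add: psums_Suc shift_def)
    qed (use Suc in \<open>simp add: psums_Suc shift_def\<close>)
  qed (simp add: psums_0 shift_def)
qed

lemma psums_pow_shift: "(psums ^^ m) (shift D H) = shift D ((psums ^^ m) H)"
  by (induction m) (simp_all add: psums_shift)

text \<open>The hockey-stick identity.\<close>

lemma psums_choose: "psums (\<lambda>i. (i + m) choose m) j = (j + Suc m) choose Suc m"
  by (induction j) (simp_all add: psums_0 psums_Suc)

lemma psums_pow_upper:
  assumes "\<And>j. psums H j \<le> e" shows "(psums ^^ Suc m) H j \<le> e * ((j + m) choose m)"
proof (induction m arbitrary: j)
  case (Suc m)
  have "(psums ^^ Suc (Suc m)) H j = psums ((psums ^^ Suc m) H) j" by simp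
  also have "\<dots> \<le> psums (\<lambda>i. e * ((i + m) choose m)) j" by (rule psums_mono) (rule Suc.IH)
  also have "\<dots> = e * psums (\<lambda>i. (i + m) choose m) j" by (simp add: psums_def sum_distrib_left)
  finally show ?case unfolding psums_choose .
qed (use assms in simp)

text \<open>The (m + 1)-fold sum of a single 1 in degree 0 is already this binomial coefficient, so
  a proper ideal suffices for the bound.\<close>

lemma psums_pow_lower:
  assumes "H 0 \<ge> 1" shows "(j + m) choose m \<le> (psums ^^ Suc m) H j"
proof (induction m arbitrary: j)
  case 0
  have "H 0 \<le> psums H j" unfolding psums_def by (rule member_le_sum) auto
  thus ?case using assms by simp
next
  case (Suc m)
  have "psums (\<lambda>i. (i + m) choose m) j \<le> psums ((psums ^^ Suc m) H) j" by (rule psums_mono) (rule Suc.IH)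
  thus ?case unfolding psums_choose by simp
qed

section \<open>Reading the multiplicity off a Hilbert polynomial\<close>

lemma poly_eventually_unique:
  fixes P Q :: "real poly"
  assumes "\<forall>\<^sub>F j in sequentially. poly P (real j) = poly Q (real j)"
  shows "P = Q"
proof (rule ccontr)
  assume "P \<noteq> Q"
  hence fin: "finite {x. poly (P - Q) x = 0}" by (intro poly_roots_finite) simp
  obtain N where N: "\<And>j. j \<ge> N \<Longrightarrow> poly P (real j) = poly Q (real j)"
    using assms unfolding eventually_sequentially by blast
  have "real ` {N..} \<subseteq> {x. poly (P - Q) x = 0}" using N by auto
  hence "finite (real ` {N..})" using fin finite_subset by blast
  hence "finite {N..}" by (rule finite_imageD) simp
  thus False using infinite_Ici by blast
qed

lemma multiplicity_eventually_poly:
  fixes P :: "real poly"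
  assumes "P \<noteq> 0" "\<forall>\<^sub>F j in sequentially. real (H j) = poly P (real j)"
  shows "multiplicity H = fact (degree P) * lead_coeff P"
proof -
  let ?A = "\<lambda>P::real poly. P \<noteq> 0 \<and> (\<forall>\<^sub>F j in sequentially. real (H j) = poly P (real j))"
  have "(THE P. ?A P) = P"
  proof (rule the_equality)
    fix Q assume "?A Q"
    hence "\<forall>\<^sub>F j in sequentially. poly Q (real j) = poly P (real j)"
      using assms(2) by (auto elim: eventually_elim2)
    thus "Q = P" by (rule poly_eventually_unique)
  qed (use assms in simp)
  moreover have "\<exists>P. ?A P" using assms by blast
  ultimately show ?thesis unfolding multiplicity_def Let_def by simp
qed

text \<open>An eventually vanishing function agrees with no nonzero polynomial, so the summation
  branch of \<open>multiplicity\<close> applies.\<close>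

lemma multiplicity_finite:
  assumes "\<And>j. j \<ge> N \<Longrightarrow> H j = 0"
  shows "multiplicity H = real (\<Sum>j<N. H j)"
proof -
  have no: "\<not> (\<exists>P::real poly. P \<noteq> 0 \<and> (\<forall>\<^sub>F j in sequentially. real (H j) = poly P (real j)))"
  proof safe
    fix P :: "real poly"
    assume "P \<noteq> 0" and P: "\<forall>\<^sub>F j in sequentially. real (H j) = poly P (real j)"
    have "\<forall>\<^sub>F j in sequentially. H j = 0" using assms eventually_sequentially by blast
    hence "\<forall>\<^sub>F j in sequentially. poly P (real j) = poly 0 (real j)"
      using P by eventually_elim simp
    hence "P = 0" by (rule poly_eventually_unique)
    with \<open>P \<noteq> 0\<close> show False by simp
  qed
  have "suminf (\<lambda>j. real (H j)) = (\<Sum>j<N. real (H j))"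
    by (rule suminf_finite) (use assms in \<open>auto simp: not_less\<close>)
  thus ?thesis unfolding multiplicity_def if_not_P[OF no] by simp
qed

lemma lead_coeff_nonneg:
  fixes P :: "real poly"
  assumes "\<And>j. j \<ge> N \<Longrightarrow> poly P (real j) \<ge> 0"
  shows "lead_coeff P \<ge> 0"
proof (rule ccontr)
  assume "\<not> lead_coeff P \<ge> 0"
  hence pos: "lead_coeff (- P) > 0" by (simp add: lead_coeff_minus)
  then obtain n where n: "\<And>x. x \<ge> n \<Longrightarrow> poly (- P) x \<ge> lead_coeff (- P)"
    using poly_pinfty_gt_lc by blast
  obtain j where j: "real j \<ge> max n (real N)" using real_arch_simple by blast
  hence "poly (- P) (real j) > 0" using n[of "real j"] pos by linarith
  moreover have "poly P (real j) \<ge> 0" using assms[of j] j by simp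
  ultimately show False by simp
qed

text \<open>The binomial is a polynomial in j of degree m with leading coefficient 1/m!. The lower
  bound forces the Hilbert polynomial to have degree at least m, the upper bound forces degree at
  most m and leading coefficient at most e/m!.\<close>

lemma multiplicity_le:
  assumes ep: "eventually_poly H" and up: "\<And>j. H j \<le> e * ((j + m) choose m)"
    and low: "\<And>j. (j + m) choose m \<le> H j"
  shows "multiplicity H \<le> real e"
proof -
  obtain P N where P: "\<And>j. j \<ge> N \<Longrightarrow> real (H j) = poly P (real j)"
    using ep unfolding eventually_poly_def by blast
  have H1: "real (H j) \<ge> 1" for j
    using low[of j] zero_less_binomial[of m "j + m"] by linarith
  have P0: "P \<noteq> 0" using P[of N] H1[of N] by auto
  have "poly P (real j) \<ge> 0" if "j \<ge> N" for j using P[OF that, symmetric] by simp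
  hence "lead_coeff P \<ge> 0" by (rule lead_coeff_nonneg)
  moreover have "lead_coeff P \<noteq> 0" using P0 by simp
  ultimately have leadP: "lead_coeff P > 0" by linarith
  have degm: "degree P \<ge> m"
  proof (rule ccontr)
    assume "\<not> degree P \<ge> m"
    hence m: "degree P < m" by simp
    \<comment> \<open>From binomial(j + m, m) \<ge> ((j + m)/m)^m \<ge> (j/m)^m. The constant is far
      from sharp, but any positive multiple of j^m rules out a smaller degree.\<close>
    let ?c = "1 / real m ^ m" and ?M = "monom (1 / real m ^ m) m"
    have cpos: "?c > 0" using m by simp
    have dM: "degree ?M = m" using cpos by (intro degree_monom_eq) simp
    have "degree (P - ?M) = m"
      using degree_add_eq_right[of P "- ?M"] m dM by simp
    moreover have "coeff (P - ?M) m = - ?c" using m by (simp add: coeff_eq_0)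
    ultimately have "lead_coeff (P - ?M) < 0" using cpos by simp
    moreover have "lead_coeff (P - ?M) \<ge> 0"
    proof (rule lead_coeff_nonneg)
      fix j assume j: "j \<ge> N"
      have "(real j / real m) ^ m \<le> (real (j + m) / real m) ^ m"
        by (intro power_mono divide_right_mono) auto
      also have "\<dots> \<le> real ((j + m) choose m)"
        using binomial_ge_n_over_k_pow_k[of m "j + m", where ?'a = real] by simp
      also have "\<dots> \<le> poly P (real j)" using low[of j] P[OF j] by simp
      finally show "poly (P - ?M) (real j) \<ge> 0"
        by (simp add: poly_monom power_divide)
    qed
    ultimately show False by simp
  qed
  \<comment> \<open>From binomial(j + m, m) \<le> (j + m)^m / m!; here the leading coefficient e/m!
    is the sharp one.\<close>
  let ?Q = "smult (real e / fact m) ([:real m, 1:] ^ m)"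
  have Qm: "coeff ?Q m = real e / fact m"
  proof -
    have "degree ([:real m, 1:] ^ m) = m" by (simp add: degree_power_eq)
    moreover have "lead_coeff ([:real m, 1:] ^ m) = 1" by (simp add: lead_coeff_power)
    ultimately show ?thesis by simp
  qed
  have degQ: "degree ?Q \<le> m"
    using degree_smult_le[of "real e / fact m" "[:real m, 1:] ^ m"] by (simp add: degree_power_eq)
  have nonneg: "lead_coeff (?Q - P) \<ge> 0"
  proof (rule lead_coeff_nonneg)
    fix j assume j: "j \<ge> N"
    have "real (((j + m) choose m) * fact m) \<le> real ((j + m) ^ m)"
      using binomial_fact_pow[of "j + m" m] of_nat_le_iff by blast
    hence "real ((j + m) choose m) * fact m \<le> (real m + real j) ^ m"
      by (simp add: add.commute)
    hence b: "real ((j + m) choose m) \<le> (real m + real j) ^ m / fact m"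
      by (simp add: pos_le_divide_eq)
    have "poly P (real j) = real (H j)" using P[OF j] by simp
    also have "\<dots> \<le> real (e * ((j + m) choose m))" using up[of j] of_nat_le_iff by blast
    also have "\<dots> \<le> real e * ((real m + real j) ^ m / fact m)"
      unfolding of_nat_mult using b by (rule mult_left_mono) simp
    also have "\<dots> = poly ?Q (real j)" by simp
    finally show "poly (?Q - P) (real j) \<ge> 0" by simp
  qed
  have deg: "degree P = m"
  proof (rule ccontr)
    assume "degree P \<noteq> m"
    hence lt: "degree ?Q < degree P" using degm degQ by simp
    hence dQP: "degree (?Q - P) = degree P" using degree_add_eq_right[of ?Q "- P"] by simp
    have "coeff (?Q - P) (degree P) = - lead_coeff P"
      unfolding coeff_diff coeff_eq_0[OF lt] by simp
    hence "lead_coeff (?Q - P) = - lead_coeff P" unfolding dQP .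
    thus False using nonneg leadP by linarith
  qed
  have "lead_coeff P \<le> real e / fact m"
  proof (rule ccontr)
    assume "\<not> lead_coeff P \<le> real e / fact m"
    hence neg: "coeff (?Q - P) m < 0" unfolding coeff_diff Qm using deg by simp
    have "degree (?Q - P) \<le> m" using degQ deg by (intro degree_diff_le) simp_all
    moreover have "m \<le> degree (?Q - P)" using neg by (intro le_degree) simp
    ultimately have "degree (?Q - P) = m" by simp
    thus False using nonneg neg by simp
  qed
  hence "fact m * lead_coeff P \<le> real e" by (simp add: pos_le_divide_eq mult.commute)
  moreover have "multiplicity H = fact (degree P) * lead_coeff P"
    using P P0 by (intro multiplicity_eventually_poly) (auto simp: eventually_sequentially)
  ultimately show ?thesis using deg by simp
qed

section \<open>Heights of homogeneous almost complete intersections\<close>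

lemma ht_prime_le: "ht_prime n (P :: 'k::field mpoly set) \<le> enat n"
  unfolding ht_prime_def
proof (rule SUP_least)
  fix k assume "k \<in> {k. \<exists>C. (\<forall>i\<le>k. is_prime n (C i)) \<and> (\<forall>i<k. C i \<subset> C (Suc i)) \<and> C k = P}"
  then obtain C :: "nat \<Rightarrow> 'k mpoly set" where "\<forall>i\<le>k. is_prime n (C i)" "\<forall>i<k. C i \<subset> C (Suc i)" by auto
  hence "prime_chain n k C" by (simp add: prime_chain_def)
  thus "enat k \<le> enat n" using prime_chain_length_le[of n k C] by simp
qed

lemma ht_prime_ge: "prime_chain n k C \<Longrightarrow> C k = P \<Longrightarrow> enat k \<le> ht_prime n P"
  unfolding ht_prime_def prime_chain_def by (rule SUP_upper) blast

lemma ht_le: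
  assumes "is_prime n P" "I \<subseteq> P" shows "ht n I \<le> ht_prime n P"
  unfolding ht_def using assms by (intro INF_lower) simp

lemma ht_ge_homog_regular:
  assumes "homog_regular n m d f" "seq_ideal n f m \<subseteq> I" shows "enat m \<le> ht n I"
  unfolding ht_def
proof (rule INF_greatest)
  fix P assume "P \<in> {P. is_prime n P \<and> I \<subseteq> P}"
  hence "is_prime n P" "seq_ideal n f m \<subseteq> P" using assms(2) by auto
  then obtain C where "prime_chain n m C" "C m = P" using homog_regular_prime_chain[OF assms(1)] by blast
  thus "enat m \<le> ht_prime n P" by (rule ht_prime_ge)
qed

text \<open>An ideal contained in no prime has as height an infimum over the empty set, which is
  infinite; finite height thus rules out the unit ideal.\<close>

lemma ht_finite_obtains_prime:
  assumes "ht n I = enat h" obtains P where "is_prime n P" "I \<subseteq> P"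
proof -
  have "{P. is_prime n P \<and> I \<subseteq> P} \<noteq> {}"
  proof
    assume "{P. is_prime n P \<and> I \<subseteq> P} = {}"
    hence "ht n I = top" unfolding ht_def by (simp only: INF_empty)
    thus False using assms by (simp add: top_enat_def)
  qed
  thus ?thesis using that by blast
qed

text \<open>The regular sequence bounds the height from below, the number of variables bounds it
  from above.\<close>

lemma ht_artinian:
  fixes I :: "'k::field mpoly set"
  assumes f: "homog_regular h h d f" "seq_ideal h f h \<subseteq> I" and I: "is_ideal h I" "1 \<notin> I"
  shows "ht h I = enat h"
proof (rule antisym)
  obtain P where P: "is_prime h P" "I \<subseteq> P"
  proof (rule exists_prime_avoiding[OF I(1), of "{1}"])
    show "I \<inter> {1} = {}" using I(2) by blast
  qed auto
  show "ht h I \<le> enat h" using ht_le[OF P] ht_prime_le order.trans by blast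
  show "enat h \<le> ht h I" by (rule ht_ge_homog_regular[OF f])
qed

section \<open>The main theorem\<close>

lemma raise_degree:
  fixes f :: "nat \<Rightarrow> 'k::field mpoly"
  assumes inf: "infinite (UNIV :: 'k set)" and f: "homog_regular h h d f"
    and G: "G \<in> forms h D'" "G \<notin> seq_ideal h f h" and D: "D' \<le> D" "D \<le> (\<Sum>i<h. d i - 1)"
  shows "\<exists>G'. G' \<in> forms h D \<and> G' \<notin> seq_ideal h f h
    \<and> colon h (seq_ideal h f h) G \<subseteq> colon h (seq_ideal h f h) G'"
  using D
proof (induction D rule: dec_induct)
  case base
  thus ?case using G by blast
next
  case (step D)
  let ?J = "seq_ideal h f h"
  have J: "is_ideal h ?J" using hideal_is_ideal[OF homog_regular_hideal[OF f]] by simp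
  obtain G' where G': "G' \<in> forms h D" "G' \<notin> ?J" "colon h ?J G \<subseteq> colon h ?J G'"
    using step by auto
  have "D \<noteq> (\<Sum>i<h. d i - 1)" using step by simp
  then obtain i where i: "i < h" "var i * G' \<notin> ?J"
    using socle_complete_intersection[OF inf f order.refl] G'(1,2) by blast
  have v: "var i \<in> forms h 1" using i(1) by (rule var_forms)
  have "var i * G' \<in> forms h (Suc D)" using forms_mult[OF v G'(1)] by simp
  moreover have "colon h ?J G' \<subseteq> colon h ?J (var i * G')"
    using is_idealD(5)[OF J forms_polyring[OF v]] by (auto simp: colon_def mult.assoc)
  ultimately show ?case using G'(3) i(2) by blast
qed

theorem theorem2p7:
  fixes n h D :: nat and d :: "nat \<Rightarrow> nat" and f :: "nat \<Rightarrow> 'k::field mpoly"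
    and G :: "'k mpoly" and a :: "'k mpoly set"
  assumes "infinite (UNIV :: 'k set)"
    and "aci n h d D f G a"
    and "D \<le> (\<Sum>i<h. d i - 1)"
  shows "\<exists>(fb :: nat \<Rightarrow> 'k mpoly) (Gb :: 'k mpoly) (ab :: 'k mpoly set). aci h h d D fb Gb ab \<and> artinian h ab
           \<and> (\<forall>j::int. HF n a j \<le> HF n (ideal_gen n ab) j)
           \<and> multiplicity (\<lambda>j. HF n a (int j)) \<le> multiplicity (\<lambda>j. HF h ab (int j))"
proof -
  note inf = assms(1)
  let ?\<sigma> = "\<Sum>i<h. d i - 1"
  have fn: "homog_regular n h d f" and mono: "\<forall>i j. i \<le> j \<longrightarrow> j < h \<longrightarrow> d i \<le> d j"
    and G: "G \<in> forms n D" "G \<notin> seq_ideal n f h"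
    and a_def: "a = ideal_gen n (f ` {..<h} \<union> {G})" and hta: "ht n a = enat h"
    using assms(2) by (auto simp: aci_def homog_regular_def forms_def)
  define J where "J = seq_ideal n f h"
  have J: "hideal n J" using homog_regular_hideal[OF fn] by (simp add: J_def)
  note Jid = hideal_is_ideal[OF J]
  have fP: "f ` {..<h} \<subseteq> polyring n" using homog_regular_forms[OF fn] forms_polyring by blast
  have a: "a = adjoin n J G"
    unfolding a_def J_def using ideal_gen_insert[OF fP forms_polyring[OF G(1)]] by simp
  have ha: "hideal n a" unfolding a by (rule hideal_adjoin[OF J G(1)])
  have Ja: "J \<subseteq> a" unfolding a by (rule adjoin_superset[OF Jid])
  obtain P0 where P0: "is_prime n P0" "a \<subseteq> P0" using ht_finite_obtains_prime[OF hta] .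
  have "h \<le> n" using hta ht_le[OF P0] ht_prime_le[of n P0] by (metis enat_ord_simps(1) order.trans)
  then obtain m where n: "n = h + m" using le_Suc_ex by blast
  \<comment> \<open>A form of degree 0 outside J is a nonzero constant and would make a the unit
    ideal. Positivity later keeps 1 out of \<open>ab\<close> and lets G extend a regular
    sequence.\<close>
  have D: "D > 0"
  proof (rule ccontr)
    assume "\<not> D > 0"
    then obtain c where c: "G = const_mp c" using forms_deg_0[of G n] G(1) by auto
    have "c \<noteq> 0" using G(2) c hidealD(2)[OF J] by (auto simp: J_def)
    have "G * const_mp (1 / c) \<in> a" unfolding a by (rule adjoin_base[OF Jid polyring_const])
    hence "1 \<in> a" using \<open>c \<noteq> 0\<close> by (simp add: c mult_single)
    thus False using is_primeD(2)[OF P0(1)] P0(2) by blast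
  qed
  obtain g :: "nat \<Rightarrow> 'k mpoly" where g: "homog_regular h h d g"
    "\<And>j. hf n J j = (psums ^^ m) (hf h (seq_ideal h g h)) j"
    and cut: "\<And>D G. G \<in> forms n D \<Longrightarrow> G \<notin> J \<Longrightarrow>
         \<exists>D' G'. D' \<le> D \<and> G' \<in> forms h D' \<and> G' \<notin> seq_ideal h g h \<and>
           (\<forall>j. (psums ^^ m) (hf h (colon h (seq_ideal h g h) G')) j \<le> hf n (colon n J G) j)"
    using cut_to_artinian[OF inf, of h m d f] fn unfolding n J_def by metis
  define K where "K = seq_ideal h g h"
  have K: "hideal h K" using homog_regular_hideal[OF g(1)] by (simp add: K_def)
  note Kid = hideal_is_ideal[OF K]
  obtain D' G' where G': "D' \<le> D" "G' \<in> forms h D'" "G' \<notin> K"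
    "\<And>j. (psums ^^ m) (hf h (colon h K G')) j \<le> hf n (colon n J G) j"
    using cut[OF G(1)] G(2) unfolding K_def J_def by blast
  obtain Gb where Gb: "Gb \<in> forms h D" "Gb \<notin> K" "colon h K G' \<subseteq> colon h K Gb"
    using raise_degree[OF inf g(1) G'(2) _ G'(1) assms(3)] G'(3) unfolding K_def by blast
  define gens where "gens = g ` {..<h} \<union> {Gb}"
  define ab where "ab = ideal_gen h gens"
  have gensV: "\<exists>e>0. x \<in> forms h e" if "x \<in> gens" for x
    using that homog_regular_forms[OF g(1)] homog_regular_deg_pos[OF g(1)] Gb(1) D unfolding gens_def by blast
  have gP: "g ` {..<h} \<subseteq> polyring h" using homog_regular_forms[OF g(1)] forms_polyring by blast
  have ab: "ab = adjoin h K Gb"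
    unfolding ab_def gens_def K_def using ideal_gen_insert[OF gP forms_polyring[OF Gb(1)]] by simp
  have hab: "hideal h ab" unfolding ab by (rule hideal_adjoin[OF K Gb(1)])
  have Kab: "K \<subseteq> ab" unfolding ab by (rule adjoin_superset[OF Kid])
  have one_ab: "1 \<notin> ab"
  proof
    assume "1 \<in> ab"
    moreover have "\<exists>e>0. homog x e" if "x \<in> gens" for x
      using gensV[OF that] by (auto simp: forms_def)
    ultimately have "hcomp 0 (1 :: 'k mpoly) = 0" unfolding ab_def by (intro hcomp_0_ideal_gen)
    thus False by (simp add: hcomp_homog[OF homog_1])
  qed
  have ht_ab: "ht h ab = enat h"
    by (rule ht_artinian[OF g(1) _ hideal_is_ideal[OF hab] one_ab]) (use Kab in \<open>simp add: K_def\<close>)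
  have aci_ab: "aci h h d D g Gb ab"
    unfolding aci_def using g(1) mono Gb(1,2) ht_ab
    by (auto simp: homog_regular_def forms_def K_def ab_def gens_def)
  have zero: "hf h ab j = 0" if "j > ?\<sigma>" for j
  proof -
    have "hf h ab j \<le> hf h K j"
      using Kab by (intro hf_antimono hideal_subspace[OF K] hideal_subspace[OF hab]) blast
    moreover have "hf h K j = 0"
      using socle_complete_intersection[OF inf g(1) order.refl] that unfolding K_def by blast
    ultimately show ?thesis by simp
  qed
  have art: "artinian h ab"
    unfolding artinian_def using zero by (intro exI[of _ "Suc ?\<sigma>"]) simp
  \<comment> \<open>Written as a sum instead of a difference, so that it passes through the additive
    operator \<open>psums\<close>; the shift covers the degrees below D uniformly.\<close>
  have adjoin_split: "hf n' I j = hf n' (adjoin n' I x) j + shift D (hf n' (colon n' I x)) j"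
    if "hideal n' I" "x \<in> forms n' D" for n' j and I :: "'k mpoly set" and x
  proof (cases "j < D")
    case True
    thus ?thesis using hf_adjoin_low[OF that True] by (simp add: shift_def)
  next
    case False
    thus ?thesis using hf_adjoin[OF that, of "j - D"] by (simp add: shift_def)
  qed
  have hf_le: "hf n a j \<le> (psums ^^ m) (hf h ab) j" for j
  proof -
    have le: "hf h (colon h K Gb) i \<le> hf h (colon h K G') i" for i
      using Gb(3) by (intro hf_antimono hideal_subspace[OF hideal_colon[OF K G'(2)]]
          hideal_subspace[OF hideal_colon[OF K Gb(1)]]) blast
    have pow: "(psums ^^ m) (hf h (colon h K Gb)) i \<le> hf n (colon n J G) i" for i
      by (rule order.trans[OF psums_pow_mono[OF le] G'(4)])
    have 1: "(psums ^^ m) (shift D (hf h (colon h K Gb))) j \<le> shift D (hf n (colon n J G)) j"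
    proof (cases "j < D")
      case False
      thus ?thesis using pow[of "j - D"] unfolding psums_pow_shift by (simp add: shift_def)
    qed (simp add: psums_pow_shift shift_def)
    \<comment> \<open>The decomposition for K, summed m times, and the one for J have the same
      left-hand side; the colon term of J is the larger one, so the remaining term for a is the
      smaller one.\<close>
    have "hf h K = (\<lambda>i. hf h ab i + shift D (hf h (colon h K Gb)) i)"
      unfolding ab by (rule ext) (rule adjoin_split[OF K Gb(1)])
    hence "hf n J j = (psums ^^ m) (hf h ab) j + (psums ^^ m) (shift D (hf h (colon h K Gb))) j"
      using g(2)[of j] psums_pow_add unfolding K_def[symmetric] by simp
    thus ?thesis using 1 adjoin_split[OF J G(1), of j] unfolding a by linarith
  qed
  have gensP: "gens \<subseteq> polyring h" using gensV forms_polyring by blast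
  have ext: "hf n (ideal_gen n ab) j = (psums ^^ m) (hf h ab) j" for j
  proof -
    have "ideal_gen n ab = ideal_gen n gens"
      unfolding ab_def using n gensP by (intro ideal_gen_ideal_gen) simp_all
    moreover have "\<exists>e. x \<in> forms h e" if "x \<in> gens" for x using gensV[OF that] by blast
    ultimately show ?thesis using hf_extend_pow[of gens h m j] unfolding ab_def n by simp
  qed
  have HF_le: "HF n a j \<le> HF n (ideal_gen n ab) j" for j :: int
  proof (cases "j < 0")
    case True thus ?thesis by (simp add: HF_def)
  next
    case False
    then obtain k where "j = int k" using nonneg_int_cases[of j] by auto
    thus ?thesis using hf_le[of k] ext[of k] by simp
  qed
  \<comment> \<open>The length of the Artinian quotient: nothing is left beyond the degree
    ?\<sigma>.\<close>
  define e where "e = (\<Sum>j<Suc ?\<sigma>. hf h ab j)"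
  have mult_ab: "multiplicity (hf h ab) = real e"
    unfolding e_def by (rule multiplicity_finite) (use zero in simp)
  have "multiplicity (hf n a) \<le> real e"
  \<comment> \<open>For m = 0 both quotients have finite length and the multiplicities are plain
    sums. For m = m' + 1 the Hilbert polynomial has degree m'.\<close>
  proof (cases m)
    case 0
    hence le: "hf n a j \<le> hf h ab j" for j using hf_le[of j] by simp
    have "multiplicity (hf n a) = real (\<Sum>j<Suc ?\<sigma>. hf n a j)"
      by (rule multiplicity_finite) (use zero le in \<open>metis Suc_le_eq le_zero_eq\<close>)
    also have "\<dots> \<le> real e" unfolding e_def of_nat_le_iff by (rule sum_mono) (rule le)
    finally show ?thesis .
  next
    case (Suc m')
    have psums_e: "psums (hf h ab) j \<le> e" for j
    proof -
      have "(\<Sum>i\<le>j. hf h ab i) = (\<Sum>i\<in>{..j} \<inter> {..<Suc ?\<sigma>}. hf h ab i)"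
        using zero not_less_eq by (intro sum.mono_neutral_right) (simp, simp, blast)
      also have "\<dots> \<le> e" unfolding e_def by (rule sum_mono2) auto
      finally show ?thesis unfolding psums_def .
    qed
    have up: "hf n a j \<le> e * ((j + m') choose m')" for j
      using hf_le[of j] psums_pow_upper[OF psums_e, of m' j] Suc by simp
    have "\<not> nzd n J G"
    proof
      assume nz: "nzd n J G"
      let ?f = "f(h := G)" and ?d = "d(h := D)"
      have im: "?f ` {..<h} = f ` {..<h}" by (rule image_cong) auto
      have "homog_regular n h ?d ?f"
        using fn im unfolding homog_regular_def regular_seq_def by (auto simp: image_def)
      hence r: "homog_regular n (Suc h) ?d ?f"
        using G(1) D nz homog_regular_deg_pos[OF fn] by (intro homog_regular_SucI) (auto simp: im J_def)
      have "?f ` {..<Suc h} = f ` {..<h} \<union> {G}"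
        unfolding lessThan_Suc image_insert im by simp
      hence "seq_ideal n ?f (Suc h) = a" unfolding a_def by (rule arg_cong)
      hence "enat (Suc h) \<le> ht n a" using ht_ge_homog_regular[OF r] by simp
      thus False using hta by simp
    qed
    then obtain j0 v where v: "v \<in> forms n j0" "G * v \<in> J" "v \<notin> J"
      using nzd_homogI[OF J G(1)] by blast
    obtain D1 v' where v': "v' \<in> forms h D1" "v' \<notin> K"
      "\<And>j. (psums ^^ m) (hf h (colon h K v')) j \<le> hf n (colon n J v) j"
      using cut[OF v(1,3)] unfolding K_def by blast
    have low: "(j + m') choose m' \<le> hf n a j" for j
    proof -
      \<comment> \<open>As v' is outside K, 1 is outside (K : v'); this positive value in degree 0
        starts \<open>psums_pow_lower\<close>.\<close>
      have "1 \<in> forms h 0" "1 \<notin> colon h K v'" using v'(2) by (simp_all add: forms_def colon_def)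
      hence "\<not> forms h 0 \<subseteq> colon h K v'" by blast
      hence "hf h (colon h K v') 0 \<ge> 1"
        using hf_pos_iff[OF hideal_subspace[OF hideal_colon[OF K v'(1)]], of h 0] by linarith
      hence "(j + m') choose m' \<le> (psums ^^ m) (hf h (colon h K v')) j"
        unfolding Suc by (rule psums_pow_lower)
      also have "\<dots> \<le> hf n (colon n J v) j" by (rule v'(3))
      also have "\<dots> \<le> hf n a j"
      proof (intro hf_antimono hideal_subspace[OF ha] hideal_subspace[OF hideal_colon[OF J v(1)]])
        have "is_ideal n (colon n J v)"
          by (rule is_ideal_colon[OF Jid forms_polyring[OF v(1)]])
        moreover have "J \<subseteq> colon n J v" by (rule colon_superset[OF Jid forms_polyring[OF v(1)]])
        moreover have "G \<in> colon n J v"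
          using v(2) forms_polyring[OF G(1)] by (simp add: colon_def mult.commute)
        ultimately show "a \<inter> forms n j \<subseteq> colon n J v" unfolding a using adjoin_minimal by blast
      qed
      finally show ?thesis .
    qed
    show ?thesis by (rule multiplicity_le[OF hilbert_polynomial[OF ha] up low])
  qed
  thus ?thesis using aci_ab art HF_le mult_ab by (intro exI[of _ g] exI[of _ Gb] exI[of _ ab]) simp
qed

end
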